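(* Let $N\ge 2$, let $\Omega\subset\mathbb{R}^N$ be a smooth and bounded domain, let $a\in C(\overline{\Omega})$ with $a\ge 0$, and let $f\in C(\mathbb{R})$. Suppose that: (a1) $a^{-1}(0)=\bigcup_{l=1}^{k}\Gamma_l\subset\Omega$ is the disjoint union of a finite number $k$ of compact, connected, without boundary and $1$-codimensional smooth submanifolds $\Gamma_l$ of $\mathbb{R}^N$; (a2) $a$ belongs to the Muckenhoupt class $A_2$, and $1/a\in L^{t}(\Omega)$ for some $t>N/2$; (f1) $f$ has a strict local minimum in $s=0$ with $f(0)=0$, and there exists $s_*>0$ such that $f(s_* )=0$ and $f>0$ in $(0,s_* )$; (f2) there exists $\gamma=\lim_{s\to 0^+} f(s)/s>0$, and $\max_{x\in\overline{D_j}}a(x)<\gamma/\lambda_1(D_j)$, where $D_j$ stands for any connected component of $\Omega\setminus a^{-1}(0)$ and $\lambda_1(D_j)$ is the first eigenvalue of the Dirichlet Laplacian in $D_j$. Let $\chi$ be the number of connected components of $\Omega\setminus a^{-1}(0)$. Then the problem $$ -\operatorname{div}(a(x)\nabla u)=f(u)\ \text{ in }\Omega,\qquad u=0\ \text{ on }\partial\Omega\cup a^{-1}(0) $$ has at least $2^{\chi}-1$ nonnegative (and nontrivial) weak solutions. More specifically, the number of positive solutions with $n$ bumps, $n\in\{1,\dots,\chi\}$, is given by the binomial coefficient $\frac{\chi!}{n!(\chi-n)!}$.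
   Context: Muckenhoupt class $A_2$: a function $h:\Omega\to[0,+\infty)$ belongs to $A_2$ if there is a constant $C$ such that $$\sup_{B}\left(\frac{1}{|B|}\int_B h(x)\,dx\right)\left(\frac{1}{|B|}\int_B h(x)^{-1}\,dx\right)\le C,$$ where the supremum is taken over all balls $B\subset\Omega$. Weak solution: a weak solution of the problem is a function $u_*\in W^{1,1}_0(\Omega\setminus a^{-1}(0))\cap L^\infty(\Omega)$ such that $$\int_\Omega a(x)\nabla u_*\cdot\nabla\varphi\,dx=\int_\Omega f(u_* )\varphi\,dx\qquad\text{for all }\varphi\in C_c^\infty(\Omega\setminus a^{-1}(0)).$$ Here $W^{1,1}_0(U)$ is the usual Sobolev space, the closure of $C_c^\infty(U)$ in $W^{1,1}(U)$. Bumps: the term is not formally defined in the paper. There, the solutions with $n$ bumps are obtained as sums of $n$ functions, each being the extension by zero to $\Omega$ of a nonnegative, nontrivial weak solution of the same equation, with zero Dirichlet data, on one connected component of $\Omega\setminus a^{-1}(0)$, the $n$ components being distinct. *)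

theory Defs
  imports "HOL-Analysis.Analysis"
begin

section \<open>Smooth functions, hypersurfaces and domains\<close>

text \<open>
  \<open>C_on k S f\<close> is the usual \<open>C\<^sup>k\<close> regularity; it is meant for open \<open>S\<close> in a
  finite-dimensional space, where existence and continuity of all iterated
  directional derivatives suffices.
\<close>

primrec C_on :: "nat \<Rightarrow> 'a::euclidean_space set \<Rightarrow> ('a \<Rightarrow> 'b::euclidean_space) \<Rightarrow> bool" where
  "C_on 0 S f \<longleftrightarrow> continuous_on S f"
| "C_on (Suc k) S f \<longleftrightarrow>
     (\<forall>x\<in>S. f differentiable (at x)) \<and>
     (\<forall>v. C_on k S (\<lambda>x. frechet_derivative f (at x) v))"

definition smooth_on :: "'a::euclidean_space set \<Rightarrow> ('a \<Rightarrow> 'b::euclidean_space) \<Rightarrow> bool" where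
  "smooth_on S f \<longleftrightarrow> (\<forall>k. C_on k S f)"

definition diffeomorphism ::
    "'a::euclidean_space set \<Rightarrow> 'a set \<Rightarrow> ('a \<Rightarrow> 'a) \<Rightarrow> ('a \<Rightarrow> 'a) \<Rightarrow> bool" where
  "diffeomorphism U V \<Phi> \<Psi> \<longleftrightarrow>
     open U \<and> open V \<and> homeomorphism U V \<Phi> \<Psi> \<and> smooth_on U \<Phi> \<and> smooth_on V \<Psi>"

text \<open>Embedded 1-codimensional submanifold without boundary, by slice charts.\<close>

definition smooth_hypersurface :: "'a::euclidean_space set \<Rightarrow> bool" where
  "smooth_hypersurface M \<longleftrightarrow>
     (\<forall>p\<in>M. \<exists>U V \<Phi> \<Psi>. \<exists>e\<in>Basis. p \<in> U \<and> diffeomorphism U V \<Phi> \<Psi> \<and>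
        \<Phi> ` (U \<inter> M) = {y\<in>V. y \<bullet> e = 0})"

definition smooth_boundary :: "'a::euclidean_space set \<Rightarrow> bool" where
  "smooth_boundary \<Omega> \<longleftrightarrow>
     (\<forall>p\<in>frontier \<Omega>. \<exists>U V \<Phi> \<Psi>. \<exists>e\<in>Basis. p \<in> U \<and> diffeomorphism U V \<Phi> \<Psi> \<and>
        \<Phi> ` (U \<inter> \<Omega>) = {y\<in>V. y \<bullet> e > 0} \<and>
        \<Phi> ` (U \<inter> frontier \<Omega>) = {y\<in>V. y \<bullet> e = 0})"

definition smooth_bounded_domain :: "'a::euclidean_space set \<Rightarrow> bool" where
  "smooth_bounded_domain \<Omega> \<longleftrightarrow>
     open \<Omega> \<and> connected \<Omega> \<and> \<Omega> \<noteq> {} \<and> bounded \<Omega> \<and> smooth_boundary \<Omega>"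


section \<open>Lebesgue and Sobolev spaces\<close>

definition Lp_on :: "real \<Rightarrow> 'a::euclidean_space set \<Rightarrow> ('a \<Rightarrow> 'b::euclidean_space) \<Rightarrow> bool" where
  "Lp_on p U h \<longleftrightarrow>
     h \<in> borel_measurable (lebesgue_on U) \<and>
     integrable (lebesgue_on U) (\<lambda>x. norm (h x) powr p)"

definition Linf_on :: "'a::euclidean_space set \<Rightarrow> ('a \<Rightarrow> real) \<Rightarrow> bool" where
  "Linf_on U h \<longleftrightarrow>
     h \<in> borel_measurable (lebesgue_on U) \<and>
     (\<exists>K. AE x in lebesgue_on U. \<bar>h x\<bar> \<le> K)"

definition test_functions :: "'a::euclidean_space set \<Rightarrow> ('a \<Rightarrow> real) set" where
  "test_functions U =
     {\<phi>. smooth_on UNIV \<phi> \<and> compact (closure {x. \<phi> x \<noteq> 0}) \<and> closure {x. \<phi> x \<noteq> 0} \<subseteq> U}"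

definition grad :: "('a::euclidean_space \<Rightarrow> real) \<Rightarrow> 'a \<Rightarrow> 'a" where
  "grad \<phi> x = (\<Sum>b\<in>Basis. frechet_derivative \<phi> (at x) b *\<^sub>R b)"

definition weak_gradient :: "'a::euclidean_space set \<Rightarrow> ('a \<Rightarrow> real) \<Rightarrow> ('a \<Rightarrow> 'a) \<Rightarrow> bool" where
  "weak_gradient U u g \<longleftrightarrow>
     (\<forall>\<phi>\<in>test_functions U. \<forall>b\<in>Basis.
        (\<integral>x. u x * (grad \<phi> x \<bullet> b) \<partial>lebesgue_on U) =
        - (\<integral>x. (g x \<bullet> b) * \<phi> x \<partial>lebesgue_on U))"

text \<open>
  \<open>W1p p U u g\<close> says that \<open>u\<close> lies in \<open>W\<^sup>1\<^sup>,\<^sup>p(U)\<close> and that \<open>g\<close> represents its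
  (almost everywhere unique) weak gradient.  \<open>W1p_0\<close> is the closure of the test
  functions with respect to the \<open>W\<^sup>1\<^sup>,\<^sup>p\<close> norm.
\<close>

definition W1p :: "real \<Rightarrow> 'a::euclidean_space set \<Rightarrow> ('a \<Rightarrow> real) \<Rightarrow> ('a \<Rightarrow> 'a) \<Rightarrow> bool" where
  "W1p p U u g \<longleftrightarrow> Lp_on p U u \<and> Lp_on p U g \<and> weak_gradient U u g"

definition W1p_0 :: "real \<Rightarrow> 'a::euclidean_space set \<Rightarrow> ('a \<Rightarrow> real) \<Rightarrow> ('a \<Rightarrow> 'a) \<Rightarrow> bool" where
  "W1p_0 p U u g \<longleftrightarrow> W1p p U u g \<and>
     (\<forall>\<epsilon>>0. \<exists>\<phi>\<in>test_functions U.
        ((\<integral>x. \<bar>u x - \<phi> x\<bar> powr p \<partial>lebesgue_on U) +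
         (\<integral>x. norm (g x - grad \<phi> x) powr p \<partial>lebesgue_on U)) powr (1 / p) < \<epsilon>)"


section \<open>The Muckenhoupt class and the first Dirichlet eigenvalue\<close>

text \<open>
  The averages are taken in \<open>[0, \<infinity>]\<close>, with \<open>h\<^sup>-\<^sup>1 = \<infinity>\<close> where \<open>h = 0\<close>.  The convention
  \<open>0 * \<infinity> = 0\<close> only matters for an \<open>h\<close> that vanishes almost everywhere on a ball.
\<close>

definition muckenhoupt_A2 :: "'a::euclidean_space set \<Rightarrow> ('a \<Rightarrow> real) \<Rightarrow> bool" where
  "muckenhoupt_A2 \<Omega> h \<longleftrightarrow>
     (\<forall>x\<in>\<Omega>. 0 \<le> h x) \<and>
     (\<exists>C::real. \<forall>z r. 0 < r \<longrightarrow> ball z r \<subseteq> \<Omega> \<longrightarrow>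
        ((\<integral>\<^sup>+x\<in>ball z r. ennreal (h x) \<partial>lebesgue) / emeasure lebesgue (ball z r)) *
        ((\<integral>\<^sup>+x\<in>ball z r. inverse (ennreal (h x)) \<partial>lebesgue) / emeasure lebesgue (ball z r))
        \<le> ennreal C)"

definition dirichlet_eigenvalue :: "'a::euclidean_space set \<Rightarrow> real \<Rightarrow> bool" where
  "dirichlet_eigenvalue D \<mu> \<longleftrightarrow>
     (\<exists>u g. W1p_0 2 D u g \<and> \<not> (AE x in lebesgue_on D. u x = 0) \<and>
        (\<forall>\<phi>\<in>test_functions D.
           (\<integral>x. g x \<bullet> grad \<phi> x \<partial>lebesgue_on D) = \<mu> * (\<integral>x. u x * \<phi> x \<partial>lebesgue_on D)))"

definition first_eigenvalue :: "'a::euclidean_space set \<Rightarrow> real" where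
  "first_eigenvalue D = (LEAST \<mu>. dirichlet_eigenvalue D \<mu>)"


section \<open>Weak solutions and bumps\<close>

definition weak_solution ::
    "'a::euclidean_space set \<Rightarrow> ('a \<Rightarrow> real) \<Rightarrow> (real \<Rightarrow> real) \<Rightarrow> ('a \<Rightarrow> real) \<Rightarrow> bool" where
  "weak_solution \<Omega> a f u \<longleftrightarrow>
     Linf_on \<Omega> u \<and>
     (\<exists>g. W1p_0 1 (\<Omega> - a -` {0}) u g \<and>
        (\<forall>\<phi>\<in>test_functions (\<Omega> - a -` {0}).
           (\<integral>x. a x * (g x \<bullet> grad \<phi> x) \<partial>lebesgue_on \<Omega>) =
           (\<integral>x. f (u x) * \<phi> x \<partial>lebesgue_on \<Omega>)))"

definition nonneg_nontrivial_weak_solution ::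
    "'a::euclidean_space set \<Rightarrow> ('a \<Rightarrow> real) \<Rightarrow> (real \<Rightarrow> real) \<Rightarrow> ('a \<Rightarrow> real) \<Rightarrow> bool" where
  "nonneg_nontrivial_weak_solution \<Omega> a f u \<longleftrightarrow>
     weak_solution \<Omega> a f u \<and>
     (AE x in lebesgue_on \<Omega>. 0 \<le> u x) \<and>
     \<not> (AE x in lebesgue_on \<Omega>. u x = 0)"

text \<open>
  \<open>u\<close> is a sum of \<open>n\<close> functions, each the extension by zero of a nonnegative,
  nontrivial weak solution on one of \<open>n\<close> distinct components \<open>D\<close>.  As \<open>a \<noteq> 0\<close> on \<open>D\<close>,
  a weak solution on \<open>D\<close> is one in \<open>W\<^sup>1\<^sup>,\<^sup>1\<^sub>0(D)\<close>, tested against all test functions on \<open>D\<close>.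
\<close>

definition has_bumps ::
    "'a::euclidean_space set \<Rightarrow> ('a \<Rightarrow> real) \<Rightarrow> (real \<Rightarrow> real) \<Rightarrow> nat \<Rightarrow> ('a \<Rightarrow> real) \<Rightarrow> bool" where
  "has_bumps \<Omega> a f n u \<longleftrightarrow>
     (\<exists>\<D> w. \<D> \<subseteq> components (\<Omega> - a -` {0}) \<and> finite \<D> \<and> card \<D> = n \<and>
        (\<forall>D\<in>\<D>. nonneg_nontrivial_weak_solution D a f (w D)) \<and>
        (AE x in lebesgue_on \<Omega>. u x = (\<Sum>D\<in>\<D>. if x \<in> D then w D x else 0)))"

end

theory Submission
  imports Defs "HOL-Complex_Analysis.Great_Picard"
begin

text \<open>
  On each component \<open>D\<close> a solution is obtained by minimising
  \<open>J(\<phi>) = 1/2 \<integral> a |\<nabla>\<phi>|\<^sup>2 - \<integral> F(\<phi>)\<close> over the test functions of \<open>D\<close>, where \<open>F\<close> is the even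
  primitive of \<open>f\<close> cut off outside \<open>[0, s0]\<close>.  A smooth truncation close to \<open>min |s| s0\<close> makes a
  minimising sequence essentially \<open>[0, s0]\<close>-valued without increasing \<open>J\<close> in the limit; as \<open>1/a\<close> is
  integrable, Rellich's theorem gives strong \<open>L\<^sup>2\<close> convergence of a subsequence, and then the parallelogram
  identity gives strong convergence of the gradients in the weighted \<open>L\<^sup>2\<close> space.  The limit satisfies the
  Euler-Lagrange equation, and it is nontrivial because the condition on the first eigenvalue makes the
  infimum of \<open>J\<close> negative.  The same minimisation with \<open>a = 1\<close> and quadratic \<open>F\<close> shows that the infimum of
  the Rayleigh quotient is an eigenvalue, hence the least one.

  Each hypersurface has two local sides, so by compactness there are finitely many components; the
  \<open>2\<^sup>\<chi> - 1\<close> solutions are the sums over the nonempty sets of components of the extensions by zero.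
  Restricting a test function to one component yields a test function again, hence these sums are solutions.
\<close>

section \<open>Smooth functions and test functions\<close>

text \<open>The obstacle is that \<open>a\<close> vanishes on the hypersurfaces, so that bounded
  energy controls gradients only in L^1, which by itself gives no compactness in L^2. The truncation
  supplies what is missing: for uniformly bounded \<open>\<psi>\<close> the gradient of
  \<open>\<psi> * \<bar>\<psi>\<bar>\<close> is bounded in L^1 too, and compactness of these
  products is L^2 compactness of \<open>\<psi>\<close>. Taking the infimum over test functions makes
  it unnecessary to build a weighted Sobolev space. The price is that truncations must be smooth,
  hence the regularised absolute value, and that the minimising sequence takes values in
  \<open>[0, s0]\<close> only up to an error tending to zero. Weak convergence is avoided: the
  gradient term is quadratic and the potential is continuous in L^2, so comparison with midpoints
  gives strong convergence. The number of bumps is unambiguous because no summand vanishes almost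
  everywhere on its component: two sums over different families differ on a set of positive measure,
  whichever solutions are chosen on the components.\<close>

lemma C_on_SucI:
  assumes "\<And>x. (f has_derivative F x) (at x)" "\<And>v. C_on k UNIV (\<lambda>x. F x v)"
  shows "C_on (Suc k) UNIV f"
proof -
  have "frechet_derivative f (at x) = F x" for x
    using frechet_derivative_at[OF assms(1)[of x]] by simp
  then show ?thesis
    using assms by (auto simp: differentiable_def)
qed

lemma C_on_SucD:
  assumes "C_on (Suc k) UNIV f"
  shows "(f has_derivative frechet_derivative f (at x)) (at x)"
    "C_on k UNIV (\<lambda>x. frechet_derivative f (at x) v)"
  using assms by (auto simp: frechet_derivative_works[symmetric])

lemma C_on_Suc_imp: "C_on (Suc k) UNIV f \<Longrightarrow> C_on k UNIV f"
proof (induction k arbitrary: f)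
  case 0
  then show ?case
    by (auto intro!: differentiable_imp_continuous_on simp: differentiable_on_def)
next
  case (Suc k)
  have "C_on k UNIV (\<lambda>x. frechet_derivative f (at x) v)" for v
    by (rule Suc.IH) (rule C_on_SucD(2)[OF Suc.prems])
  with Suc.prems show ?case by auto
qed

lemma C_on_const: "C_on k UNIV (\<lambda>x. c)"
  by (induction k arbitrary: c) auto

section \<open>Closure properties of C^k functions\<close>

lemma C_on_add:
  "C_on k UNIV f \<Longrightarrow> C_on k UNIV g \<Longrightarrow> C_on k UNIV (\<lambda>x. f x + g x)"
proof (induction k arbitrary: f g)
  case 0
  then show ?case by (auto intro!: continuous_intros)
next
  case (Suc k)
  show ?case
    by (rule C_on_SucI[OF has_derivative_add[OF C_on_SucD(1)[OF Suc.prems(1)] C_on_SucD(1)[OF Suc.prems(2)]]])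
      (intro Suc.IH C_on_SucD(2)[OF Suc.prems(1)] C_on_SucD(2)[OF Suc.prems(2)])
qed

lemma C_on_mult:
  fixes f g :: "'a::euclidean_space \<Rightarrow> real"
  shows "C_on k UNIV f \<Longrightarrow> C_on k UNIV g \<Longrightarrow> C_on k UNIV (\<lambda>x. f x * g x)"
proof (induction k arbitrary: f g)
  case 0
  then show ?case by (auto intro!: continuous_intros)
next
  case (Suc k)
  show ?case
    by (rule C_on_SucI[OF has_derivative_mult[OF C_on_SucD(1)[OF Suc.prems(1)] C_on_SucD(1)[OF Suc.prems(2)]]])
      (intro C_on_add Suc.IH C_on_SucD(2)[OF Suc.prems(1)] C_on_SucD(2)[OF Suc.prems(2)]
         C_on_Suc_imp[OF Suc.prems(1)] C_on_Suc_imp[OF Suc.prems(2)])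
qed

lemma C_on_inner_left: "C_on k UNIV (\<lambda>x. x \<bullet> b)"
proof (cases k)
  case (Suc j)
  have "((\<lambda>x. x \<bullet> b) has_derivative (\<lambda>h. h \<bullet> b)) (at x)" for x :: 'a
    by (auto intro!: derivative_eq_intros)
  from C_on_SucI[OF this] show ?thesis
    unfolding Suc by (simp add: C_on_const)
qed (auto intro!: continuous_intros)

text \<open>Differentiation stays inside the family \<open>H\<close> and only moves the index from
  \<open>p\<close> to \<open>d p\<close>, so the induction on \<open>k\<close> leaves
  \<open>p\<close> arbitrary. For \<open>H = flat\<close> the index is a polynomial.\<close>

lemma C_on_comp_smooth:
  fixes f :: "'a::euclidean_space \<Rightarrow> real"
  assumes der: "\<And>p s. (H p has_real_derivative H (d p) s) (at s)"
  shows "C_on k UNIV f \<Longrightarrow> C_on k UNIV (\<lambda>x. H p (f x))"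
proof (induction k arbitrary: f p)
  case 0
  have "continuous_on UNIV (H p)"
    using der by (meson DERIV_isCont continuous_at_imp_continuous_on)
  with 0 show ?case
    by (auto intro: continuous_on_compose2)
next
  case (Suc k)
  have "((\<lambda>x. H p (f x)) has_derivative (\<lambda>h. H (d p) (f x) * frechet_derivative f (at x) h)) (at x)" for x
    using has_derivative_compose[OF C_on_SucD(1)[OF Suc.prems] der[unfolded has_field_derivative_def]] .
  then show ?case
    by (rule C_on_SucI)
      (intro C_on_mult Suc.IH C_on_SucD(2)[OF Suc.prems] C_on_Suc_imp[OF Suc.prems])
qed

text \<open>The derivative of the outer function is \<open>- s\<close> times its own cube, so the
  induction closes without any further function entering. This is why the inverse root is treated
  before the root.\<close>

lemma C_on_inverse_sqrt:
  fixes f :: "'a::euclidean_space \<Rightarrow> real"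
  assumes "d > 0"
  shows "C_on k UNIV f \<Longrightarrow> C_on k UNIV (\<lambda>x. 1 / sqrt ((f x)\<^sup>2 + d\<^sup>2))"
proof (induction k arbitrary: f)
  case 0
  have "(f x)\<^sup>2 + d\<^sup>2 \<noteq> 0" for x
    using assms by (simp add: sum_power2_eq_zero_iff)
  with 0 show ?case
    by (auto intro!: continuous_intros)
next
  case (Suc k)
  let ?h = "\<lambda>s. 1 / sqrt (s\<^sup>2 + d\<^sup>2)"
  have der: "(?h has_real_derivative - s * (?h s * (?h s * ?h s))) (at s)" for s
  proof -
    have p: "s\<^sup>2 + d\<^sup>2 > 0"
      using assms by (simp add: add_nonneg_pos)
    show ?thesis
      using p by (auto intro!: derivative_eq_intros simp: field_simps power2_eq_square real_sqrt_mult_self)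
  qed
  have "((\<lambda>x. ?h (f x)) has_derivative (\<lambda>v. ((-1) * f x * (?h (f x) * (?h (f x) * ?h (f x)))) * frechet_derivative f (at x) v)) (at x)" for x
    using has_derivative_compose[OF C_on_SucD(1)[OF Suc.prems] der[of "f x", unfolded has_field_derivative_def]] by simp
  then show ?case
    by (rule C_on_SucI)
      (intro C_on_mult C_on_const Suc.IH C_on_SucD(2)[OF Suc.prems] C_on_Suc_imp[OF Suc.prems])
qed

text \<open>A positive root is its square times its inverse, which leaves only sums, products and
  the inverse root.\<close>

lemma C_on_sqrt:
  fixes f :: "'a::euclidean_space \<Rightarrow> real"
  assumes "d > 0" "C_on k UNIV f"
  shows "C_on k UNIV (\<lambda>x. sqrt ((f x)\<^sup>2 + d\<^sup>2))"
proof -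
  have *: "(\<lambda>x. sqrt ((f x)\<^sup>2 + d\<^sup>2)) = (\<lambda>x. (f x * f x + d * d) * (1 / sqrt ((f x)\<^sup>2 + d\<^sup>2)))"
    using assms(1) by (simp add: real_div_sqrt add_nonneg_pos flip: power2_eq_square)
  show ?thesis
    by (subst *) (intro C_on_mult C_on_add C_on_const C_on_inverse_sqrt assms)
qed

text \<open>The functions \<open>p(1/s) * exp (-1/s)\<close>, extended by zero to
  \<open>s \<le> 0\<close>. Carrying the polynomial makes the class closed under differentiation;
  \<open>p = 1\<close> is the classical smooth function that vanishes to infinite order at
  zero.\<close>

definition flat :: "real poly \<Rightarrow> real \<Rightarrow> real" where
  "flat p s = (if 0 < s then poly p (inverse s) * exp (- inverse s) else 0)"

lemma poly_times_exp_minus_tendsto_0: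
  "((\<lambda>t::real. poly p t * exp (- t)) \<longlongrightarrow> 0) at_top"
proof -
  have "((\<lambda>t. \<Sum>i\<le>degree p. coeff p i * (t ^ i / exp t)) \<longlongrightarrow> (\<Sum>i\<le>degree p. coeff p i * 0)) at_top"
    by (intro tendsto_intros tendsto_power_div_exp_0)
  then show ?thesis
    by (simp add: poly_altdef sum_divide_distrib exp_minus field_simps)
qed

text \<open>In \<open>t = 1/s\<close> one has \<open>d/ds = - t^2 d/dt\<close>, and the derivative
  of \<open>p(t) * exp (- t)\<close> in \<open>t\<close> is \<open>(p' - p) * exp (- t)\<close>.
  Together they produce the polynomial \<open>(p - p') * t^2\<close>.\<close>

lemma flat_has_derivative:
  "(flat p has_real_derivative flat ((p - pderiv p) * monom 1 2) s) (at s)"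
proof -
  consider "s > 0" | "s < 0" | "s = 0" by linarith
  then show ?thesis
  proof cases
    case 1
    have "((\<lambda>s. poly p (inverse s) * exp (- inverse s)) has_real_derivative
        flat ((p - pderiv p) * monom 1 2) s) (at s)"
      using 1 by (auto intro!: derivative_eq_intros DERIV_chain2[OF poly_DERIV]
          simp: flat_def poly_monom algebra_simps power2_eq_square)
    then show ?thesis
      by (rule has_field_derivative_transform_within_open[of _ _ _ "{0<..}"])
        (use 1 in \<open>auto simp: flat_def\<close>)
  next
    case 2
    have "((\<lambda>s. 0) has_real_derivative flat ((p - pderiv p) * monom 1 2) s) (at s)"
      using 2 by (simp add: flat_def)
    then show ?thesis
      by (rule has_field_derivative_transform_within_open[of _ _ _ "{..<0}"])
        (use 2 in \<open>auto simp: flat_def\<close>)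
  next
    case 3
    \<comment> \<open>In \<open>t = 1/h\<close> the right difference quotient at zero is
      \<open>t * p(t) * exp (- t)\<close>, with \<open>t\<close> tending to infinity.\<close>
    have "((\<lambda>h. poly (p * monom 1 1) (inverse h) * exp (- inverse h)) \<longlongrightarrow> 0) (at_right 0)"
      by (rule filterlim_compose[OF poly_times_exp_minus_tendsto_0 filterlim_inverse_at_top_right])
    then have R: "((\<lambda>h. flat p h / h) \<longlongrightarrow> 0) (at_right 0)"
      by (rule Lim_transform_eventually)
        (auto simp: eventually_at_filter flat_def poly_monom field_simps)
    have L: "((\<lambda>h. flat p h / h) \<longlongrightarrow> 0) (at_left 0)"
      by (rule Lim_transform_eventually[OF tendsto_const])
        (auto simp: eventually_at_filter flat_def)
    have "((\<lambda>h. flat p h / h) \<longlongrightarrow> 0) (at 0)"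
      using L R by (rule filterlim_split_at)
    then show ?thesis
      using 3 by (simp add: DERIV_def flat_def)
  qed
qed

section \<open>Gradients and compactly supported C^1 functions\<close>

lemma grad_eqI:
  assumes "(f has_derivative (\<lambda>h. G \<bullet> h)) (at x)"
  shows "grad f x = G"
  using frechet_derivative_at[OF assms, symmetric]
  by (simp add: grad_def euclidean_representation)

lemma has_derivative_grad:
  fixes f :: "'a::euclidean_space \<Rightarrow> real"
  assumes "f differentiable (at x)"
  shows "(f has_derivative (\<lambda>h. grad f x \<bullet> h)) (at x)"
proof -
  have f: "(f has_derivative frechet_derivative f (at x)) (at x)"
    using assms by (simp add: frechet_derivative_works)
  interpret bounded_linear "frechet_derivative f (at x)"
    using f by (rule has_derivative_bounded_linear)
  have "frechet_derivative f (at x) h = grad f x \<bullet> h" for h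
  proof -
    have "frechet_derivative f (at x) h = frechet_derivative f (at x) (\<Sum>b\<in>Basis. (h \<bullet> b) *\<^sub>R b)"
      by (simp add: euclidean_representation)
    also have "\<dots> = grad f x \<bullet> h"
      by (simp add: grad_def sum scale inner_sum_left inner_commute[of h] mult.commute)
    finally show ?thesis .
  qed
  then have "frechet_derivative f (at x) = (\<lambda>h. grad f x \<bullet> h)" by auto
  with f show ?thesis by simp
qed

text \<open>Test functions are too narrow a class for the use made of Rellich's theorem, since
  \<open>s * \<bar>s\<bar>\<close> is only C^1. The gradient is a second argument so that chain and
  product rules can be read off directly.\<close>

definition C1c :: "('a::euclidean_space \<Rightarrow> real) \<Rightarrow> ('a \<Rightarrow> 'a) \<Rightarrow> bool" where
  "C1c v G \<longleftrightarrow> (\<forall>x. (v has_derivative (\<lambda>h. G x \<bullet> h)) (at x)) \<and> continuous_on UNIV G \<and>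
     (\<exists>R. \<forall>x. R < norm x \<longrightarrow> v x = 0 \<and> G x = 0)"

lemma C1c_continuous: "C1c v G \<Longrightarrow> continuous_on S v" "C1c v G \<Longrightarrow> continuous_on S G"
  unfolding C1c_def
  by (meson continuous_on_subset has_derivative_continuous_on has_derivative_at_withinI subset_UNIV)+

lemma C1c_mult:
  assumes "C1c v G" "C1c w H"
  shows "C1c (\<lambda>x. v x * w x) (\<lambda>x. v x *\<^sub>R H x + w x *\<^sub>R G x)"
proof -
  obtain R where "\<And>x. R < norm x \<Longrightarrow> v x = 0 \<and> G x = 0"
    using assms(1) by (auto simp: C1c_def)
  then have "\<exists>R. \<forall>x. R < norm x \<longrightarrow> v x * w x = 0 \<and> v x *\<^sub>R H x + w x *\<^sub>R G x = 0"
    by (intro exI[of _ R]) auto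
  moreover have "((\<lambda>x. v x * w x) has_derivative (\<lambda>h. (v x *\<^sub>R H x + w x *\<^sub>R G x) \<bullet> h)) (at x)" for x
    using assms unfolding C1c_def
    by (auto intro!: derivative_eq_intros simp: inner_add_left)
  moreover have "continuous_on UNIV (\<lambda>x. v x *\<^sub>R H x + w x *\<^sub>R G x)"
    using C1c_continuous[OF assms(1)] C1c_continuous[OF assms(2)] by (auto intro!: continuous_intros)
  ultimately show ?thesis by (auto simp: C1c_def)
qed

lemma DERIV_mult_abs: "((\<lambda>s::real. s * \<bar>s\<bar>) has_real_derivative 2 * \<bar>s\<bar>) (at s)"
proof -
  consider "s > 0" | "s < 0" | "s = 0" by linarith
  then show ?thesis
  proof cases
    case 1
    have "((\<lambda>s. s * s) has_real_derivative 2 * \<bar>s\<bar>) (at s)"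
      using 1 by (auto intro!: derivative_eq_intros)
    then show ?thesis
      by (rule has_field_derivative_transform_within_open[of _ _ _ "{0<..}"]) (use 1 in auto)
  next
    case 2
    have "((\<lambda>s. - (s * s)) has_real_derivative 2 * \<bar>s\<bar>) (at s)"
      using 2 by (auto intro!: derivative_eq_intros)
    then show ?thesis
      by (rule has_field_derivative_transform_within_open[of _ _ _ "{..<0}"]) (use 2 in auto)
  next
    case 3
    have "((\<lambda>h::real. \<bar>h\<bar>) \<longlongrightarrow> 0) (at 0)"
      by (intro tendsto_rabs_zero tendsto_ident_at)
    then have "((\<lambda>h::real. h * \<bar>h\<bar> / h) \<longlongrightarrow> 0) (at 0)"
      by (rule Lim_transform_eventually) (auto simp: eventually_at_filter)
    then show ?thesis using 3 by (simp add: DERIV_def)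
  qed
qed

lemma C1c_mult_abs:
  assumes "C1c v G"
  shows "C1c (\<lambda>x. v x * \<bar>v x\<bar>) (\<lambda>x. (2 * \<bar>v x\<bar>) *\<^sub>R G x)"
proof -
  have "((\<lambda>x. v x * \<bar>v x\<bar>) has_derivative (\<lambda>h. ((2 * \<bar>v x\<bar>) *\<^sub>R G x) \<bullet> h)) (at x)" for x
  proof -
    have "(v has_derivative (\<lambda>h. G x \<bullet> h)) (at x)"
      using assms by (auto simp: C1c_def)
    from has_derivative_compose[OF this DERIV_mult_abs[unfolded has_field_derivative_def]]
    show ?thesis by simp
  qed
  moreover have "continuous_on UNIV (\<lambda>x. (2 * \<bar>v x\<bar>) *\<^sub>R G x)"
    using C1c_continuous[OF assms] by (auto intro!: continuous_intros)
  moreover obtain R where "\<forall>x. R < norm x \<longrightarrow> v x = 0 \<and> G x = 0"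
    using assms by (auto simp: C1c_def)
  then have "\<exists>R. \<forall>x. R < norm x \<longrightarrow> v x * \<bar>v x\<bar> = 0 \<and> (2 * \<bar>v x\<bar>) *\<^sub>R G x = 0"
    by (intro exI[of _ R]) auto
  ultimately show ?thesis by (auto simp: C1c_def)
qed

section \<open>Test functions\<close>

lemma test_functions_C_on: "\<phi> \<in> test_functions U \<Longrightarrow> C_on k UNIV \<phi>"
  by (auto simp: test_functions_def smooth_on_def)

lemma test_functions_has_derivative:
  "\<phi> \<in> test_functions U \<Longrightarrow> (\<phi> has_derivative (\<lambda>h. grad \<phi> x \<bullet> h)) (at x)"
  using test_functions_C_on[of \<phi> U 1] by (auto intro!: has_derivative_grad)

lemma test_functions_zero:
  "\<phi> \<in> test_functions U \<Longrightarrow> x \<notin> closure {x. \<phi> x \<noteq> 0} \<Longrightarrow> \<phi> x = 0 \<and> grad \<phi> x = 0"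
proof -
  assume phi: "\<phi> \<in> test_functions U" and x: "x \<notin> closure {x. \<phi> x \<noteq> 0}"
  define Z where "Z = closure {x. \<phi> x \<noteq> 0}"
  have z: "\<phi> y = 0" if "y \<in> - Z" for y
    using that closure_subset[of "{x. \<phi> x \<noteq> 0}"] unfolding Z_def by blast
  have Z: "open (- Z)" "x \<in> - Z"
    using x by (auto simp: Z_def)
  have "(\<phi> has_derivative (\<lambda>h. 0 \<bullet> h)) (at x)"
    by (rule has_derivative_transform_within_open[OF _ Z]) (simp_all add: z)
  from grad_eqI[OF this] z[OF Z(2)] show ?thesis by simp
qed

lemma test_functions_zero_outside:
  "\<phi> \<in> test_functions U \<Longrightarrow> x \<notin> U \<Longrightarrow> \<phi> x = 0 \<and> grad \<phi> x = 0"
  by (rule test_functions_zero) (auto simp: test_functions_def)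

lemma continuous_grad_test: "\<phi> \<in> test_functions U \<Longrightarrow> continuous_on S (grad \<phi>)"
proof -
  assume "\<phi> \<in> test_functions U"
  from test_functions_C_on[OF this, of 1]
  have "continuous_on UNIV (\<lambda>x. frechet_derivative \<phi> (at x) b)" for b
    by simp
  then have "continuous_on UNIV (grad \<phi>)"
    unfolding grad_def[abs_def] by (intro continuous_intros)
  then show ?thesis by (rule continuous_on_subset) auto
qed

lemma test_functions_C1c: "\<phi> \<in> test_functions U \<Longrightarrow> C1c \<phi> (grad \<phi>)"
proof -
  assume phi: "\<phi> \<in> test_functions U"
  then have "bounded (closure {x. \<phi> x \<noteq> 0})"
    by (auto simp: test_functions_def compact_imp_bounded)
  then obtain R where "\<And>x. x \<in> closure {x. \<phi> x \<noteq> 0} \<Longrightarrow> norm x \<le> R"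
    by (auto simp: bounded_iff)
  then have "\<forall>x. R < norm x \<longrightarrow> \<phi> x = 0 \<and> grad \<phi> x = 0"
    using test_functions_zero[OF phi] by (meson not_le)
  then show ?thesis
    using test_functions_has_derivative[OF phi] continuous_grad_test[OF phi] by (auto simp: C1c_def)
qed

lemma test_functionsI:
  assumes "\<And>k. C_on k UNIV \<phi>" "compact K" "K \<subseteq> U" "\<And>x. x \<notin> K \<Longrightarrow> \<phi> x = 0"
  shows "\<phi> \<in> test_functions U"
proof -
  have "closure {x. \<phi> x \<noteq> 0} \<subseteq> K"
    using assms by (intro closure_minimal) (auto simp: compact_imp_closed)
  moreover have "bounded {x. \<phi> x \<noteq> 0}"
    using assms by (intro bounded_subset[OF compact_imp_bounded[OF assms(2)]]) auto
  ultimately show ?thesis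
    using assms by (auto simp: test_functions_def smooth_on_def)
qed

lemma test_functions_support:
  assumes "\<phi> \<in> test_functions U"
  obtains K where "compact K" "K \<subseteq> U" "\<And>x. x \<notin> K \<Longrightarrow> \<phi> x = 0 \<and> grad \<phi> x = 0"
proof
  show "compact (closure {x. \<phi> x \<noteq> 0})" "closure {x. \<phi> x \<noteq> 0} \<subseteq> U"
    using assms by (simp_all add: test_functions_def)
qed (rule test_functions_zero[OF assms])

lemma zero_test: "(\<lambda>x. 0) \<in> test_functions U"
  by (rule test_functionsI[of _ "{}"]) (auto simp: C_on_const)

lemma test_functions_lincomb:
  assumes "\<phi> \<in> test_functions U" "\<psi> \<in> test_functions U"
  shows "(\<lambda>x. c * \<phi> x + d * \<psi> x) \<in> test_functions U"
    "grad (\<lambda>x. c * \<phi> x + d * \<psi> x) x = c *\<^sub>R grad \<phi> x + d *\<^sub>R grad \<psi> x"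
proof -
  obtain K L where K: "compact K" "K \<subseteq> U" "\<And>x. x \<notin> K \<Longrightarrow> \<phi> x = 0"
    and L: "compact L" "L \<subseteq> U" "\<And>x. x \<notin> L \<Longrightarrow> \<psi> x = 0"
    using test_functions_support assms by metis
  show "(\<lambda>x. c * \<phi> x + d * \<psi> x) \<in> test_functions U"
    by (rule test_functionsI[of _ "K \<union> L"])
      (use K L in \<open>auto intro!: C_on_add C_on_mult C_on_const
         test_functions_C_on[OF assms(1)] test_functions_C_on[OF assms(2)]\<close>)
  show "grad (\<lambda>x. c * \<phi> x + d * \<psi> x) x = c *\<^sub>R grad \<phi> x + d *\<^sub>R grad \<psi> x"
    by (rule grad_eqI)
      (auto intro!: derivative_eq_intros test_functions_has_derivative[OF assms(1)]
        test_functions_has_derivative[OF assms(2)] simp: inner_add_left)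
qed

lemma test_functions_scale:
  assumes "\<phi> \<in> test_functions U"
  shows "(\<lambda>x. c * \<phi> x) \<in> test_functions U" "grad (\<lambda>x. c * \<phi> x) x = c *\<^sub>R grad \<phi> x"
  using test_functions_lincomb[OF assms assms, of c 0] by auto

lemma test_functions_sum:
  fixes \<psi> :: "'i \<Rightarrow> 'a::euclidean_space \<Rightarrow> real"
  assumes "finite I" "\<And>i. i \<in> I \<Longrightarrow> \<psi> i \<in> test_functions U"
  shows "(\<lambda>x. \<Sum>i\<in>I. \<psi> i x) \<in> test_functions U \<and> grad (\<lambda>x. \<Sum>i\<in>I. \<psi> i x) x = (\<Sum>i\<in>I. grad (\<psi> i) x)"
  using assms
proof (induction I rule: finite_induct)
  case empty
  have "grad (\<lambda>x. 0) x = (0::'a)" by (rule grad_eqI) auto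
  then show ?case by (simp add: zero_test)
next
  case (insert i I)
  then show ?case
    using test_functions_lincomb[of "\<psi> i" U "\<lambda>x. \<Sum>i\<in>I. \<psi> i x" 1 1] by simp
qed

lemma test_functions_mono: "U \<subseteq> V \<Longrightarrow> \<phi> \<in> test_functions U \<Longrightarrow> \<phi> \<in> test_functions V"
  by (auto simp: test_functions_def)

text \<open>The witness is the bump \<open>exp (-1 / (r^2 - |x - c|^2))\<close>, supported in a
  closed ball inside \<open>D\<close> and positive at its centre.\<close>

lemma exists_test_function:
  fixes D :: "'a::euclidean_space set"
  assumes "open D" "D \<noteq> {}"
  shows "\<exists>\<phi>\<in>test_functions D. \<exists>x\<in>D. \<phi> x \<noteq> 0"
proof -
  obtain c where c: "c \<in> D" using assms by auto
  then obtain r where r: "r > 0" "cball c r \<subseteq> D"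
    using assms open_contains_cball by blast
  \<comment> \<open>The squared distance is written in coordinates, with a factor \<open>-1\<close>
    in place of subtraction, so that the closure rules for sums and products apply as they
    stand.\<close>
  let ?s = "\<lambda>x. r\<^sup>2 + (-1) * (\<Sum>b\<in>Basis. (x \<bullet> b + (-1) * (c \<bullet> b)) * (x \<bullet> b + (-1) * (c \<bullet> b)))"
  have s: "?s x = r\<^sup>2 - (dist c x)\<^sup>2" for x
  proof -
    have "(dist c x)\<^sup>2 = (c - x) \<bullet> (c - x)" by (simp add: dist_norm power2_norm_eq_inner)
    also have "\<dots> = (\<Sum>b\<in>Basis. ((c - x) \<bullet> b) * ((c - x) \<bullet> b))" by (rule euclidean_inner)
    also have "\<dots> = (\<Sum>b\<in>Basis. (x \<bullet> b + (-1) * (c \<bullet> b)) * (x \<bullet> b + (-1) * (c \<bullet> b)))"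
      by (intro sum.cong) (simp_all add: inner_diff_left algebra_simps)
    finally have eq: "(dist c x)\<^sup>2 = (\<Sum>b\<in>Basis. (x \<bullet> b + (-1) * (c \<bullet> b)) * (x \<bullet> b + (-1) * (c \<bullet> b)))" .
    show ?thesis unfolding eq by (simp only: mult_minus1 diff_conv_add_uminus)
  qed
  have sm: "C_on k UNIV (\<lambda>x. \<Sum>b\<in>B. (x \<bullet> b + (-1) * (c \<bullet> b)) * (x \<bullet> b + (-1) * (c \<bullet> b)))"
    if "finite B" for B and k using that
  proof (induction B rule: finite_induct)
    case (insert b B)
    show ?case
      unfolding sum.insert[OF insert(1,2)]
      by (intro C_on_add C_on_mult C_on_const C_on_inner_left insert.IH)
  qed (simp add: C_on_const)
  have "(\<lambda>x. flat 1 (?s x)) \<in> test_functions D"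
  proof (rule test_functionsI[of _ "cball c r"])
    show "C_on k UNIV (\<lambda>x. flat 1 (?s x))" for k
      by (rule C_on_comp_smooth[where H = flat, OF flat_has_derivative])
        (intro C_on_add C_on_mult C_on_const sm finite_Basis)
    show "flat 1 (?s x) = 0" if "x \<notin> cball c r" for x
    proof -
      have "r\<^sup>2 \<le> (dist c x)\<^sup>2" using that r by (intro power_mono) auto
      then show ?thesis by (simp only: s) (simp add: flat_def)
    qed
  qed (use r in auto)
  moreover have "flat 1 (?s c) \<noteq> 0"
    using r by (simp only: s) (simp add: flat_def)
  ultimately show ?thesis using c by (intro bexI[where x = c] bexI[where x = "\<lambda>x. flat 1 (?s x)"])
qed

text \<open>A point outside \<open>D\<close> lies in \<open>E\<close> or outside \<open>K\<close>,
  and on the open set \<open>E \<union> - K\<close> the restricted function is zero. Derivatives of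
  \<open>\<phi>\<close> also vanish off \<open>K\<close>, so the same argument applies to them in
  the induction.\<close>

lemma C_on_restrict_clopen:
  fixes \<phi> :: "'a::euclidean_space \<Rightarrow> real"
  assumes K: "closed K" "K \<subseteq> D \<union> E" "open D" "open E" "D \<inter> E = {}"
  shows "C_on k UNIV \<phi> \<Longrightarrow> (\<And>x. x \<notin> K \<Longrightarrow> \<phi> x = 0) \<Longrightarrow> C_on k UNIV (\<lambda>x. if x \<in> D then \<phi> x else 0)"
proof (induction k arbitrary: \<phi>)
  case 0
  have "isCont (\<lambda>x. if x \<in> D then \<phi> x else 0) x" for x
  proof (cases "x \<in> D")
    case True
    have "isCont \<phi> x" using 0 by (simp add: continuous_on_eq_continuous_at)
    moreover have "eventually (\<lambda>y. (if y \<in> D then \<phi> y else 0) = \<phi> y) (nhds x)"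
      using eventually_nhds_in_open[OF \<open>open D\<close> True] by eventually_elim auto
    ultimately show ?thesis by (simp add: isCont_cong)
  next
    case False
    then have x: "x \<in> E \<union> - K" "open (E \<union> - K)" using K by auto
    have "eventually (\<lambda>y. (if y \<in> D then \<phi> y else 0) = 0) (nhds x)"
      using eventually_nhds_in_open[OF x(2,1)] by eventually_elim (use 0 K in auto)
    from isCont_cong[OF this] show ?thesis by simp
  qed
  then show ?case by (simp add: continuous_at_imp_continuous_on)
next
  case (Suc k)
  let ?F = "frechet_derivative \<phi>"
  have van: "?F (at x) = (\<lambda>h. 0)" if "x \<notin> K" for x
  proof -
    have "(\<phi> has_derivative (\<lambda>h. 0)) (at x)"
      by (rule has_derivative_transform_within_open[of "\<lambda>_. 0" _ x UNIV "- K"])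
        (use K that Suc.prems in auto)
    from frechet_derivative_at[OF this] show ?thesis by simp
  qed
  have "((\<lambda>x. if x \<in> D then \<phi> x else 0) has_derivative (\<lambda>h. if x \<in> D then ?F (at x) h else 0)) (at x)" for x
  proof (cases "x \<in> D")
    case True
    have "((\<lambda>x. if x \<in> D then \<phi> x else 0) has_derivative ?F (at x)) (at x)"
      by (rule has_derivative_transform_within_open[of \<phi> _ x UNIV D])
        (use K True C_on_SucD(1)[OF Suc.prems(1)] in auto)
    then show ?thesis using True by simp
  next
    case False
    then have x: "x \<in> E \<union> - K" "open (E \<union> - K)" using K by auto
    have "((\<lambda>x. if x \<in> D then \<phi> x else 0) has_derivative (\<lambda>h. 0)) (at x)"
      by (rule has_derivative_transform_within_open[of "\<lambda>_. 0" _ x UNIV "E \<union> - K"])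
        (use K x Suc.prems in auto)
    then show ?thesis using False by simp
  qed
  then show ?case
    by (rule C_on_SucI) (rule Suc.IH[OF C_on_SucD(2)[OF Suc.prems(1)]], simp add: van)
qed

section \<open>Translation estimates and Rellich's theorem\<close>

lemma lborel_translation:
  fixes f :: "'a::euclidean_space \<Rightarrow> 'b::{banach, second_countable_topology}"
  assumes "f \<in> borel_measurable borel"
  shows "(\<integral>x. f (x + c) \<partial>lborel) = (\<integral>x. f x \<partial>lborel)"
proof -
  have "(\<integral>x. f x \<partial>lborel) = (\<integral>x. f x \<partial>distr lborel borel ((+) c))"
    by (simp add: lborel_distr_plus)
  also have "\<dots> = (\<integral>x. f (c + x) \<partial>lborel)"
    using assms by (intro integral_distr) auto
  finally show ?thesis by (simp add: add.commute)
qed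

lemma integrable_continuous_support:
  fixes f :: "'a::euclidean_space \<Rightarrow> 'b::euclidean_space"
  assumes "continuous_on UNIV f" "\<And>x. R < norm x \<Longrightarrow> f x = 0"
  shows "integrable lborel f"
proof -
  have "integrable lborel (\<lambda>x. indicator (cball 0 R) x *\<^sub>R f x)"
    by (rule borel_integrable_compact) (auto intro: continuous_on_subset[OF assms(1)])
  also have "(\<lambda>x. indicator (cball 0 R) x *\<^sub>R f x) = f"
    using assms(2) by (force simp: indicator_def)
  finally show ?thesis .
qed

section \<open>Difference quotients of compactly supported C^1 functions\<close>

lemma C1c_support:
  assumes "C1c v G"
  obtains R where "\<And>x. R < norm x \<Longrightarrow> v x = 0" "\<And>x. R < norm x \<Longrightarrow> G x = 0"
  using assms by (auto simp: C1c_def)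

lemma C1c_integrable:
  assumes "C1c v G"
  shows "integrable lborel v" "integrable lborel G"
  using C1c_support[OF assms] C1c_continuous[OF assms, of UNIV] integrable_continuous_support by metis+

lemma C1c_borel:
  assumes "C1c v G"
  shows "v \<in> borel_measurable borel" "G \<in> borel_measurable borel"
  using C1c_continuous[OF assms, of UNIV] by (auto intro: borel_measurable_continuous_onI)

lemma C1c_lipschitz:
  assumes "C1c v G"
  obtains M where "\<And>x y. \<bar>v x - v y\<bar> \<le> M * norm (x - y)"
proof -
  obtain R where R: "\<And>x. R < norm x \<Longrightarrow> G x = 0"
    using C1c_support[OF assms] by metis
  have "bounded (G ` cball 0 R)"
    by (intro compact_imp_bounded compact_continuous_image C1c_continuous[OF assms]) auto
  then obtain M where M: "M > 0" "\<And>x. x \<in> cball 0 R \<Longrightarrow> norm (G x) \<le> M"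
    by (auto simp: bounded_pos)
  have "norm (G x) \<le> M" for x
    using M R[of x] by (cases "norm x \<le> R") auto
  then have "norm (v x - v y) \<le> M * norm (x - y)" for x y
    using assms unfolding C1c_def
    by (intro differentiable_bound[of UNIV v "\<lambda>x h. G x \<bullet> h" M x y] onorm_le)
      (auto intro!: order_trans[OF Cauchy_Schwarz_ineq2] mult_right_mono)
  then show ?thesis using that by auto
qed

text \<open>A Lipschitz constant bounds all quotients by \<open>M * norm h\<close>, and since no
  shift is longer than \<open>h\<close> they are all supported in one ball. Dominated convergence
  thus takes the place of integration along lines.\<close>

lemma C1c_difference_quotient:
  fixes h :: "'a::euclidean_space"
  assumes v: "C1c v G"
  defines "q \<equiv> \<lambda>n x. real (Suc n) * (v (x + h /\<^sub>R real (Suc n)) - v x)"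
  shows "integrable lborel (q n)" "(\<lambda>n. \<integral>x. q n x \<partial>lborel) \<longlonglongrightarrow> (\<integral>x. G x \<bullet> h \<partial>lborel)"
    "(\<lambda>n. \<integral>x. \<bar>q n x\<bar> \<partial>lborel) \<longlonglongrightarrow> (\<integral>x. \<bar>G x \<bullet> h\<bar> \<partial>lborel)"
proof -
  obtain R where R: "\<And>x. R < norm x \<Longrightarrow> v x = 0" using C1c_support[OF v] by metis
  obtain M where M: "\<And>x y. \<bar>v x - v y\<bar> \<le> M * norm (x - y)" using C1c_lipschitz[OF v] by metis
  have small: "norm (h /\<^sub>R real (Suc n)) \<le> norm h" for n
    by (simp add: divide_inverse[symmetric] divide_le_eq mult_left_le_one_le mult_le_cancel_left1 field_simps)
  have cont: "continuous_on UNIV (q n)" for n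
    unfolding q_def
    by (intro continuous_intros continuous_on_compose2[OF C1c_continuous(1)[OF v, of UNIV]]) auto
  have supp: "q n x = 0" if "R + norm h < norm x" for n x
  proof -
    have "norm x \<le> norm (x + h /\<^sub>R real (Suc n)) + norm (h /\<^sub>R real (Suc n))"
      using norm_triangle_ineq4[of "x + h /\<^sub>R real (Suc n)" "h /\<^sub>R real (Suc n)"] by simp
    with that small[of n] norm_ge_zero[of h] have "R < norm (x + h /\<^sub>R real (Suc n))" "R < norm x"
      by linarith+
    then show ?thesis by (simp add: q_def R)
  qed
  show int: "integrable lborel (q n)" for n
    by (rule integrable_continuous_support[OF cont supp])
  have bd: "\<bar>q n x\<bar> \<le> indicator (cball 0 (R + norm h)) x * (M * norm h)" for n x
  proof (cases "R + norm h < norm x")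
    case False
    have "\<bar>q n x\<bar> \<le> real (Suc n) * (M * norm (h /\<^sub>R real (Suc n)))"
      unfolding q_def abs_mult using M[of "x + h /\<^sub>R real (Suc n)" x]
      by (intro mult_mono) auto
    also have "\<dots> = M * norm h" by simp
    finally show ?thesis using False by simp
  qed (simp add: supp)
  have lim: "(\<lambda>n. q n x) \<longlonglongrightarrow> G x \<bullet> h" for x
  proof -
    have "((\<lambda>t. v (x + t *\<^sub>R h)) has_derivative (\<lambda>t. G x \<bullet> (t *\<^sub>R h))) (at 0)"
      using v unfolding C1c_def
      by (intro has_derivative_compose[of "\<lambda>t. x + t *\<^sub>R h" "\<lambda>t. t *\<^sub>R h" 0 UNIV v "\<lambda>k. G x \<bullet> k"])
        (auto intro!: derivative_eq_intros)
    then have "((\<lambda>t. v (x + t *\<^sub>R h)) has_real_derivative (G x \<bullet> h)) (at 0)"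
      by (simp add: has_field_derivative_def mult_commute_abs)
    then have "((\<lambda>t. (v (x + t *\<^sub>R h) - v x) / t) \<longlongrightarrow> G x \<bullet> h) (at 0)"
      by (simp add: DERIV_def)
    moreover have "filterlim (\<lambda>n. inverse (real (Suc n))) (at 0) sequentially"
      using LIMSEQ_inverse_real_of_nat by (auto simp: filterlim_at)
    ultimately have "(\<lambda>n. (v (x + inverse (real (Suc n)) *\<^sub>R h) - v x) / inverse (real (Suc n))) \<longlonglongrightarrow> G x \<bullet> h"
      by (rule filterlim_compose)
    then show ?thesis by (simp add: q_def field_simps)
  qed
  have dom: "integrable lborel (\<lambda>x. indicator (cball 0 (R + norm h)) x * (M * norm h))"
    by (intro integrable_mult_left integrable_real_indicator emeasure_lborel_cball_finite) auto
  have meas: "(\<lambda>x. G x \<bullet> h) \<in> borel_measurable lborel"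
    using C1c_borel[OF v] by (auto intro!: borel_measurable_inner)
  show "(\<lambda>n. \<integral>x. q n x \<partial>lborel) \<longlonglongrightarrow> (\<integral>x. G x \<bullet> h \<partial>lborel)"
    by (rule integral_dominated_convergence[OF meas _ dom])
      (use lim bd borel_measurable_integrable[OF int] in auto)
  show "(\<lambda>n. \<integral>x. \<bar>q n x\<bar> \<partial>lborel) \<longlonglongrightarrow> (\<integral>x. \<bar>G x \<bullet> h\<bar> \<partial>lborel)"
    by (rule integral_dominated_convergence[OF borel_measurable_abs[OF meas] _ dom])
      (use bd borel_measurable_integrable[OF int] in \<open>auto intro!: tendsto_rabs lim\<close>)
qed

text \<open>By translation invariance every difference quotient has integral zero. Applied to a
  product this becomes integration by parts.\<close>

lemma integral_C1c_gradient:
  assumes v: "C1c v G"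
  shows "(\<integral>x. G x \<bullet> h \<partial>lborel) = 0"
proof -
  have v1: "integrable lborel v" "integrable lborel (\<lambda>x. v (x + c))" for c
    using C1c_integrable[OF v] integrable_distr[of "(+) c" lborel borel v] by (auto simp: lborel_distr_plus add.commute)
  have "(\<integral>x. real (Suc n) * (v (x + h /\<^sub>R real (Suc n)) - v x) \<partial>lborel) = 0" for n
    using v1 lborel_translation[OF C1c_borel(1)[OF v]] by simp
  with C1c_difference_quotient(2)[OF v, of h] show ?thesis
    by (simp add: LIMSEQ_unique)
qed

text \<open>The shift by \<open>h\<close> is split into \<open>n + 1\<close> equal shifts. Each
  costs the same by translation invariance, so their sum is the integral of the absolute difference
  quotient, which converges to that of \<open>\<bar>G x \<bullet> h\<bar>\<close>.\<close>

lemma C1c_translation: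
  assumes v: "C1c v G"
  shows "(\<integral>x. \<bar>v (x + h) - v x\<bar> \<partial>lborel) \<le> norm h * (\<integral>x. norm (G x) \<partial>lborel)"
proof -
  have m: "v \<in> borel_measurable borel" "G \<in> borel_measurable borel" using C1c_borel[OF v] .
  have vi: "integrable lborel (\<lambda>x. v (x + c))" for c
    using C1c_integrable[OF v] integrable_distr[of "(+) c" lborel borel v] by (auto simp: lborel_distr_plus add.commute)
  have tr: "(\<integral>x. \<bar>v (x + (c + d)) - v (x + c)\<bar> \<partial>lborel) = (\<integral>x. \<bar>v (x + d) - v x\<bar> \<partial>lborel)" for c d
    using lborel_translation[of "\<lambda>x. \<bar>v (x + d) - v x\<bar>" c] m by (simp add: algebra_simps)
  have step: "(\<integral>x. \<bar>v (x + real k *\<^sub>R d) - v x\<bar> \<partial>lborel) \<le> real k * (\<integral>x. \<bar>v (x + d) - v x\<bar> \<partial>lborel)" for k d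
  proof (induction k)
    case (Suc k)
    have "(\<integral>x. \<bar>v (x + real (Suc k) *\<^sub>R d) - v x\<bar> \<partial>lborel)
      \<le> (\<integral>x. \<bar>v (x + (real k *\<^sub>R d + d)) - v (x + real k *\<^sub>R d)\<bar> + \<bar>v (x + real k *\<^sub>R d) - v x\<bar> \<partial>lborel)"
      using vi[of 0] by (intro integral_mono Bochner_Integration.integrable_add integrable_abs Bochner_Integration.integrable_diff vi) (auto simp: algebra_simps)
    also have "\<dots> = (\<integral>x. \<bar>v (x + d) - v x\<bar> \<partial>lborel) + (\<integral>x. \<bar>v (x + real k *\<^sub>R d) - v x\<bar> \<partial>lborel)"
      using vi[of 0] by (subst Bochner_Integration.integral_add) (auto simp: tr intro!: integrable_abs Bochner_Integration.integrable_diff vi)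
    finally show ?case using Suc by (simp add: algebra_simps)
  qed simp
  have "(\<integral>x. \<bar>v (x + h) - v x\<bar> \<partial>lborel) \<le> (\<integral>x. \<bar>real (Suc n) * (v (x + h /\<^sub>R real (Suc n)) - v x)\<bar> \<partial>lborel)" for n
    using step[of "Suc n" "h /\<^sub>R real (Suc n)"] by (simp add: abs_mult del: of_nat_Suc)
  from LIMSEQ_le_const[OF C1c_difference_quotient(3)[OF v, of h]] this
  have "(\<integral>x. \<bar>v (x + h) - v x\<bar> \<partial>lborel) \<le> (\<integral>x. \<bar>G x \<bullet> h\<bar> \<partial>lborel)" by blast
  also have "\<dots> \<le> (\<integral>x. norm h * norm (G x) \<partial>lborel)"
    using C1c_integrable[OF v]
    by (intro integral_mono integrable_abs integrable_mult_right integrable_norm integrable_inner_left)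
      (auto intro!: order_trans[OF Cauchy_Schwarz_ineq2] simp: mult.commute)
  finally show ?thesis by simp
qed

text \<open>Under a common translation estimate the averages over balls are equi-Lipschitz, so that the
  Arzela-Ascoli theorem applies to them, and they are uniformly close to the functions in \<open>L\<^sup>1\<close>.\<close>

definition ball_average :: "real \<Rightarrow> ('a::euclidean_space \<Rightarrow> real) \<Rightarrow> 'a \<Rightarrow> real" where
  "ball_average e v x = (\<integral>y. indicator (cball 0 e) y * v (x + y) \<partial>lborel) / measure lborel (cball 0 e :: 'a set)"

lemma integral_indicator_le:
  fixes f :: "'a::euclidean_space \<Rightarrow> real"
  assumes "integrable lborel f" "\<And>x. 0 \<le> f x" "A \<in> sets borel"
  shows "integrable lborel (\<lambda>x. indicator A x * f x)"
    "(\<integral>x. indicator A x * f x \<partial>lborel) \<le> (\<integral>x. f x \<partial>lborel)"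
proof -
  show i: "integrable lborel (\<lambda>x. indicator A x * f x)"
    using integrable_mult_indicator[of A lborel f] assms by simp
  show "(\<integral>x. indicator A x * f x \<partial>lborel) \<le> (\<integral>x. f x \<partial>lborel)"
    by (rule integral_mono[OF i assms(1)]) (auto simp: indicator_def assms)
qed

lemma integrable_translation:
  fixes v :: "'a::euclidean_space \<Rightarrow> real"
  assumes "integrable lborel v"
  shows "integrable lborel (\<lambda>y. v (x + y))"
  using integrable_distr[of "(+) x" lborel borel v] assms by (auto simp: lborel_distr_plus)

text \<open>The absolute value moves under the integral, the indicator is dropped and a translation
  reduces both bounds to the hypotheses. The constants involve the volume of the ball, so the radius
  must be fixed before equicontinuity is used.\<close>

lemma ball_average_lipschitz:
  fixes v :: "'a::euclidean_space \<Rightarrow> real"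
  assumes v: "integrable lborel v" and e: "e > 0"
    and tr: "\<And>h. (\<integral>x. \<bar>v (x + h) - v x\<bar> \<partial>lborel) \<le> C * norm h"
  shows "\<bar>ball_average e v x - ball_average e v x'\<bar> \<le> C / measure lborel (cball 0 e :: 'a set) * norm (x - x')"
    "\<bar>ball_average e v x\<bar> \<le> (\<integral>x. \<bar>v x\<bar> \<partial>lborel) / measure lborel (cball 0 e :: 'a set)"
proof -
  let ?m = "measure lborel (cball 0 e :: 'a set)" and ?I = "indicator (cball 0 e) :: 'a \<Rightarrow> real"
  have m: "?m > 0" using content_cball_pos[of e "0::'a"] e by simp
  have meas: "v \<in> borel_measurable borel" using borel_measurable_integrable[OF v] by simp
  note vt = integrable_translation[OF v]
  have vi: "integrable lborel (\<lambda>y. ?I y * v (x + y))" for x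
    using integrable_mult_indicator[OF _ vt, of "cball 0 e"] by simp
  have "\<bar>ball_average e v x - ball_average e v x'\<bar> = \<bar>\<integral>y. ?I y * v (x + y) - ?I y * v (x' + y) \<partial>lborel\<bar> / ?m"
    using m vi by (simp add: ball_average_def flip: diff_divide_distrib)
  also have "\<bar>\<integral>y. ?I y * v (x + y) - ?I y * v (x' + y) \<partial>lborel\<bar> \<le> (\<integral>y. \<bar>?I y * v (x + y) - ?I y * v (x' + y)\<bar> \<partial>lborel)"
    by (rule integral_abs_bound)
  also have "\<dots> = (\<integral>y. ?I y * \<bar>v (x + y) - v (x' + y)\<bar> \<partial>lborel)"
    by (rule Bochner_Integration.integral_cong) (auto simp: indicator_def)
  also have "\<dots> \<le> (\<integral>y. \<bar>v (x + y) - v (x' + y)\<bar> \<partial>lborel)"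
    using vt by (intro integral_indicator_le) auto
  also have "\<dots> = (\<integral>y. \<bar>v (y + (x - x')) - v y\<bar> \<partial>lborel)"
    using lborel_translation[of "\<lambda>y. \<bar>v (y + (x - x')) - v y\<bar>" x'] meas by (simp add: algebra_simps)
  also have "\<dots> \<le> C * norm (x - x')" by (rule tr)
  finally show "\<bar>ball_average e v x - ball_average e v x'\<bar> \<le> C / ?m * norm (x - x')"
    using m by (simp add: divide_right_mono)
  have "\<bar>\<integral>y. ?I y * v (x + y) \<partial>lborel\<bar> \<le> (\<integral>y. \<bar>?I y * v (x + y)\<bar> \<partial>lborel)"
    by (rule integral_abs_bound)
  also have "\<dots> = (\<integral>y. ?I y * \<bar>v (x + y)\<bar> \<partial>lborel)"
    by (rule Bochner_Integration.integral_cong) (auto simp: indicator_def)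
  also have "\<dots> \<le> (\<integral>y. \<bar>v (x + y)\<bar> \<partial>lborel)"
    using vt by (intro integral_indicator_le) auto
  also have "\<dots> = (\<integral>y. \<bar>v y\<bar> \<partial>lborel)"
    using lborel_translation[of "\<lambda>y. \<bar>v y\<bar>" x] meas by (simp add: algebra_simps)
  finally show "\<bar>ball_average e v x\<bar> \<le> (\<integral>x. \<bar>v x\<bar> \<partial>lborel) / ?m"
    using m by (simp add: ball_average_def divide_right_mono)
qed

text \<open>By Tonelli the error is at most the average over \<open>y\<close> in the ball of the L^1
  distance between \<open>v\<close> and its translate by \<open>y\<close>, which never exceeds
  \<open>C * e\<close>. On the compact set \<open>S\<close> the average is integrable by
  continuity.\<close>

lemma ball_average_L1:
  fixes v :: "'a::euclidean_space \<Rightarrow> real"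
  assumes v: "integrable lborel v" and e: "e > 0" and C: "C \<ge> 0"
    and tr: "\<And>h. (\<integral>x. \<bar>v (x + h) - v x\<bar> \<partial>lborel) \<le> C * norm h"
    and S: "compact S"
  shows "integrable lborel (\<lambda>x. indicator S x * \<bar>ball_average e v x - v x\<bar>)"
    "(\<integral>x. indicator S x * \<bar>ball_average e v x - v x\<bar> \<partial>lborel) \<le> C * e"
proof -
  let ?m = "measure lborel (cball 0 e :: 'a set)" and ?I = "indicator (cball 0 e) :: 'a \<Rightarrow> real"
  have m: "?m > 0" using content_cball_pos[of e "0::'a"] e by simp
  have meas[measurable]: "v \<in> borel_measurable borel" using borel_measurable_integrable[OF v] by simp
  note vt = integrable_translation[OF v]
  have cont: "continuous_on UNIV (ball_average e v)"
    unfolding continuous_on_iff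
  proof clarsimp
    fix x :: 'a and d :: real assume d: "d > 0"
    let ?L = "C / ?m"
    have L: "?L \<ge> 0" using C m by simp
    have "\<bar>ball_average e v y - ball_average e v x\<bar> < d" if "norm (y - x) < d / (?L + 1)" for y
    proof -
      have "\<bar>ball_average e v y - ball_average e v x\<bar> \<le> ?L * norm (y - x)"
        by (rule ball_average_lipschitz[OF v e tr])
      also have "\<dots> \<le> (?L + 1) * norm (y - x)" by (simp add: distrib_right)
      also have "\<dots> < d" using that L by (simp add: field_simps)
      finally show ?thesis .
    qed
    then show "\<exists>da>0. \<forall>x'. dist x' x < da \<longrightarrow> dist (ball_average e v x') (ball_average e v x) < d"
      using d L by (intro exI[of _ "d / (?L + 1)"]) (auto simp: dist_norm)
  qed
  then have bm[measurable]: "ball_average e v \<in> borel_measurable borel"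
    by (rule borel_measurable_continuous_onI)
  have Sb[measurable]: "S \<in> sets borel" using S by (auto intro: borel_compact)
  have "integrable lborel (\<lambda>x. indicator S x *\<^sub>R ball_average e v x)"
    by (rule borel_integrable_compact[OF S]) (rule continuous_on_subset[OF cont], auto)
  then have "integrable lborel (\<lambda>x. \<bar>indicator S x *\<^sub>R ball_average e v x - indicator S x *\<^sub>R v x\<bar>)"
    using integrable_mult_indicator[OF _ v, of S] by auto
  also have "(\<lambda>x. \<bar>indicator S x *\<^sub>R ball_average e v x - indicator S x *\<^sub>R v x\<bar>)
     = (\<lambda>x. indicator S x * \<bar>ball_average e v x - v x\<bar>)"
    by (auto simp: indicator_def)
  finally show int: "integrable lborel (\<lambda>x. indicator S x * \<bar>ball_average e v x - v x\<bar>)" .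
  have pt: "ennreal \<bar>ball_average e v x - v x\<bar> * ennreal ?m \<le> (\<integral>\<^sup>+y. ennreal (?I y * \<bar>v (x + y) - v x\<bar>) \<partial>lborel)" for x
  proof -
    have vi: "integrable lborel (\<lambda>y. ?I y * v (x + y))" "integrable lborel (\<lambda>y. ?I y * v x)"
      using integrable_mult_indicator[OF _ vt, of "cball 0 e"]
      by (auto intro!: integrable_mult_left integrable_real_indicator emeasure_lborel_cball_finite)
    have "ball_average e v x * ?m - v x * ?m = (\<integral>y. ?I y * v (x + y) - ?I y * v x \<partial>lborel)"
      using m vi by (simp add: ball_average_def)
    then have "\<bar>ball_average e v x - v x\<bar> * ?m = \<bar>\<integral>y. ?I y * v (x + y) - ?I y * v x \<partial>lborel\<bar>"
      using m by (metis abs_mult abs_of_pos left_diff_distrib)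
    then have "ennreal \<bar>ball_average e v x - v x\<bar> * ennreal ?m = ennreal (norm (\<integral>y. ?I y * v (x + y) - ?I y * v x \<partial>lborel))"
      by (simp flip: ennreal_mult')
    also have "\<dots> \<le> (\<integral>\<^sup>+y. ennreal (norm (?I y * v (x + y) - ?I y * v x)) \<partial>lborel)"
      using vi by (intro integral_norm_bound_ennreal Bochner_Integration.integrable_diff)
    also have "\<dots> = (\<integral>\<^sup>+y. ennreal (?I y * \<bar>v (x + y) - v x\<bar>) \<partial>lborel)"
      by (rule nn_integral_cong) (auto simp: indicator_def)
    finally show ?thesis .
  qed
  have "(\<integral>\<^sup>+x. ennreal (indicator S x * \<bar>ball_average e v x - v x\<bar>) \<partial>lborel) * ennreal ?m
     = (\<integral>\<^sup>+x. ennreal (indicator S x * \<bar>ball_average e v x - v x\<bar>) * ennreal ?m \<partial>lborel)"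
    by (rule nn_integral_multc[symmetric]) measurable
  also have "\<dots> \<le> (\<integral>\<^sup>+x. (\<integral>\<^sup>+y. ennreal (?I y * \<bar>v (x + y) - v x\<bar>) \<partial>lborel) \<partial>lborel)"
    by (rule nn_integral_mono) (use pt in \<open>auto simp: indicator_def\<close>)
  also have "\<dots> = (\<integral>\<^sup>+y. (\<integral>\<^sup>+x. ennreal (?I y * \<bar>v (x + y) - v x\<bar>) \<partial>lborel) \<partial>lborel)"
  proof -
    \<comment> \<open>Joint measurability is checked on the Borel sets of the product space, where
      addition and the projections are continuous.\<close>
    have "(\<lambda>p::'a \<times> 'a. v (fst p + snd p)) \<in> borel_measurable borel" "(\<lambda>p::'a \<times> 'a. v (fst p)) \<in> borel_measurable borel"
      by (rule measurable_compose[OF borel_measurable_continuous_onI meas]; intro continuous_intros)+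
    moreover have "(\<lambda>p::'a \<times> 'a. ?I (snd p)) \<in> borel_measurable borel"
    proof -
      have "(snd :: 'a \<times> 'a \<Rightarrow> 'a) \<in> borel_measurable borel"
        by (intro borel_measurable_continuous_onI continuous_intros)
      from measurable_compose[OF this, of ?I borel] show ?thesis
        by (simp add: borel_measurable_indicator)
    qed
    ultimately have "(\<lambda>p::'a \<times> 'a. ennreal (?I (snd p) * \<bar>v (fst p + snd p) - v (fst p)\<bar>)) \<in> borel_measurable borel"
      by simp
    then have "(\<lambda>(x::'a, y::'a). ennreal (?I y * \<bar>v (x + y) - v x\<bar>)) \<in> borel_measurable (lborel \<Otimes>\<^sub>M lborel)"
      by (simp add: lborel_prod split_beta')
    from lborel_pair.Fubini'[OF this] show ?thesis by simp
  qed
  also have "\<dots> \<le> (\<integral>\<^sup>+(y::'a). ennreal (C * e) * indicator (cball 0 e) y \<partial>lborel)"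
  proof (rule nn_integral_mono)
    fix y :: 'a
    show "(\<integral>\<^sup>+x. ennreal (?I y * \<bar>v (x + y) - v x\<bar>) \<partial>lborel) \<le> ennreal (C * e) * indicator (cball 0 e) y"
    proof (cases "y \<in> cball 0 e")
      case True
      have "(\<integral>\<^sup>+x. ennreal \<bar>v (x + y) - v x\<bar> \<partial>lborel) = ennreal (\<integral>x. \<bar>v (x + y) - v x\<bar> \<partial>lborel)"
        using v vt[of y] by (intro nn_integral_eq_integral integrable_abs Bochner_Integration.integrable_diff) (auto simp: add.commute)
      also have "\<dots> \<le> ennreal (C * e)"
        using True C by (intro ennreal_leI order_trans[OF tr] mult_left_mono) auto
      finally show ?thesis using True by simp
    qed simp
  qed
  also have "\<dots> = ennreal (C * e) * ennreal ?m"
  proof -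
    have "emeasure lborel (cball 0 e :: 'a set) = ennreal ?m"
      using emeasure_lborel_cball_finite[of "0::'a" e]
      by (intro emeasure_eq_ennreal_measure) (metis infinity_ennreal_def less_irrefl)
    then show ?thesis
      by (subst nn_integral_cmult_indicator) auto
  qed
  finally have *: "(\<integral>\<^sup>+x. ennreal (indicator S x * \<bar>ball_average e v x - v x\<bar>) \<partial>lborel) * ennreal ?m \<le> ennreal (C * e) * ennreal ?m" .
  have "(\<integral>\<^sup>+x. ennreal (indicator S x * \<bar>ball_average e v x - v x\<bar>) \<partial>lborel)
      = ennreal (\<integral>x. indicator S x * \<bar>ball_average e v x - v x\<bar> \<partial>lborel)"
    by (rule nn_integral_eq_integral[OF int]) auto
  with * have "ennreal ((\<integral>x. indicator S x * \<bar>ball_average e v x - v x\<bar> \<partial>lborel) * ?m) \<le> ennreal (C * e * ?m)"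
    using C e m by (simp only: ennreal_mult'' flip: ennreal_mult'')
  then show "(\<integral>x. indicator S x * \<bar>ball_average e v x - v x\<bar> \<partial>lborel) \<le> C * e"
    using C e m by (simp add: ennreal_le_iff)
qed

text \<open>Three errors of at most \<open>e / 4\<close> are added: averaging costs
  \<open>C * d\<close> for each of the two functions, and the two averages differ by at most
  \<open>\<delta>\<close> on a ball of volume \<open>\<mu>\<close>.\<close>

lemma rellich_L1_step:
  fixes v :: "nat \<Rightarrow> 'a::euclidean_space \<Rightarrow> real"
  assumes int: "\<And>n. integrable lborel (v n)" and supp: "\<And>n x. R < norm x \<Longrightarrow> v n x = 0"
    and L1: "\<And>n. (\<integral>x. \<bar>v n x\<bar> \<partial>lborel) \<le> C"
    and tr: "\<And>n h. (\<integral>x. \<bar>v n (x + h) - v n x\<bar> \<partial>lborel) \<le> C * norm h"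
    and e: "e > 0"
  shows "\<exists>k. strict_mono (k::nat \<Rightarrow> nat) \<and> (\<exists>N. \<forall>m\<ge>N. \<forall>n\<ge>N. (\<integral>x. \<bar>v (k m) x - v (k n) x\<bar> \<partial>lborel) < e)"
proof -
  have "0 \<le> (\<integral>x. \<bar>v 0 x\<bar> \<partial>lborel)" by (rule integral_nonneg_AE) auto
  with L1[of 0] have C: "C \<ge> 0" by linarith
  \<comment> \<open>The summand 1, here and in \<open>\<delta>\<close>, keeps the denominator
    positive when \<open>C\<close> or \<open>\<mu>\<close> is zero.\<close>
  define d where "d = e / (4 * (C + 1))"
  define S :: "'a set" where "S = cball 0 R"
  define \<mu> where "\<mu> = measure lborel S"
  define \<delta> where "\<delta> = e / (4 * (\<mu> + 1))"
  have mu: "\<mu> \<ge> 0" by (simp add: \<mu>_def)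
  have d: "d > 0" and dl: "\<delta> > 0"
    using e C mu by (auto simp: d_def \<delta>_def)
  let ?w = "\<lambda>n. ball_average d (v n)"
  let ?m = "measure lborel (cball 0 d :: 'a set)"
  have m: "?m > 0" using content_cball_pos[of d "0::'a"] d by simp
  define L where "L = C / ?m"
  have L: "L \<ge> 0" using C m by (simp add: L_def)
  have lip: "\<bar>?w n x - ?w n y\<bar> \<le> L * norm (x - y)" for n x y
    unfolding L_def by (rule ball_average_lipschitz(1)[OF int d tr])
  have bd: "norm (?w n x) \<le> L" for n x
    using ball_average_lipschitz(2)[OF int d tr, of n x] divide_right_mono[OF L1[of n], of ?m] m
    unfolding L_def by auto
  have cS: "compact S" by (simp add: S_def)
  obtain g k where k: "strict_mono (k :: nat \<Rightarrow> nat)"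
    and lim: "\<And>e. 0 < e \<Longrightarrow> \<exists>N. \<forall>n x. n \<ge> N \<and> x \<in> S \<longrightarrow> norm (?w (k n) x - g x) < e"
  proof (rule Arzela_Ascoli[of S ?w L, OF cS])
    show "\<exists>d>0. \<forall>n y. y \<in> S \<and> norm (x - y) < d \<longrightarrow> norm (?w n x - ?w n y) < e'"
      if "x \<in> S" "0 < e'" for x e'
    proof (intro exI[of _ "e' / (L + 1)"] conjI allI impI)
      fix n y assume "y \<in> S \<and> norm (x - y) < e' / (L + 1)"
      then have "(L + 1) * norm (x - y) < e'" using L by (simp add: field_simps)
      moreover have "L * norm (x - y) \<le> (L + 1) * norm (x - y)" by (simp add: distrib_right)
      ultimately show "norm (?w n x - ?w n y) < e'" using lip[of n x y] by simp
    qed (use that L in auto)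
  qed (use bd in auto)
  obtain N where N: "\<And>n x. n \<ge> N \<Longrightarrow> x \<in> S \<Longrightarrow> norm (?w (k n) x - g x) < \<delta> / 2"
    using lim[of "\<delta> / 2"] dl by auto
  let ?I = "indicator S :: 'a \<Rightarrow> real"
  note av = ball_average_L1[OF int d C tr cS]
  have iI: "integrable lborel (\<lambda>x. ?I x * \<delta>)"
    unfolding S_def by (intro integrable_mult_left integrable_real_indicator emeasure_lborel_cball_finite) auto
  have "(\<integral>x. \<bar>v (k m) x - v (k n) x\<bar> \<partial>lborel) < e" if mn: "m \<ge> N" "n \<ge> N" for m n
  proof -
    have "(\<integral>x. \<bar>v (k m) x - v (k n) x\<bar> \<partial>lborel)
      \<le> (\<integral>x. (?I x * \<bar>?w (k m) x - v (k m) x\<bar> + ?I x * \<bar>?w (k n) x - v (k n) x\<bar>) + ?I x * \<delta> \<partial>lborel)"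
    proof (rule integral_mono)
      fix x
      show "\<bar>v (k m) x - v (k n) x\<bar> \<le> (?I x * \<bar>?w (k m) x - v (k m) x\<bar> + ?I x * \<bar>?w (k n) x - v (k n) x\<bar>) + ?I x * \<delta>"
      proof (cases "x \<in> S")
        case True
        then have "?I x = 1" by simp
        then show ?thesis using N[OF mn(1) True] N[OF mn(2) True]
          unfolding real_norm_def by (simp only: mult_1)
      next
        case False
        then show ?thesis using supp by (simp add: S_def)
      qed
    qed (intro integrable_abs Bochner_Integration.integrable_diff Bochner_Integration.integrable_add int av iI)+
    also have "\<dots> = (\<integral>x. ?I x * \<bar>?w (k m) x - v (k m) x\<bar> \<partial>lborel) + (\<integral>x. ?I x * \<bar>?w (k n) x - v (k n) x\<bar> \<partial>lborel) + \<mu> * \<delta>"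
      using av iI by (simp add: \<mu>_def S_def)
    also have "\<dots> \<le> C * d + C * d + \<mu> * \<delta>"
      by (intro add_mono av order_refl)
    also have "\<dots> < e"
    proof -
      have "C * d \<le> (C + 1) * d" using d by simp
      also have "\<dots> = e / 4" using C by (simp add: d_def field_simps)
      finally have 1: "C * d \<le> e / 4" .
      have "\<mu> * \<delta> \<le> (\<mu> + 1) * \<delta>" using dl by simp
      also have "\<dots> = e / 4" using mu by (simp add: \<delta>_def field_simps)
      finally show ?thesis using 1 e by linarith
    qed
    finally show ?thesis .
  qed
  with k show ?thesis by blast
qed

text \<open>The extracted subsequence so far depends on the tolerance; a diagonal sequence serves
  all tolerances \<open>1 / (i + 1)\<close> at once.\<close>

lemma rellich_L1:
  fixes v :: "nat \<Rightarrow> 'a::euclidean_space \<Rightarrow> real"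
  assumes int: "\<And>n. integrable lborel (v n)" and supp: "\<And>n x. R < norm x \<Longrightarrow> v n x = 0"
    and L1: "\<And>n. (\<integral>x. \<bar>v n x\<bar> \<partial>lborel) \<le> C"
    and tr: "\<And>n h. (\<integral>x. \<bar>v n (x + h) - v n x\<bar> \<partial>lborel) \<le> C * norm h"
  obtains k where "strict_mono (k::nat \<Rightarrow> nat)"
    "\<And>e. e > 0 \<Longrightarrow> \<exists>N. \<forall>m\<ge>N. \<forall>n\<ge>N. (\<integral>x. \<bar>v (k m) x - v (k n) x\<bar> \<partial>lborel) < e"
proof -
  define P where "P i s \<longleftrightarrow> (\<exists>N. \<forall>m\<ge>N. \<forall>n\<ge>N. (\<integral>x. \<bar>v (s m) x - v (s n) x\<bar> \<partial>lborel) < inverse (real (Suc i)))"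
    for i :: nat and s :: "nat \<Rightarrow> nat"
  have 1: "\<exists>k. strict_mono k \<and> P i (r \<circ> k)" for i and r :: "nat \<Rightarrow> nat"
    unfolding P_def o_def
    by (rule rellich_L1_step[of "\<lambda>n. v (r n)" R C]) (use assms in auto)
  \<comment> \<open>The Cauchy bound for tolerance \<open>i\<close> concerns only the tail and
    survives when entries are replaced by later ones, which is what the diagonal sequence
    does.\<close>
  have 2: "P i (r \<circ> k2)" if h: "P i (r \<circ> k1)" "\<And>j. N \<le> j \<Longrightarrow> \<exists>j'. j \<le> j' \<and> k2 j = k1 j'"
    for i k1 k2 N and r :: "nat \<Rightarrow> nat"
  proof -
    obtain M where M: "\<And>m n. m \<ge> M \<Longrightarrow> n \<ge> M \<Longrightarrow>
        (\<integral>x. \<bar>v (r (k1 m)) x - v (r (k1 n)) x\<bar> \<partial>lborel) < inverse (real (Suc i))"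
      using h(1) unfolding P_def comp_apply by metis
    show ?thesis unfolding P_def
    proof (intro exI[of _ "max M N"] allI impI)
      fix m n assume "max M N \<le> m" "max M N \<le> n"
      then obtain m' n' where "m \<le> m'" "k2 m = k1 m'" "n \<le> n'" "k2 n = k1 n'" "M \<le> m" "M \<le> n"
        using h(2)[of m] h(2)[of n] by auto
      then show "(\<integral>x. \<bar>v ((r \<circ> k2) m) x - v ((r \<circ> k2) n) x\<bar> \<partial>lborel) < inverse (real (Suc i))"
        using M[of m' n'] by simp
    qed
  qed
  obtain k where k: "strict_mono (k::nat \<Rightarrow> nat)" "\<And>i. P i (id \<circ> k)"
    by (rule subsequence_diagonalization_lemma[of P id, OF 1 2]) blast+
  show ?thesis
  proof (rule that[OF k(1)])
    fix e :: real assume "e > 0"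
    then obtain i where i: "inverse (real (Suc i)) < e"
      using reals_Archimedean by blast
    obtain N where "\<forall>m\<ge>N. \<forall>n\<ge>N. (\<integral>x. \<bar>v (k m) x - v (k n) x\<bar> \<partial>lborel) < inverse (real (Suc i))"
      using k(2)[of i] unfolding P_def comp_apply id_apply by blast
    then show "\<exists>N. \<forall>m\<ge>N. \<forall>n\<ge>N. (\<integral>x. \<bar>v (k m) x - v (k n) x\<bar> \<partial>lborel) < e"
      by (intro exI[of _ N] allI impI less_trans[OF _ i]) blast
  qed
qed

text \<open>For equal signs \<open>\<bar>a - b\<bar> \<le> \<bar>a + b\<bar>\<close>, and the
  product of the two is the difference of squares. For opposite signs
  \<open>(a - b)^2 \<le> 2 * (a^2 + b^2)\<close>, where the bracket is the right-hand absolute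
  value. This converts L^1 convergence of \<open>\<psi> * \<bar>\<psi>\<bar>\<close> into L^2
  convergence of \<open>\<psi>\<close>.\<close>

lemma square_diff_le_mult_abs: "(a - b)\<^sup>2 \<le> 2 * \<bar>a * \<bar>a\<bar> - b * \<bar>b\<bar>\<bar>" for a b :: real
proof -
  have *: "(a - b)\<^sup>2 \<le> \<bar>a * \<bar>a\<bar> - b * \<bar>b\<bar>\<bar>" if "a \<ge> 0" "b \<ge> 0" for a b :: real
  proof -
    have "(a - b)\<^sup>2 = \<bar>a - b\<bar> * \<bar>a - b\<bar>" by (simp add: power2_eq_square)
    also have "\<dots> \<le> \<bar>a - b\<bar> * \<bar>a + b\<bar>" using that by (intro mult_left_mono) auto
    also have "\<dots> = \<bar>(a - b) * (a + b)\<bar>" by (simp only: abs_mult)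
    also have "(a - b) * (a + b) = a * \<bar>a\<bar> - b * \<bar>b\<bar>" using that by (simp add: algebra_simps)
    finally show ?thesis .
  qed
  have opp: "(a - b)\<^sup>2 \<le> 2 * \<bar>a * \<bar>a\<bar> - b * \<bar>b\<bar>\<bar>" if "a \<ge> 0" "b \<le> 0" for a b :: real
  proof -
    have "(a - b)\<^sup>2 \<le> 2 * (a\<^sup>2 + b\<^sup>2)" using zero_le_power2[of "a + b"] by (simp add: power2_eq_square algebra_simps)
    also have "a\<^sup>2 + b\<^sup>2 = \<bar>a * \<bar>a\<bar> - b * \<bar>b\<bar>\<bar>" using that by (simp add: power2_eq_square)
    finally show ?thesis .
  qed
  consider "a \<ge> 0 \<and> b \<ge> 0" | "a \<le> 0 \<and> b \<le> 0" | "a \<ge> 0 \<and> b \<le> 0" | "a \<le> 0 \<and> b \<ge> 0" by linarith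
  then show ?thesis
  proof cases
    case 1
    then have "(a - b)\<^sup>2 \<le> \<bar>a * \<bar>a\<bar> - b * \<bar>b\<bar>\<bar>" using * by blast
    then show ?thesis by (rule order_trans) simp
  next
    case 2
    then have "(a - b)\<^sup>2 \<le> \<bar>a * \<bar>a\<bar> - b * \<bar>b\<bar>\<bar>"
      using *[of "-a" "-b"] by (simp add: power2_commute abs_minus_commute)
    then show ?thesis by (rule order_trans) simp
  next
    case 3 then show ?thesis using opp by simp
  next
    case 4 then show ?thesis using opp[of b a] by (simp add: power2_commute abs_minus_commute)
  qed
qed

text \<open>Rellich's theorem is applied to \<open>\<psi> |\<psi>|\<close>, whose gradient is controlled by \<open>|\<psi>| |\<nabla>\<psi>|\<close>.\<close>

lemma test_functions_L2_compact:
  fixes \<psi> :: "nat \<Rightarrow> 'a::euclidean_space \<Rightarrow> real"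
  assumes psi: "\<And>n. \<psi> n \<in> test_functions D" and D: "bounded D"
    and K: "\<And>n. (\<integral>x. \<bar>\<psi> n x\<bar> * norm (grad (\<psi> n) x) \<partial>lborel) \<le> K"
    and K2: "\<And>n. (\<integral>x. (\<psi> n x)\<^sup>2 \<partial>lborel) \<le> K"
  obtains k where "strict_mono (k::nat \<Rightarrow> nat)"
    "\<And>e. e > 0 \<Longrightarrow> \<exists>N. \<forall>m\<ge>N. \<forall>n\<ge>N. (\<integral>x. (\<psi> (k m) x - \<psi> (k n) x)\<^sup>2 \<partial>lborel) < e"
proof -
  obtain R where R: "\<And>x. x \<in> D \<Longrightarrow> norm x \<le> R"
    using D by (auto simp: bounded_iff)
  let ?v = "\<lambda>n x. \<psi> n x * \<bar>\<psi> n x\<bar>"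
  have C: "C1c (\<psi> n) (grad (\<psi> n))" for n by (rule test_functions_C1c[OF psi])
  note Cv = C1c_mult_abs[OF C]
  have "0 \<le> (\<integral>x. (\<psi> 0 x)\<^sup>2 \<partial>lborel)" by (rule integral_nonneg_AE) auto
  with K2[of 0] have K0: "0 \<le> K" by linarith
  obtain k where k: "strict_mono (k::nat \<Rightarrow> nat)"
    and cau: "\<And>e. e > 0 \<Longrightarrow> \<exists>N. \<forall>m\<ge>N. \<forall>n\<ge>N. (\<integral>x. \<bar>?v (k m) x - ?v (k n) x\<bar> \<partial>lborel) < e"
  \<comment> \<open>The factor 2 stems from the gradient of
    \<open>\<psi> * \<bar>\<psi>\<bar>\<close>, which is \<open>\<nabla>\<psi>\<close> times
    \<open>2 * \<bar>\<psi>\<bar>\<close>.\<close>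
  proof (rule rellich_L1[of ?v R "2 * K"])
    show "integrable lborel (?v n)" for n by (rule C1c_integrable[OF Cv])
    show "?v n x = 0" if "R < norm x" for n x
      using test_functions_zero_outside[OF psi[of n], of x] R[of x] that by auto
    show "(\<integral>x. \<bar>?v n x\<bar> \<partial>lborel) \<le> 2 * K" for n
      using K2[of n] K0 by (simp add: abs_mult power2_eq_square)
    show "(\<integral>x. \<bar>?v n (x + h) - ?v n x\<bar> \<partial>lborel) \<le> 2 * K * norm h" for n h
    proof -
      have "(\<integral>x. norm ((2 * \<bar>\<psi> n x\<bar>) *\<^sub>R grad (\<psi> n) x) \<partial>lborel) = 2 * (\<integral>x. \<bar>\<psi> n x\<bar> * norm (grad (\<psi> n) x) \<partial>lborel)"
        by (simp add: abs_mult mult.assoc)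
      also have "\<dots> \<le> 2 * K" using K[of n] by simp
      finally show ?thesis
        using C1c_translation[OF Cv, of n h] mult_left_mono[OF _ norm_ge_zero[of h]]
        by (smt (verit, best) mult.commute)
    qed
  qed auto
  show ?thesis
  proof (rule that[OF k])
    fix e :: real assume "e > 0"
    then obtain N where N: "\<And>m n. m \<ge> N \<Longrightarrow> n \<ge> N \<Longrightarrow> (\<integral>x. \<bar>?v (k m) x - ?v (k n) x\<bar> \<partial>lborel) < e / 2"
      using cau[of "e / 2"] by auto
    have "(\<integral>x. (\<psi> (k m) x - \<psi> (k n) x)\<^sup>2 \<partial>lborel) < e" if "m \<ge> N" "n \<ge> N" for m n
    proof -
      have "(\<integral>x. (\<psi> (k m) x - \<psi> (k n) x)\<^sup>2 \<partial>lborel) \<le> (\<integral>x. 2 * \<bar>?v (k m) x - ?v (k n) x\<bar> \<partial>lborel)"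
      proof (rule integral_mono)
        show "integrable lborel (\<lambda>x. (\<psi> (k m) x - \<psi> (k n) x)\<^sup>2)"
        proof (rule integrable_continuous_support[of _ R])
          show "continuous_on UNIV (\<lambda>x. (\<psi> (k m) x - \<psi> (k n) x)\<^sup>2)"
            by (intro continuous_intros C1c_continuous(1)[OF C])
          show "(\<psi> (k m) x - \<psi> (k n) x)\<^sup>2 = 0" if "R < norm x" for x
            using test_functions_zero_outside[OF psi, of x] R[of x] that by (cases "x \<in> D") auto
        qed
        show "integrable lborel (\<lambda>x. 2 * \<bar>?v (k m) x - ?v (k n) x\<bar>)"
          by (intro integrable_mult_right integrable_abs Bochner_Integration.integrable_diff C1c_integrable[OF Cv])
      qed (rule square_diff_le_mult_abs)
      also have "\<dots> < e" using N[OF that] by simp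
      finally show ?thesis .
    qed
    then show "\<exists>N. \<forall>m\<ge>N. \<forall>n\<ge>N. (\<integral>x. (\<psi> (k m) x - \<psi> (k n) x)\<^sup>2 \<partial>lborel) < e" by blast
  qed
qed

section \<open>Square integrable functions\<close>

definition sq_int :: "'a measure \<Rightarrow> ('a \<Rightarrow> 'b::euclidean_space) \<Rightarrow> bool" where
  "sq_int M f \<longleftrightarrow> f \<in> borel_measurable M \<and> integrable M (\<lambda>x. (norm (f x))\<^sup>2)"

text \<open>The polynomial \<open>t^2 * A - 2 * t * B + C\<close> is the integral of
  \<open>(t * \<bar>f\<bar> - \<bar>g\<bar>)^2\<close>. Having the absolute value inside the
  integral gives bounds on L^1 norms of products, not only on pairings.\<close>

lemma Cauchy_Schwarz_integral:
  fixes f g :: "'a \<Rightarrow> real"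
  assumes [measurable]: "f \<in> borel_measurable M" "g \<in> borel_measurable M"
    and f: "integrable M (\<lambda>x. (f x)\<^sup>2)" and g: "integrable M (\<lambda>x. (g x)\<^sup>2)"
  shows "integrable M (\<lambda>x. f x * g x)"
    "(\<integral>x. \<bar>f x * g x\<bar> \<partial>M) \<le> sqrt (\<integral>x. (f x)\<^sup>2 \<partial>M) * sqrt (\<integral>x. (g x)\<^sup>2 \<partial>M)"
proof -
  have am: "\<bar>a * b\<bar> \<le> a\<^sup>2 + b\<^sup>2" for a b :: real
  proof -
    have "2 * (\<bar>a\<bar> * \<bar>b\<bar>) \<le> \<bar>a\<bar>\<^sup>2 + \<bar>b\<bar>\<^sup>2"
      using zero_le_power2[of "\<bar>a\<bar> - \<bar>b\<bar>"] unfolding power2_diff by linarith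
    moreover have "0 \<le> \<bar>a\<bar> * \<bar>b\<bar>" by simp
    ultimately show ?thesis unfolding abs_mult power2_abs by linarith
  qed
  show fg: "integrable M (\<lambda>x. f x * g x)"
    by (rule Bochner_Integration.integrable_bound[OF Bochner_Integration.integrable_add[OF f g]])
      (auto intro: am)
  define A B C where "A = (\<integral>x. (f x)\<^sup>2 \<partial>M)" and "B = (\<integral>x. \<bar>f x * g x\<bar> \<partial>M)" and "C = (\<integral>x. (g x)\<^sup>2 \<partial>M)"
  have A: "A \<ge> 0" and B: "B \<ge> 0" and C: "C \<ge> 0"
    by (auto simp: A_def B_def C_def intro!: integral_nonneg_AE)
  have q: "0 \<le> t\<^sup>2 * A - 2 * t * B + C" for t :: real
  proof -
    have "0 \<le> (\<integral>x. t\<^sup>2 * (f x)\<^sup>2 - 2 * t * \<bar>f x * g x\<bar> + (g x)\<^sup>2 \<partial>M)"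
    proof (rule integral_nonneg_AE, rule AE_I2)
      fix x
      have "0 \<le> (t * \<bar>f x\<bar> - \<bar>g x\<bar>)\<^sup>2" by simp
      then show "0 \<le> t\<^sup>2 * (f x)\<^sup>2 - 2 * t * \<bar>f x * g x\<bar> + (g x)\<^sup>2"
        by (simp add: power2_diff power_mult_distrib abs_mult mult_ac)
    qed
    also have "\<dots> = t\<^sup>2 * A - 2 * t * B + C"
      using f g fg unfolding A_def B_def C_def by simp
    finally show ?thesis .
  qed
  have "B\<^sup>2 \<le> A * C"
  proof (cases "A = 0")
    case True
    have "B = 0"
    proof (rule ccontr)
      assume "B \<noteq> 0"
      \<comment> \<open>For \<open>A = 0\<close> the polynomial is affine in \<open>t\<close>; at
        this \<open>t\<close> it would equal -1.\<close>
      then have "2 * ((C + 1) / (2 * B)) * B = C + 1" by simp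
      then show False using q[of "(C + 1) / (2 * B)"] True by simp
    qed
    then show ?thesis using True by simp
  next
    case False
    \<comment> \<open>The value \<open>t = B / A\<close> minimises the polynomial.\<close>
    then have "A * ((B / A)\<^sup>2 * A - 2 * (B / A) * B + C) = A * C - B\<^sup>2"
      by (simp add: field_simps power2_eq_square)
    moreover have "0 \<le> A * ((B / A)\<^sup>2 * A - 2 * (B / A) * B + C)"
      using q A by (intro mult_nonneg_nonneg)
    ultimately show ?thesis by simp
  qed
  then show "(\<integral>x. \<bar>f x * g x\<bar> \<partial>M) \<le> sqrt (\<integral>x. (f x)\<^sup>2 \<partial>M) * sqrt (\<integral>x. (g x)\<^sup>2 \<partial>M)"
    unfolding A_def[symmetric] B_def[symmetric] C_def[symmetric]
    by (simp add: real_le_rsqrt flip: real_sqrt_mult)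
qed

lemma sq_int_norm_mult:
  fixes f :: "'a \<Rightarrow> 'b::euclidean_space" and g :: "'a \<Rightarrow> 'c::euclidean_space"
  assumes "sq_int M f" "sq_int M g"
  shows "integrable M (\<lambda>x. norm (f x) * norm (g x))"
    "(\<integral>x. norm (f x) * norm (g x) \<partial>M) \<le> sqrt (\<integral>x. (norm (f x))\<^sup>2 \<partial>M) * sqrt (\<integral>x. (norm (g x))\<^sup>2 \<partial>M)"
  using Cauchy_Schwarz_integral[of "\<lambda>x. norm (f x)" M "\<lambda>x. norm (g x)"] assms
  by (auto simp: sq_int_def)

lemma sq_int_inner:
  assumes "sq_int M f" "sq_int M g"
  shows "integrable M (\<lambda>x. f x \<bullet> g x)"
    "\<bar>\<integral>x. f x \<bullet> g x \<partial>M\<bar> \<le> sqrt (\<integral>x. (norm (f x))\<^sup>2 \<partial>M) * sqrt (\<integral>x. (norm (g x))\<^sup>2 \<partial>M)"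
proof -
  have m: "f \<in> borel_measurable M" "g \<in> borel_measurable M" using assms by (auto simp: sq_int_def)
  show i: "integrable M (\<lambda>x. f x \<bullet> g x)"
    by (rule Bochner_Integration.integrable_bound[OF sq_int_norm_mult(1)[OF assms]])
      (use m in \<open>auto intro!: borel_measurable_inner simp: Cauchy_Schwarz_ineq2\<close>)
  have "\<bar>\<integral>x. f x \<bullet> g x \<partial>M\<bar> \<le> (\<integral>x. \<bar>f x \<bullet> g x\<bar> \<partial>M)" by (rule integral_abs_bound)
  also have "\<dots> \<le> (\<integral>x. norm (f x) * norm (g x) \<partial>M)"
    by (intro integral_mono integrable_abs i sq_int_norm_mult[OF assms] Cauchy_Schwarz_ineq2)
  also have "\<dots> \<le> sqrt (\<integral>x. (norm (f x))\<^sup>2 \<partial>M) * sqrt (\<integral>x. (norm (g x))\<^sup>2 \<partial>M)"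
    by (rule sq_int_norm_mult[OF assms])
  finally show "\<bar>\<integral>x. f x \<bullet> g x \<partial>M\<bar> \<le> sqrt (\<integral>x. (norm (f x))\<^sup>2 \<partial>M) * sqrt (\<integral>x. (norm (g x))\<^sup>2 \<partial>M)" .
qed

lemma norm_add_sq: "(norm (a + b))\<^sup>2 = (norm a)\<^sup>2 + 2 * (a \<bullet> b) + (norm b)\<^sup>2" for a b :: "'b::real_inner"
  by (simp add: power2_norm_eq_inner inner_add_left inner_add_right inner_commute)

lemma norm_diff_sq: "(norm (a - b))\<^sup>2 = (norm a)\<^sup>2 - 2 * (a \<bullet> b) + (norm b)\<^sup>2" for a b :: "'b::real_inner"
  by (simp add: power2_norm_eq_inner inner_diff_left inner_diff_right inner_commute)

lemma sq_int_add:
  assumes "sq_int M f" "sq_int M g"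
  shows "sq_int M (\<lambda>x. f x + g x)"
  unfolding sq_int_def norm_add_sq
  using assms sq_int_inner(1)[OF assms] by (auto simp: sq_int_def)

lemma sq_int_scaleR: "sq_int M f \<Longrightarrow> sq_int M (\<lambda>x. c *\<^sub>R f x)"
  by (auto simp: sq_int_def power_mult_distrib)

lemma sq_int_diff:
  assumes "sq_int M f" "sq_int M g"
  shows "sq_int M (\<lambda>x. f x - g x)"
  using sq_int_add[OF assms(1) sq_int_scaleR[OF assms(2), of "-1"]] by simp

lemma sq_int_norm: "sq_int M f \<Longrightarrow> sq_int M (\<lambda>x. norm (f x))"
  by (auto simp: sq_int_def)

lemma (in finite_measure) sq_int_const: "sq_int M (\<lambda>x. c)"
  by (auto simp: sq_int_def)

lemma (in finite_measure) sq_int_integrable: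
  assumes "sq_int M f"
  shows "integrable M f"
    "(\<integral>x. norm (f x) \<partial>M) \<le> sqrt (\<integral>x. (norm (f x))\<^sup>2 \<partial>M) * sqrt (measure M (space M))"
proof -
  show "(\<integral>x. norm (f x) \<partial>M) \<le> sqrt (\<integral>x. (norm (f x))\<^sup>2 \<partial>M) * sqrt (measure M (space M))"
    using sq_int_norm_mult(2)[OF assms sq_int_const[of "1::real"]] by simp
  have "integrable M (\<lambda>x. norm (f x))"
    using sq_int_norm_mult(1)[OF assms sq_int_const[of "1::real"]] by simp
  then show "integrable M f"
    using assms by (simp add: sq_int_def integrable_norm_iff)
qed

lemma sq_int_bound:
  assumes "sq_int M g" "f \<in> borel_measurable M" "\<And>x. x \<in> space M \<Longrightarrow> norm (f x) \<le> norm (g x)"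
  shows "sq_int M f"
  using assms unfolding sq_int_def
  by (auto intro!: Bochner_Integration.integrable_bound[of M "\<lambda>x. (norm (g x))\<^sup>2" "\<lambda>x. (norm (f x))\<^sup>2"] power_mono)

section \<open>Convergence in L^2\<close>

lemma tendsto_0_squeeze: "(\<And>n. \<bar>f n\<bar> \<le> g n) \<Longrightarrow> g \<longlonglongrightarrow> (0::real) \<Longrightarrow> f \<longlonglongrightarrow> 0"
  by (rule Lim_null_comparison[where g = g]) auto

text \<open>Cauchy-Schwarz. With \<open>z = 1\<close> on a finite measure it passes from L^2 to L^1;
  with \<open>z\<close> the inverse root of the weight it removes the weight from a convergent
  sequence of gradients.\<close>

lemma L2_tendsto_mult:
  assumes w: "\<And>n. sq_int M (w n)" "sq_int M w0"
    and lim: "(\<lambda>n. \<integral>x. (norm (w n x - w0 x))\<^sup>2 \<partial>M) \<longlonglongrightarrow> 0" and z: "sq_int M z"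
  shows "(\<lambda>n. \<integral>x. norm (w n x - w0 x) * norm (z x) \<partial>M) \<longlonglongrightarrow> 0"
proof (rule tendsto_0_squeeze)
  have "(\<lambda>n. sqrt (\<integral>x. (norm (w n x - w0 x))\<^sup>2 \<partial>M) * sqrt (\<integral>x. (norm (z x))\<^sup>2 \<partial>M)) \<longlonglongrightarrow> sqrt 0 * sqrt (\<integral>x. (norm (z x))\<^sup>2 \<partial>M)"
    by (intro tendsto_intros lim)
  then show "(\<lambda>n. sqrt (\<integral>x. (norm (w n x - w0 x))\<^sup>2 \<partial>M) * sqrt (\<integral>x. (norm (z x))\<^sup>2 \<partial>M)) \<longlonglongrightarrow> 0" by simp
  show "\<bar>\<integral>x. norm (w n x - w0 x) * norm (z x) \<partial>M\<bar> \<le> sqrt (\<integral>x. (norm (w n x - w0 x))\<^sup>2 \<partial>M) * sqrt (\<integral>x. (norm (z x))\<^sup>2 \<partial>M)" for n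
    using sq_int_norm_mult(2)[OF sq_int_diff[OF w(1) w(2)] z, of n]
    by (subst abs_of_nonneg) (auto intro!: integral_nonneg_AE)
qed

lemma L2_tendsto_inner:
  assumes w: "\<And>n. sq_int M (w n)" "sq_int M w0"
    and lim: "(\<lambda>n. \<integral>x. (norm (w n x - w0 x))\<^sup>2 \<partial>M) \<longlonglongrightarrow> 0" and z: "sq_int M z"
  shows "(\<lambda>n. \<integral>x. w n x \<bullet> z x \<partial>M) \<longlonglongrightarrow> (\<integral>x. w0 x \<bullet> z x \<partial>M)"
proof -
  have "(\<lambda>n. \<integral>x. (w n x - w0 x) \<bullet> z x \<partial>M) \<longlonglongrightarrow> 0"
  proof (rule tendsto_0_squeeze[OF _ L2_tendsto_mult[OF assms]])
    fix n
    note d = sq_int_diff[OF w(1)[of n] w(2)]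
    have "\<bar>\<integral>x. (w n x - w0 x) \<bullet> z x \<partial>M\<bar> \<le> (\<integral>x. \<bar>(w n x - w0 x) \<bullet> z x\<bar> \<partial>M)" by (rule integral_abs_bound)
    also have "\<dots> \<le> (\<integral>x. norm (w n x - w0 x) * norm (z x) \<partial>M)"
      by (intro integral_mono integrable_abs sq_int_inner d z sq_int_norm_mult Cauchy_Schwarz_ineq2)
    finally show "\<bar>\<integral>x. (w n x - w0 x) \<bullet> z x \<partial>M\<bar> \<le> (\<integral>x. norm (w n x - w0 x) * norm (z x) \<partial>M)" .
  qed
  then have "(\<lambda>n. (\<integral>x. w n x \<bullet> z x \<partial>M) - (\<integral>x. w0 x \<bullet> z x \<partial>M)) \<longlonglongrightarrow> 0"
    using sq_int_inner(1)[OF w(1) z] sq_int_inner(1)[OF w(2) z] by (simp add: inner_diff_left)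
  then show ?thesis by (rule LIM_zero_cancel)
qed

lemma L2_tendsto_norm:
  assumes w: "\<And>n. sq_int M (w n)" "sq_int M w0"
    and lim: "(\<lambda>n. \<integral>x. (norm (w n x - w0 x))\<^sup>2 \<partial>M) \<longlonglongrightarrow> 0"
  shows "(\<lambda>n. \<integral>x. (norm (w n x))\<^sup>2 \<partial>M) \<longlonglongrightarrow> (\<integral>x. (norm (w0 x))\<^sup>2 \<partial>M)"
proof -
  have eq: "(\<integral>x. (norm (w n x))\<^sup>2 \<partial>M) = (\<integral>x. (norm (w n x - w0 x))\<^sup>2 \<partial>M) + 2 * (\<integral>x. w n x \<bullet> w0 x \<partial>M)
      - (\<integral>x. (norm (w0 x))\<^sup>2 \<partial>M)" for n
    using w sq_int_inner(1)[OF w(1) w(2)] by (simp add: norm_diff_sq sq_int_def)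
  have "(\<lambda>n. (\<integral>x. (norm (w n x - w0 x))\<^sup>2 \<partial>M) + 2 * (\<integral>x. w n x \<bullet> w0 x \<partial>M) - (\<integral>x. (norm (w0 x))\<^sup>2 \<partial>M))
     \<longlonglongrightarrow> 0 + 2 * (\<integral>x. w0 x \<bullet> w0 x \<partial>M) - (\<integral>x. (norm (w0 x))\<^sup>2 \<partial>M)"
    by (intro tendsto_intros lim L2_tendsto_inner[OF w lim w(2)])
  moreover have "(\<integral>x. w0 x \<bullet> w0 x \<partial>M) = (\<integral>x. (norm (w0 x))\<^sup>2 \<partial>M)"
    by (simp add: power2_norm_eq_inner)
  ultimately show ?thesis unfolding eq by simp
qed

lemma L2_AE_subseq:
  fixes w :: "nat \<Rightarrow> 'a \<Rightarrow> 'b::euclidean_space"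
  assumes w: "\<And>n. sq_int M (w n)" "sq_int M w0"
    and lim: "(\<lambda>n. \<integral>x. (norm (w n x - w0 x))\<^sup>2 \<partial>M) \<longlonglongrightarrow> 0"
  obtains r where "strict_mono (r::nat \<Rightarrow> nat)" "AE x in M. (\<lambda>n. w (r n) x) \<longlonglongrightarrow> w0 x"
proof -
  have "\<exists>r::nat \<Rightarrow> nat. strict_mono r \<and> (AE x in M. (\<lambda>n. (norm (w (r n) x - w0 x))\<^sup>2) \<longlonglongrightarrow> 0)"
    by (rule tendsto_L1_AE_subseq[of M "\<lambda>n x. (norm (w n x - w0 x))\<^sup>2"])
      (use lim sq_int_diff[OF w] in \<open>auto simp: sq_int_def\<close>)
  then obtain r where r: "strict_mono (r::nat \<Rightarrow> nat)" and ae: "AE x in M. (\<lambda>n. (norm (w (r n) x - w0 x))\<^sup>2) \<longlonglongrightarrow> 0"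
    by blast
  from ae have "AE x in M. (\<lambda>n. w (r n) x) \<longlonglongrightarrow> w0 x"
  proof eventually_elim
    case (elim x)
    from tendsto_real_sqrt[OF elim] have "(\<lambda>n. norm (w (r n) x - w0 x)) \<longlonglongrightarrow> 0" by simp
    then show ?case by (metis LIM_zero_cancel tendsto_norm_zero_iff)
  qed
  with r show ?thesis by (rule that)
qed

text \<open>Fatou's lemma for nonnegative integrals, recast so that integrability of the limit is a
  conclusion. \<open>C\<close> is nonnegative because it dominates one of the integrals.\<close>

lemma Fatou_integral:
  fixes u :: "nat \<Rightarrow> 'a \<Rightarrow> real"
  assumes u: "\<And>n. integrable M (u n)" "\<And>n x. 0 \<le> u n x" and l: "l \<in> borel_measurable M" "\<And>x. 0 \<le> l x"
    and ae: "AE x in M. (\<lambda>n. u n x) \<longlonglongrightarrow> l x" and C: "eventually (\<lambda>n. (\<integral>x. u n x \<partial>M) \<le> C) sequentially"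
  shows "integrable M l" "(\<integral>x. l x \<partial>M) \<le> C"
proof -
  obtain n0 where "(\<integral>x. u n0 x \<partial>M) \<le> C" using C by (auto simp: eventually_sequentially)
  moreover have "0 \<le> (\<integral>x. u n0 x \<partial>M)" by (rule integral_nonneg_AE) (simp add: u)
  ultimately have C0: "0 \<le> C" by linarith
  have "(\<integral>\<^sup>+x. ennreal (l x) \<partial>M) = (\<integral>\<^sup>+x. liminf (\<lambda>n. ennreal (u n x)) \<partial>M)"
  proof (rule nn_integral_cong_AE)
    show "AE x in M. ennreal (l x) = liminf (\<lambda>n. ennreal (u n x))"
      using ae by eventually_elim (auto intro!: lim_imp_Liminf[symmetric] tendsto_ennrealI)
  qed
  also have "\<dots> \<le> liminf (\<lambda>n. \<integral>\<^sup>+x. ennreal (u n x) \<partial>M)"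
    using u by (intro nn_integral_liminf) auto
  also have "\<dots> \<le> liminf (\<lambda>n. ennreal C)"
  proof (rule Liminf_mono)
    show "\<forall>\<^sub>F n in sequentially. (\<integral>\<^sup>+x. ennreal (u n x) \<partial>M) \<le> ennreal C"
      using C by eventually_elim (subst nn_integral_eq_integral, auto intro: ennreal_leI simp: u)
  qed
  finally have b: "(\<integral>\<^sup>+x. ennreal (l x) \<partial>M) \<le> ennreal C" by (simp add: Liminf_const)
  show i: "integrable M l"
  proof (rule integrableI_bounded[OF l(1)])
    have "(\<integral>\<^sup>+x. ennreal (norm (l x)) \<partial>M) \<le> ennreal C" using b l(2) by simp
    then show "(\<integral>\<^sup>+x. ennreal (norm (l x)) \<partial>M) < \<infinity>" using le_less_trans ennreal_less_top by (metis infinity_ennreal_def)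
  qed
  have "ennreal (\<integral>x. l x \<partial>M) \<le> ennreal C"
    using b nn_integral_eq_integral[OF i] l(2) by simp
  then show "(\<integral>x. l x \<partial>M) \<le> C" using C0 by (simp add: ennreal_le_iff)
qed

text \<open>On a finite measure space an L^2 Cauchy sequence is Cauchy in L^1, so a subsequence
  converges almost everywhere. Fatou's lemma, applied to \<open>w n - w (r i)\<close> as
  \<open>i\<close> grows, then bounds the distance of every late \<open>w n\<close> from the
  limit.\<close>

lemma (in finite_measure) L2_complete:
  fixes w :: "nat \<Rightarrow> 'a \<Rightarrow> 'b::euclidean_space"
  assumes w: "\<And>n. sq_int M (w n)"
    and cau: "\<And>e. e > 0 \<Longrightarrow> \<exists>N. \<forall>m\<ge>N. \<forall>n\<ge>N. (\<integral>x. (norm (w m x - w n x))\<^sup>2 \<partial>M) < e"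
  obtains w0 where "sq_int M w0" "(\<lambda>n. \<integral>x. (norm (w n x - w0 x))\<^sup>2 \<partial>M) \<longlonglongrightarrow> 0"
proof -
  define \<mu> where "\<mu> = measure M (space M)"
  have mu: "\<mu> \<ge> 0" by (simp add: \<mu>_def)
  have wm[measurable]: "w n \<in> borel_measurable M" for n using w by (simp add: sq_int_def)
  have L1: "\<exists>N. \<forall>i\<ge>N. \<forall>j\<ge>N. (\<integral>x. norm (w i x - w j x) \<partial>M) < e" if "e > 0" for e
  proof -
    define d where "d = e / (sqrt \<mu> + 1)"
    have s: "sqrt \<mu> + 1 > 0" using mu by (simp add: add_nonneg_pos)
    have d: "d > 0" using that s by (simp add: d_def)
    then obtain N where N: "\<And>m n. m \<ge> N \<Longrightarrow> n \<ge> N \<Longrightarrow> (\<integral>x. (norm (w m x - w n x))\<^sup>2 \<partial>M) < d\<^sup>2"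
      using cau[of "d\<^sup>2"] by auto
    have "(\<integral>x. norm (w i x - w j x) \<partial>M) < e" if "i \<ge> N" "j \<ge> N" for i j
    proof -
      have "sqrt (\<integral>x. (norm (w i x - w j x))\<^sup>2 \<partial>M) \<le> d"
        using N[OF that] d by (simp add: real_le_lsqrt less_imp_le)
      then have "sqrt (\<integral>x. (norm (w i x - w j x))\<^sup>2 \<partial>M) * sqrt \<mu> \<le> d * sqrt \<mu>"
        using mu by (simp add: mult_right_mono)
      also have "d * sqrt \<mu> < d * (sqrt \<mu> + 1)" using d by simp
      also have "\<dots> = e" using s by (simp add: d_def)
      finally show ?thesis
        using sq_int_integrable(2)[OF sq_int_diff[OF w[of i] w[of j]]] by (simp add: \<mu>_def)
    qed
    then show ?thesis by blast
  qed
  obtain r where r: "strict_mono r" and ae: "AE x in M. Cauchy (\<lambda>i. w (r i) x)"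
    by (rule cauchy_L1_AE_cauchy_subseq[OF sq_int_integrable(1)[OF w] L1])
  define w0 where "w0 x = lim (\<lambda>i. w (r i) x)" for x
  have m0[measurable]: "w0 \<in> borel_measurable M"
    unfolding w0_def by (rule borel_measurable_lim_metric) simp
  have lim: "AE x in M. (\<lambda>i. w (r i) x) \<longlonglongrightarrow> w0 x"
    using ae by eventually_elim (simp add: w0_def Cauchy_convergent convergent_LIMSEQ_iff[symmetric])
  have dif: "integrable M (\<lambda>x. (norm (w n x - w k x))\<^sup>2)" for n k
    using sq_int_diff[OF w[of n] w[of k]] by (simp add: sq_int_def)
  have key: "\<exists>N. \<forall>n\<ge>N. integrable M (\<lambda>x. (norm (w n x - w0 x))\<^sup>2) \<and> (\<integral>x. (norm (w n x - w0 x))\<^sup>2 \<partial>M) \<le> e" if e: "e > 0" for e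
  proof -
    obtain N where N: "\<And>m n. m \<ge> N \<Longrightarrow> n \<ge> N \<Longrightarrow> (\<integral>x. (norm (w m x - w n x))\<^sup>2 \<partial>M) < e"
      using cau[OF e] by auto
    have "integrable M (\<lambda>x. (norm (w n x - w0 x))\<^sup>2) \<and> (\<integral>x. (norm (w n x - w0 x))\<^sup>2 \<partial>M) \<le> e" if n: "n \<ge> N" for n
    proof -
      have a: "AE x in M. (\<lambda>i. (norm (w n x - w (r i) x))\<^sup>2) \<longlonglongrightarrow> (norm (w n x - w0 x))\<^sup>2"
        using lim by eventually_elim (intro tendsto_intros)
      have c: "eventually (\<lambda>i. (\<integral>x. (norm (w n x - w (r i) x))\<^sup>2 \<partial>M) \<le> e) sequentially"
        using eventually_ge_at_top[of N]
      proof eventually_elim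
        case (elim i)
        then have "N \<le> r i" using seq_suble[OF r, of i] by linarith
        from N[OF n this] show ?case by simp
      qed
      have m: "(\<lambda>x. (norm (w n x - w0 x))\<^sup>2) \<in> borel_measurable M" by measurable
      show ?thesis using Fatou_integral[OF dif _ m _ a c] by simp
    qed
    then show ?thesis by blast
  qed
  obtain N where "integrable M (\<lambda>x. (norm (w N x - w0 x))\<^sup>2)" using key[of 1] by auto
  then have "sq_int M (\<lambda>x. w N x - w0 x)" by (simp add: sq_int_def)
  from sq_int_diff[OF w[of N] this] have s0: "sq_int M w0" by simp
  have "(\<lambda>n. \<integral>x. (norm (w n x - w0 x))\<^sup>2 \<partial>M) \<longlonglongrightarrow> 0"
  proof (rule LIMSEQ_I)
    fix e :: real assume "e > 0"
    then obtain N where "\<forall>n\<ge>N. (\<integral>x. (norm (w n x - w0 x))\<^sup>2 \<partial>M) \<le> e / 2" using key[of "e / 2"] by auto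
    moreover have "0 \<le> (\<integral>x. (norm (w n x - w0 x))\<^sup>2 \<partial>M)" for n by (intro integral_nonneg_AE) auto
    ultimately show "\<exists>N. \<forall>n\<ge>N. norm ((\<integral>x. (norm (w n x - w0 x))\<^sup>2 \<partial>M) - 0) < e"
      using \<open>e > 0\<close> by (intro exI[of _ N]) (fastforce simp: abs_of_nonneg)
  qed
  with s0 show ?thesis by (rule that)
qed

section \<open>Weighted energies on a bounded open set\<close>

text \<open>The weight may degenerate towards the boundary. The bound \<open>A\<close> gives test
  functions finite energy, and integrability of \<open>1 / \<rho>\<close> lets the energy control
  the L^1 norm of the gradient. Both \<open>a\<close> on a component and the constant weight 1 are
  instances.\<close>

locale weighted_domain =
  fixes D :: "'a::euclidean_space set" and \<rho> :: "'a \<Rightarrow> real" and A :: real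
  assumes open_D: "open D" and bounded_D: "bounded D"
    and cont_weight: "continuous_on D \<rho>" and weight_pos: "\<And>x. x \<in> D \<Longrightarrow> 0 < \<rho> x"
    and weight_le: "\<And>x. x \<in> D \<Longrightarrow> \<rho> x \<le> A"
    and integrable_inverse_weight: "integrable (lebesgue_on D) (\<lambda>x. 1 / \<rho> x)"
begin

abbreviation "M \<equiv> lebesgue_on D"

lemma D_sets[simp, measurable]: "D \<in> sets lebesgue" "D \<in> sets borel"
  using open_D by (auto intro: lmeasurable_open[THEN fmeasurableD] simp: bounded_D)

sublocale finite_measure M
  using lmeasurable_open[OF bounded_D open_D] by (rule finite_measure_lebesgue_on)

lemma borel_imp_measurable_M:
  fixes f :: "'a \<Rightarrow> 'b::euclidean_space"
  shows "f \<in> borel_measurable borel \<Longrightarrow> f \<in> borel_measurable M"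
  by (intro measurable_restrict_space1 measurable_completion) simp

lemma integral_M:
  fixes f :: "'a \<Rightarrow> 'b::euclidean_space"
  assumes f: "f \<in> borel_measurable borel" "\<And>x. x \<notin> D \<Longrightarrow> f x = 0"
  shows "integral\<^sup>L M f = integral\<^sup>L lborel f" "integrable M f \<longleftrightarrow> integrable lborel f"
proof -
  have eq: "(\<lambda>x. indicator D x *\<^sub>R f x) = f"
    using f(2) by (force simp: indicator_def)
  show "integral\<^sup>L M f = integral\<^sup>L lborel f"
    using f by (simp add: integral_restrict_space eq integral_completion)
  show "integrable M f \<longleftrightarrow> integrable lborel f"
    using f by (simp add: integrable_restrict_space eq integrable_completion)
qed

section \<open>Test functions as elements of L^1 and L^2\<close>

lemma test_borel:
  assumes "\<phi> \<in> test_functions U"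
  shows "\<phi> \<in> borel_measurable borel" "grad \<phi> \<in> borel_measurable borel"
  using C1c_borel[OF test_functions_C1c[OF assms]] .

lemma test_measurable:
  assumes "\<phi> \<in> test_functions U"
  shows "\<phi> \<in> borel_measurable M" "grad \<phi> \<in> borel_measurable M"
  using test_borel[OF assms] by (auto intro: borel_imp_measurable_M)

lemma test_bounded:
  assumes "\<phi> \<in> test_functions U"
  obtains B where "B > 0" "\<And>x. \<bar>\<phi> x\<bar> \<le> B" "\<And>x. norm (grad \<phi> x) \<le> B"
proof -
  obtain K where K: "compact K" "\<And>x. x \<notin> K \<Longrightarrow> \<phi> x = 0 \<and> grad \<phi> x = 0"
    using test_functions_support[OF assms] by metis
  note c = C1c_continuous[OF test_functions_C1c[OF assms], of K]
  have "bounded (\<phi> ` K)" "bounded (grad \<phi> ` K)"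
    using c K by (auto intro!: compact_imp_bounded compact_continuous_image)
  then obtain a b where ab: "a > 0" "b > 0" "\<And>x. x \<in> K \<Longrightarrow> norm (\<phi> x) \<le> a" "\<And>x. x \<in> K \<Longrightarrow> norm (grad \<phi> x) \<le> b"
    by (auto simp: bounded_pos)
  show ?thesis
  proof (rule that[of "max a b"])
    show "\<bar>\<phi> x\<bar> \<le> max a b" "norm (grad \<phi> x) \<le> max a b" for x
      using ab(1,2) ab(3)[of x] ab(4)[of x] K(2)[of x] unfolding max_def by (smt (verit) norm_zero real_norm_def)+
  qed (use ab in auto)
qed

lemma bounded_sq_int:
  fixes f :: "'a \<Rightarrow> 'b::euclidean_space"
  assumes "f \<in> borel_measurable M" "\<And>x. x \<in> D \<Longrightarrow> norm (f x) \<le> B"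
  shows "sq_int M f"
  using sq_int_bound[OF sq_int_const[of B] assms(1)] assms(2) by (force simp: abs_if)

lemma weight_measurable: "\<rho> \<in> borel_measurable M"
  by (rule continuous_imp_measurable_on_sets_lebesgue[OF cont_weight]) simp

lemma sqrt_weight_bounds: "x \<in> D \<Longrightarrow> 0 < sqrt (\<rho> x)" "x \<in> D \<Longrightarrow> sqrt (\<rho> x) \<le> sqrt A"
  using weight_pos weight_le by auto

lemma sq_int_test:
  assumes "\<phi> \<in> test_functions D"
  shows "sq_int M \<phi>" "sq_int M (grad \<phi>)" "sq_int M (\<lambda>x. sqrt (\<rho> x) *\<^sub>R grad \<phi> x)"
proof -
  obtain B where B: "B > 0" "\<And>x. \<bar>\<phi> x\<bar> \<le> B" "\<And>x. norm (grad \<phi> x) \<le> B"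
    by (rule test_bounded[OF assms]) blast
  note m = test_measurable[OF assms]
  show "sq_int M \<phi>" "sq_int M (grad \<phi>)"
    using bounded_sq_int[OF m(1)] bounded_sq_int[OF m(2)] B by auto
  show "sq_int M (\<lambda>x. sqrt (\<rho> x) *\<^sub>R grad \<phi> x)"
  proof (rule bounded_sq_int[of _ "sqrt A * B"])
    show "(\<lambda>x. sqrt (\<rho> x) *\<^sub>R grad \<phi> x) \<in> borel_measurable M"
      using m weight_measurable by auto
    show "norm (sqrt (\<rho> x) *\<^sub>R grad \<phi> x) \<le> sqrt A * B" if "x \<in> D" for x
      using sqrt_weight_bounds[OF that] B(3)[of x] by (auto intro!: mult_mono)
  qed
qed

lemma sq_int_inverse_sqrt_weight: "sq_int M (\<lambda>x. 1 / sqrt (\<rho> x))"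
proof -
  have "(norm (1 / sqrt (\<rho> x)))\<^sup>2 = 1 / \<rho> x" if "x \<in> D" for x
    using weight_pos[OF that] by (simp add: power_divide)
  then have "integrable M (\<lambda>x. (norm (1 / sqrt (\<rho> x)))\<^sup>2)"
    using integrable_inverse_weight by (subst Bochner_Integration.integrable_cong[OF refl]) auto
  then show ?thesis using weight_measurable by (auto simp: sq_int_def)
qed

lemma integrable_mult_bounded:
  fixes f h :: "'a \<Rightarrow> real"
  assumes f: "integrable M f" and h: "h \<in> borel_measurable M" "\<And>x. \<bar>h x\<bar> \<le> B"
  shows "integrable M (\<lambda>x. f x * h x)" "\<bar>\<integral>x. f x * h x \<partial>M\<bar> \<le> B * (\<integral>x. \<bar>f x\<bar> \<partial>M)"
proof -
  have b: "\<bar>f x * h x\<bar> \<le> B * \<bar>f x\<bar>" for x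
    using mult_right_mono[OF h(2)[of x], of "\<bar>f x\<bar>"] by (simp add: abs_mult mult.commute)
  show i: "integrable M (\<lambda>x. f x * h x)"
    by (rule Bochner_Integration.integrable_bound[of _ "\<lambda>x. B * \<bar>f x\<bar>"])
      (use f h b in \<open>auto intro!: AE_I2 order_trans[OF b]\<close>)
  have "\<bar>\<integral>x. f x * h x \<partial>M\<bar> \<le> (\<integral>x. \<bar>f x * h x\<bar> \<partial>M)" by (rule integral_abs_bound)
  also have "\<dots> \<le> (\<integral>x. B * \<bar>f x\<bar> \<partial>M)"
    by (intro integral_mono integrable_abs i b integrable_mult_right f)
  finally show "\<bar>\<integral>x. f x * h x \<partial>M\<bar> \<le> B * (\<integral>x. \<bar>f x\<bar> \<partial>M)" by simp
qed

lemma L1_tendsto_mult_bounded: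
  fixes f :: "nat \<Rightarrow> 'a \<Rightarrow> real" and h :: "'a \<Rightarrow> real"
  assumes f: "\<And>n. integrable M (f n)" "integrable M f0"
    and lim: "(\<lambda>n. \<integral>x. \<bar>f0 x - f n x\<bar> \<partial>M) \<longlonglongrightarrow> 0"
    and h: "h \<in> borel_measurable M" "\<And>x. \<bar>h x\<bar> \<le> B"
  shows "(\<lambda>n. \<integral>x. f n x * h x \<partial>M) \<longlonglongrightarrow> (\<integral>x. f0 x * h x \<partial>M)"
proof -
  have "(\<lambda>n. \<integral>x. (f0 x - f n x) * h x \<partial>M) \<longlonglongrightarrow> 0"
  proof (rule tendsto_0_squeeze)
    show "\<bar>\<integral>x. (f0 x - f n x) * h x \<partial>M\<bar> \<le> B * (\<integral>x. \<bar>f0 x - f n x\<bar> \<partial>M)" for n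
      using integrable_mult_bounded(2)[OF Bochner_Integration.integrable_diff[OF f(2) f(1)[of n]] h] .
    show "(\<lambda>n. B * (\<integral>x. \<bar>f0 x - f n x\<bar> \<partial>M)) \<longlonglongrightarrow> 0"
      using tendsto_mult[OF tendsto_const lim, of B] by simp
  qed
  then have "(\<lambda>n. (\<integral>x. f0 x * h x \<partial>M) - (\<integral>x. f n x * h x \<partial>M)) \<longlonglongrightarrow> 0"
    using integrable_mult_bounded(1)[OF _ h] f by (simp add: left_diff_distrib)
  from tendsto_diff[OF tendsto_const this, of "\<integral>x. f0 x * h x \<partial>M"] show ?thesis by simp
qed

lemma test_integration_by_parts:
  assumes "\<psi> \<in> test_functions D" "\<phi> \<in> test_functions D"
  shows "(\<integral>x. \<psi> x * (grad \<phi> x \<bullet> b) \<partial>M) = - (\<integral>x. (grad \<psi> x \<bullet> b) * \<phi> x \<partial>M)"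
proof -
  note C = test_functions_C1c[OF assms(1)] test_functions_C1c[OF assms(2)]
  note m = test_borel[OF assms(1)] test_borel[OF assms(2)]
  have i: "integrable lborel (\<lambda>x. \<psi> x * (grad \<phi> x \<bullet> b))" "integrable lborel (\<lambda>x. (grad \<psi> x \<bullet> b) * \<phi> x)"
  proof -
    obtain R where R: "\<And>x. R < norm x \<Longrightarrow> \<psi> x = 0" using C1c_support[OF C(1)] by metis
    obtain R' where R': "\<And>x. R' < norm x \<Longrightarrow> grad \<psi> x = 0" using C1c_support[OF C(1)] by metis
    show "integrable lborel (\<lambda>x. \<psi> x * (grad \<phi> x \<bullet> b))"
      by (rule integrable_continuous_support[of _ R])
        (auto intro!: continuous_intros C1c_continuous[OF C(1)] C1c_continuous[OF C(2)] simp: R)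
    show "integrable lborel (\<lambda>x. (grad \<psi> x \<bullet> b) * \<phi> x)"
      by (rule integrable_continuous_support[of _ R'])
        (auto intro!: continuous_intros C1c_continuous[OF C(1)] C1c_continuous[OF C(2)] simp: R')
  qed
  have "0 = (\<integral>x. (\<psi> x *\<^sub>R grad \<phi> x + \<phi> x *\<^sub>R grad \<psi> x) \<bullet> b \<partial>lborel)"
    by (rule integral_C1c_gradient[OF C1c_mult[OF C], symmetric])
  also have "\<dots> = (\<integral>x. \<psi> x * (grad \<phi> x \<bullet> b) + (grad \<psi> x \<bullet> b) * \<phi> x \<partial>lborel)"
    by (simp add: inner_add_left mult.commute)
  also have "\<dots> = (\<integral>x. \<psi> x * (grad \<phi> x \<bullet> b) \<partial>lborel) + (\<integral>x. (grad \<psi> x \<bullet> b) * \<phi> x \<partial>lborel)"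
    by (rule Bochner_Integration.integral_add[OF i])
  finally have "(\<integral>x. \<psi> x * (grad \<phi> x \<bullet> b) \<partial>lborel) = - (\<integral>x. (grad \<psi> x \<bullet> b) * \<phi> x \<partial>lborel)" by simp
  moreover have "(\<integral>x. \<psi> x * (grad \<phi> x \<bullet> b) \<partial>M) = (\<integral>x. \<psi> x * (grad \<phi> x \<bullet> b) \<partial>lborel)"
    using m test_functions_zero_outside[OF assms(1)] by (intro integral_M(1)) (auto intro!: borel_measurable_inner)
  moreover have "(\<integral>x. (grad \<psi> x \<bullet> b) * \<phi> x \<partial>M) = (\<integral>x. (grad \<psi> x \<bullet> b) * \<phi> x \<partial>lborel)"
    using m test_functions_zero_outside[OF assms(1)] by (intro integral_M(1)) (auto intro!: borel_measurable_inner)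
  ultimately show ?thesis by simp
qed

lemma test_integrable:
  assumes "\<phi> \<in> test_functions D"
  shows "integrable M \<phi>" "integrable M (grad \<phi>)"
  using sq_int_test[OF assms] by (auto intro: sq_int_integrable)

text \<open>Test functions and their gradients are bounded, so both sides of the integration by
  parts pass to L^1 limits.\<close>

lemma weak_gradient_limit:
  assumes psi: "\<And>n. \<psi> n \<in> test_functions D" and u: "integrable M u" "integrable M g"
    and lim: "(\<lambda>n. \<integral>x. \<bar>u x - \<psi> n x\<bar> \<partial>M) \<longlonglongrightarrow> 0" "(\<lambda>n. \<integral>x. norm (g x - grad (\<psi> n) x) \<partial>M) \<longlonglongrightarrow> 0"
  shows "weak_gradient D u g"
  unfolding weak_gradient_def
proof (intro ballI)
  fix \<phi> and b :: 'a assume phi: "\<phi> \<in> test_functions D" and b: "b \<in> Basis"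
  obtain B where B: "B > 0" "\<And>x. \<bar>\<phi> x\<bar> \<le> B" "\<And>x. norm (grad \<phi> x) \<le> B"
    by (rule test_bounded[OF phi]) blast
  note m = test_measurable[OF phi]
  have 1: "(\<lambda>n. \<integral>x. \<psi> n x * (grad \<phi> x \<bullet> b) \<partial>M) \<longlonglongrightarrow> (\<integral>x. u x * (grad \<phi> x \<bullet> b) \<partial>M)"
  proof (rule L1_tendsto_mult_bounded[OF _ u(1) lim(1)])
    show "\<bar>grad \<phi> x \<bullet> b\<bar> \<le> B" for x
      using order_trans[OF Basis_le_norm[OF b] B(3)] .
  qed (use test_integrable[OF psi] m in \<open>auto intro!: borel_measurable_inner\<close>)
  have lb: "(\<lambda>n. \<integral>x. \<bar>g x \<bullet> b - grad (\<psi> n) x \<bullet> b\<bar> \<partial>M) \<longlonglongrightarrow> 0"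
  proof (rule tendsto_0_squeeze[OF _ lim(2)])
    fix n
    have "(\<integral>x. \<bar>g x \<bullet> b - grad (\<psi> n) x \<bullet> b\<bar> \<partial>M) \<le> (\<integral>x. norm (g x - grad (\<psi> n) x) \<partial>M)"
      using u test_integrable[OF psi[of n]]
      by (intro integral_mono integrable_abs integrable_norm Bochner_Integration.integrable_diff integrable_inner_left)
        (auto simp: Basis_le_norm[OF b] simp flip: inner_diff_left)
    then show "\<bar>\<integral>x. \<bar>g x \<bullet> b - grad (\<psi> n) x \<bullet> b\<bar> \<partial>M\<bar> \<le> (\<integral>x. norm (g x - grad (\<psi> n) x) \<partial>M)"
      by (subst abs_of_nonneg) (auto intro!: integral_nonneg_AE)
  qed
  have 2: "(\<lambda>n. \<integral>x. (grad (\<psi> n) x \<bullet> b) * \<phi> x \<partial>M) \<longlonglongrightarrow> (\<integral>x. (g x \<bullet> b) * \<phi> x \<partial>M)"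
    by (rule L1_tendsto_mult_bounded[OF _ _ lb m(1) B(2)])
      (use test_integrable[OF psi] u in \<open>auto intro!: integrable_inner_left\<close>)
  from tendsto_minus[OF 2] 1 show "(\<integral>x. u x * (grad \<phi> x \<bullet> b) \<partial>M) = - (\<integral>x. (g x \<bullet> b) * \<phi> x \<partial>M)"
    unfolding test_integration_by_parts[OF psi phi] by (rule LIMSEQ_unique[rotated])
qed

text \<open>The sequence of test functions serves twice: it witnesses membership in the closure and
  it proves that \<open>g\<close> is the weak gradient.\<close>

lemma W1p_0_1I:
  assumes psi: "\<And>n. \<psi> n \<in> test_functions D" and u: "integrable M u" "integrable M g"
    and lim: "(\<lambda>n. \<integral>x. \<bar>u x - \<psi> n x\<bar> \<partial>M) \<longlonglongrightarrow> 0" "(\<lambda>n. \<integral>x. norm (g x - grad (\<psi> n) x) \<partial>M) \<longlonglongrightarrow> 0"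
  shows "W1p_0 1 D u g"
  unfolding W1p_0_def W1p_def Lp_on_def
proof (intro conjI allI impI)
  fix e :: real assume "e > 0"
  have "eventually (\<lambda>n. (\<integral>x. \<bar>u x - \<psi> n x\<bar> \<partial>M) + (\<integral>x. norm (g x - grad (\<psi> n) x) \<partial>M) < e) sequentially"
    using tendsto_add[OF lim] \<open>e > 0\<close> by (auto elim: order_tendstoD)
  then obtain n where "(\<integral>x. \<bar>u x - \<psi> n x\<bar> \<partial>M) + (\<integral>x. norm (g x - grad (\<psi> n) x) \<partial>M) < e"
    by (auto simp: eventually_sequentially)
  moreover have "0 \<le> (\<integral>x. \<bar>u x - \<psi> n x\<bar> \<partial>M) + (\<integral>x. norm (g x - grad (\<psi> n) x) \<partial>M)"
    by (intro add_nonneg_nonneg integral_nonneg_AE) auto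
  ultimately show "\<exists>\<phi>\<in>test_functions D. ((\<integral>x. \<bar>u x - \<phi> x\<bar> powr 1 \<partial>M) + (\<integral>x. norm (g x - grad \<phi> x) powr 1 \<partial>M)) powr (1 / 1) < e"
    using psi by (intro bexI[of _ "\<psi> n"]) auto
qed (use u weak_gradient_limit[OF assms] in auto)

lemma W1p_0_2I:
  assumes psi: "\<And>n. \<psi> n \<in> test_functions D" and u: "sq_int M u" "sq_int M g"
    and lim: "(\<lambda>n. \<integral>x. (u x - \<psi> n x)\<^sup>2 \<partial>M) \<longlonglongrightarrow> 0" "(\<lambda>n. \<integral>x. (norm (g x - grad (\<psi> n) x))\<^sup>2 \<partial>M) \<longlonglongrightarrow> 0"
  shows "W1p_0 2 D u g"
  unfolding W1p_0_def W1p_def Lp_on_def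
proof (intro conjI allI impI)
  have L1: "(\<lambda>n. \<integral>x. norm (f x - h n x) \<partial>M) \<longlonglongrightarrow> 0"
    if "sq_int M f" "\<And>n. sq_int M (h n)" "(\<lambda>n. \<integral>x. (norm (f x - h n x))\<^sup>2 \<partial>M) \<longlonglongrightarrow> 0"
    for f :: "'a \<Rightarrow> 'b::euclidean_space" and h
    using L2_tendsto_mult[of M h f "\<lambda>_. 1::real"] that sq_int_const[of "1::real"] by (simp add: norm_minus_commute)
  show "weak_gradient D u g"
    using L1[OF u(1) sq_int_test(1)[OF psi]] L1[OF u(2) sq_int_test(2)[OF psi]] lim
    by (intro weak_gradient_limit[OF psi sq_int_integrable(1)[OF u(1)] sq_int_integrable(1)[OF u(2)]]) simp_all
  fix e :: real assume e: "e > 0"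
  have "eventually (\<lambda>n. (\<integral>x. (u x - \<psi> n x)\<^sup>2 \<partial>M) + (\<integral>x. (norm (g x - grad (\<psi> n) x))\<^sup>2 \<partial>M) < e\<^sup>2) sequentially"
    using tendsto_add[OF lim] e by (auto elim: order_tendstoD)
  then obtain n where n: "(\<integral>x. (u x - \<psi> n x)\<^sup>2 \<partial>M) + (\<integral>x. (norm (g x - grad (\<psi> n) x))\<^sup>2 \<partial>M) < e\<^sup>2"
    by (auto simp: eventually_sequentially)
  moreover have "0 \<le> (\<integral>x. (u x - \<psi> n x)\<^sup>2 \<partial>M) + (\<integral>x. (norm (g x - grad (\<psi> n) x))\<^sup>2 \<partial>M)"
    by (intro add_nonneg_nonneg integral_nonneg_AE) auto
  ultimately show "\<exists>\<phi>\<in>test_functions D. ((\<integral>x. \<bar>u x - \<phi> x\<bar> powr 2 \<partial>M) + (\<integral>x. norm (g x - grad \<phi> x) powr 2 \<partial>M)) powr (1 / 2) < e"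
    using psi e by (intro bexI[of _ "\<psi> n"]) (auto simp: powr_half_sqrt real_less_lsqrt)
qed (use u in \<open>auto simp: sq_int_def\<close>)

end

text \<open>The first variation at a minimum must vanish. If \<open>a\<close> did not, take
  \<open>t\<close> of the sign opposite to \<open>a\<close>: the error \<open>e * P\<close> is at
  most \<open>\<bar>a\<bar> / 2\<close>, a small \<open>t\<close> makes \<open>t * B\<close> at most
  \<open>\<bar>a\<bar> / 4\<close>, and the linear term wins.\<close>

lemma first_order_vanishes:
  fixes a :: real
  assumes P: "P \<ge> 0" and B: "B \<ge> 0"
    and h: "\<And>e. e > 0 \<Longrightarrow> \<exists>d>0. \<forall>t. \<bar>t\<bar> \<le> d \<longrightarrow> 0 \<le> t * a + t\<^sup>2 * B + e * \<bar>t\<bar> * P"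
  shows "a = 0"
proof (rule ccontr)
  assume "a \<noteq> 0"
  define e where "e = \<bar>a\<bar> / (2 * (P + 1))"
  have e: "e > 0" "e * P \<le> \<bar>a\<bar> / 2"
    using P \<open>a \<noteq> 0\<close> by (auto simp: e_def field_simps)
  obtain d where d: "d > 0" "\<And>t. \<bar>t\<bar> \<le> d \<Longrightarrow> 0 \<le> t * a + t\<^sup>2 * B + e * \<bar>t\<bar> * P"
    using h[OF e(1)] by blast
  define t where "t = min d (\<bar>a\<bar> / (4 * (B + 1)))"
  have t: "t > 0" "t \<le> d" "t \<le> \<bar>a\<bar> / (4 * (B + 1))"
    using d(1) \<open>a \<noteq> 0\<close> B by (auto simp: t_def)
  have tB: "t * B \<le> \<bar>a\<bar> / 4"
  proof -
    have "t * (4 * (B + 1)) \<le> \<bar>a\<bar>" using t(3) B by (simp add: pos_le_divide_eq)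
    then show ?thesis using t(1) by (simp add: algebra_simps)
  qed
  have "0 \<le> (- sgn a * t) * a + (- sgn a * t)\<^sup>2 * B + e * \<bar>- sgn a * t\<bar> * P"
    using t \<open>a \<noteq> 0\<close> by (intro d(2)) (simp add: abs_mult)
  also have "\<dots> = t * (- \<bar>a\<bar> + t * B + e * P)"
    using t \<open>a \<noteq> 0\<close> by (auto simp: abs_mult sgn_if algebra_simps power2_eq_square split: if_splits)
  finally have "0 \<le> - \<bar>a\<bar> + t * B + e * P" using t(1) by (simp add: zero_le_mult_iff)
  with tB e(2) \<open>a \<noteq> 0\<close> show False by linarith
qed

text \<open>\<open>G\<close> plays the primitive of \<open>q\<close>, known only through estimates.
  Quadratic growth of \<open>G\<close> covers both the eigenvalue problem and the truncated
  nonlinearity, and the Taylor estimate is uniform in \<open>s\<close> so that the remainder can be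
  integrated.\<close>

locale energy_functional = weighted_domain +
  fixes G q :: "real \<Rightarrow> real" and L :: real
  assumes q_cont: "continuous_on UNIV q" and q_growth: "\<And>s. \<bar>q s\<bar> \<le> L * (1 + \<bar>s\<bar>)"
    and G_0: "G 0 = 0" and G_cont: "continuous_on UNIV G"
    and G_lip: "\<And>s t. \<bar>G s - G t\<bar> \<le> L * (1 + \<bar>s\<bar> + \<bar>t\<bar>) * \<bar>s - t\<bar>"
    and G_taylor: "\<And>e. e > 0 \<Longrightarrow> \<exists>d>0. \<forall>s h. \<bar>h\<bar> \<le> d \<longrightarrow> \<bar>G (s + h) - G s - h * q s\<bar> \<le> e * \<bar>h\<bar>"
begin

definition energy :: "('a \<Rightarrow> real) \<Rightarrow> real" where
  "energy \<phi> = (\<integral>x. \<rho> x * (norm (grad \<phi> x))\<^sup>2 \<partial>M) / 2 - (\<integral>x. G (\<phi> x) \<partial>M)"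

text \<open>Absorbing the root of the weight into the gradient replaces the weighted L^2 space by
  the ordinary one, whose completeness is available.\<close>

definition wgrad :: "('a \<Rightarrow> real) \<Rightarrow> 'a \<Rightarrow> 'a" where
  "wgrad \<phi> x = sqrt (\<rho> x) *\<^sub>R grad \<phi> x"

lemma L_nonneg: "L \<ge> 0"
  using q_growth[of 0] by simp

lemma sq_int_wgrad: "\<phi> \<in> test_functions D \<Longrightarrow> sq_int M (wgrad \<phi>)"
  using sq_int_test(3) unfolding wgrad_def[abs_def] .

lemma energy_wgrad: "energy \<phi> = (\<integral>x. (norm (wgrad \<phi> x))\<^sup>2 \<partial>M) / 2 - (\<integral>x. G (\<phi> x) \<partial>M)"
proof -
  have "(\<integral>x. \<rho> x * (norm (grad \<phi> x))\<^sup>2 \<partial>M) = (\<integral>x. (norm (wgrad \<phi> x))\<^sup>2 \<partial>M)"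
    using weight_pos
    by (intro Bochner_Integration.integral_cong) (auto simp: wgrad_def power_mult_distrib less_imp_le)
  then show ?thesis by (simp add: energy_def)
qed

lemma wgrad_lincomb:
  assumes "\<phi> \<in> test_functions D" "\<psi> \<in> test_functions D"
  shows "wgrad (\<lambda>x. c * \<phi> x + d * \<psi> x) x = c *\<^sub>R wgrad \<phi> x + d *\<^sub>R wgrad \<psi> x"
  by (simp add: wgrad_def test_functions_lincomb(2)[OF assms] scaleR_add_right mult.commute)

lemma comp_measurable:
  assumes "continuous_on UNIV h" "u \<in> borel_measurable M"
  shows "(\<lambda>x. h (u x) :: real) \<in> borel_measurable M"
  using measurable_compose[OF assms(2) borel_measurable_continuous_onI[OF assms(1)]] .

lemma G_integrable:
  assumes u: "sq_int M u"
  shows "integrable M (\<lambda>x. G (u x))"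
proof (rule Bochner_Integration.integrable_bound[where g = "\<lambda>x. G (u x)"])
  have "integrable M (\<lambda>x. \<bar>u x\<bar>)" "integrable M (\<lambda>x. (norm (u x))\<^sup>2)"
    using sq_int_integrable(1)[OF u] u unfolding sq_int_def by blast+
  then show "integrable M (\<lambda>x. L * (\<bar>u x\<bar> + (norm (u x))\<^sup>2))"
    by (intro integrable_mult_right Bochner_Integration.integrable_add)
  show "(\<lambda>x. G (u x)) \<in> borel_measurable M"
    using u by (intro comp_measurable[OF G_cont]) (simp add: sq_int_def)
  have "norm (G s) \<le> norm (L * (\<bar>s\<bar> + (norm s)\<^sup>2))" for s
  proof -
    have "L * (1 + \<bar>s\<bar> + \<bar>0\<bar>) * \<bar>s - 0\<bar> = L * (\<bar>s\<bar> + (norm s)\<^sup>2)"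
      by (simp add: algebra_simps power2_eq_square)
    with G_lip[of s 0] have "\<bar>G s - G 0\<bar> \<le> L * (\<bar>s\<bar> + (norm s)\<^sup>2)" by (rule ord_le_eq_trans)
    then have "\<bar>G s\<bar> \<le> L * (\<bar>s\<bar> + (norm s)\<^sup>2)" unfolding G_0 by simp
    then show ?thesis by simp
  qed
  then show "AE x in M. norm (G (u x)) \<le> norm (L * (\<bar>u x\<bar> + (norm (u x))\<^sup>2))"
    by (intro AE_I2)
qed

text \<open>In the Lipschitz estimate \<open>1 + \<bar>v\<bar> + \<bar>u\<bar> \<le> \<bar>v -
  u\<bar> + (1 + 2 * \<bar>u\<bar>)\<close>, so only \<open>u\<close> and the distance
  \<open>s\<close> of \<open>v\<close> from \<open>u\<close> enter, and Cauchy-Schwarz gives the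
  modulus \<open>L * (s^2 + s * C)\<close>.\<close>

lemma G_integral_continuous:
  assumes u: "sq_int M u" and e: "e > 0"
  obtains d where "d > 0"
    "\<And>v. sq_int M v \<Longrightarrow> (\<integral>x. (v x - u x)\<^sup>2 \<partial>M) < d \<Longrightarrow> \<bar>(\<integral>x. G (v x) \<partial>M) - (\<integral>x. G (u x) \<partial>M)\<bar> < e"
proof -
  define C where "C = sqrt (\<integral>x. (norm (1 + 2 * \<bar>u x\<bar>))\<^sup>2 \<partial>M)"
  have z: "sq_int M (\<lambda>x. 1 + 2 * \<bar>u x\<bar>)"
    using sq_int_add[OF sq_int_const[of "1::real"] sq_int_scaleR[OF sq_int_norm[OF u], of 2]] by simp
  have bd: "\<bar>(\<integral>x. G (v x) \<partial>M) - (\<integral>x. G (u x) \<partial>M)\<bar> \<le> L * (s\<^sup>2 + s * C)"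
    if v: "sq_int M v" and s: "s = sqrt (\<integral>x. (v x - u x)\<^sup>2 \<partial>M)" for v s
  proof -
    have s2: "s\<^sup>2 = (\<integral>x. (v x - u x)\<^sup>2 \<partial>M)" unfolding s
      by (simp add: integral_nonneg_AE)
    note d = sq_int_diff[OF v u]
    have i: "integrable M (\<lambda>x. L * ((v x - u x)\<^sup>2 + \<bar>v x - u x\<bar> * (1 + 2 * \<bar>u x\<bar>)))"
      using sq_int_norm_mult(1)[OF d z] d by (auto simp: sq_int_def abs_of_nonneg)
    have "(\<integral>x. G (v x) \<partial>M) - (\<integral>x. G (u x) \<partial>M) = (\<integral>x. G (v x) - G (u x) \<partial>M)"
      using G_integrable u v by simp
    then have "\<bar>(\<integral>x. G (v x) \<partial>M) - (\<integral>x. G (u x) \<partial>M)\<bar> \<le> (\<integral>x. \<bar>G (v x) - G (u x)\<bar> \<partial>M)"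
      by (simp add: integral_abs_bound)
    also have "\<dots> \<le> (\<integral>x. L * ((v x - u x)\<^sup>2 + \<bar>v x - u x\<bar> * (1 + 2 * \<bar>u x\<bar>)) \<partial>M)"
    proof (rule integral_mono[OF _ i])
      show "integrable M (\<lambda>x. \<bar>G (v x) - G (u x)\<bar>)"
        using G_integrable[OF u] G_integrable[OF v] by simp
      fix x
      have "L * (1 + \<bar>v x\<bar> + \<bar>u x\<bar>) * \<bar>v x - u x\<bar> \<le> L * (\<bar>v x - u x\<bar> + (1 + 2 * \<bar>u x\<bar>)) * \<bar>v x - u x\<bar>"
        using L_nonneg by (intro mult_right_mono mult_left_mono) auto
      also have "\<dots> = L * ((v x - u x)\<^sup>2 + \<bar>v x - u x\<bar> * (1 + 2 * \<bar>u x\<bar>))"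
        by (simp add: algebra_simps power2_eq_square flip: abs_mult)
      finally show "\<bar>G (v x) - G (u x)\<bar> \<le> L * ((v x - u x)\<^sup>2 + \<bar>v x - u x\<bar> * (1 + 2 * \<bar>u x\<bar>))"
        using G_lip[of "v x" "u x"] by linarith
    qed
    also have "\<dots> = L * (s\<^sup>2 + (\<integral>x. norm (v x - u x) * norm (1 + 2 * \<bar>u x\<bar>) \<partial>M))"
      using sq_int_norm_mult(1)[OF d z] d by (simp add: s2 sq_int_def abs_of_nonneg)
    also have "\<dots> \<le> L * (s\<^sup>2 + s * C)"
      using sq_int_norm_mult(2)[OF d z] L_nonneg unfolding s C_def by (intro mult_left_mono add_left_mono) auto
    finally show ?thesis .
  qed
  have C: "C \<ge> 0" unfolding C_def by (simp add: integral_nonneg_AE)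
  have "((\<lambda>s. L * (s\<^sup>2 + s * C)) \<longlongrightarrow> L * (0\<^sup>2 + 0 * C)) (at_right 0)"
    by (intro tendsto_intros)
  then have "eventually (\<lambda>s. L * (s\<^sup>2 + s * C) < e) (at_right 0)"
    using e by (auto elim: order_tendstoD)
  then obtain b where b: "b > 0" "\<And>s. 0 < s \<Longrightarrow> s < b \<Longrightarrow> L * (s\<^sup>2 + s * C) < e"
    by (auto simp: eventually_at_right_field)
  show ?thesis
  proof (rule that[of "b\<^sup>2"])
    fix v assume v: "sq_int M v" and l: "(\<integral>x. (v x - u x)\<^sup>2 \<partial>M) < b\<^sup>2"
    define s where "s = sqrt (\<integral>x. (v x - u x)\<^sup>2 \<partial>M)"
    have "s < b" unfolding s_def using l b(1) by (simp add: real_less_lsqrt integral_nonneg_AE)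
    moreover have "s \<ge> 0" unfolding s_def by (simp add: integral_nonneg_AE)
    ultimately have "L * (s\<^sup>2 + s * C) < e" using b(2)[of s] e by (cases "s = 0") auto
    then show "\<bar>(\<integral>x. G (v x) \<partial>M) - (\<integral>x. G (u x) \<partial>M)\<bar> < e"
      using bd[OF v s_def] by linarith
  qed (use b in auto)
qed

lemma G_integral_tendsto:
  assumes u: "\<And>n. sq_int M (w n)" "sq_int M u" and lim: "(\<lambda>n. \<integral>x. (w n x - u x)\<^sup>2 \<partial>M) \<longlonglongrightarrow> 0"
  shows "(\<lambda>n. \<integral>x. G (w n x) \<partial>M) \<longlonglongrightarrow> (\<integral>x. G (u x) \<partial>M)"
proof (rule LIMSEQ_I)
  fix e :: real assume "e > 0"
  then obtain d where d: "d > 0"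
    "\<And>v. sq_int M v \<Longrightarrow> (\<integral>x. (v x - u x)\<^sup>2 \<partial>M) < d \<Longrightarrow> \<bar>(\<integral>x. G (v x) \<partial>M) - (\<integral>x. G (u x) \<partial>M)\<bar> < e"
    by (rule G_integral_continuous[OF u(2)]) blast
  have "eventually (\<lambda>n. (\<integral>x. (w n x - u x)\<^sup>2 \<partial>M) < d) sequentially"
    using lim d(1) by (auto elim: order_tendstoD)
  then show "\<exists>N. \<forall>n\<ge>N. norm ((\<integral>x. G (w n x) \<partial>M) - (\<integral>x. G (u x) \<partial>M)) < e"
    using d(2)[OF u(1)] by (auto simp: eventually_sequentially)
qed

text \<open>The parallelogram identity makes the gradients of a minimising sequence a Cauchy sequence.\<close>

lemma wgrad_Cauchy:
  assumes psi: "\<And>n. \<psi> n \<in> test_functions D"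
    and lower: "\<And>\<phi>. \<phi> \<in> test_functions D \<Longrightarrow> m \<le> energy \<phi>"
    and lim: "(\<lambda>n. energy (\<psi> n)) \<longlonglongrightarrow> m"
    and u: "sq_int M u" and ulim: "(\<lambda>n. \<integral>x. (\<psi> n x - u x)\<^sup>2 \<partial>M) \<longlonglongrightarrow> 0" and e: "e > 0"
  shows "\<exists>N. \<forall>i\<ge>N. \<forall>j\<ge>N. (\<integral>x. (norm (wgrad (\<psi> i) x - wgrad (\<psi> j) x))\<^sup>2 \<partial>M) < e"
proof -
  \<comment> \<open>The closing estimate collects \<open>24 * c\<close>, that is
    \<open>e / 2\<close>.\<close>
  define c where "c = e / 48"
  have c: "c > 0" using e by (simp add: c_def)
  define \<gamma> where "\<gamma> = (\<integral>x. G (u x) \<partial>M)"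
  obtain d where d: "d > 0" "\<And>v. sq_int M v \<Longrightarrow> (\<integral>x. (v x - u x)\<^sup>2 \<partial>M) < d \<Longrightarrow> \<bar>(\<integral>x. G (v x) \<partial>M) - \<gamma>\<bar> < c"
    unfolding \<gamma>_def by (rule G_integral_continuous[OF u c]) blast
  have "eventually (\<lambda>n. (\<integral>x. (\<psi> n x - u x)\<^sup>2 \<partial>M) < d \<and> energy (\<psi> n) < m + c) sequentially"
    using order_tendstoD(2)[OF ulim d(1)] order_tendstoD(2)[OF lim, of "m + c"] c by (auto intro: eventually_conj)
  then obtain N where N: "\<And>n. n \<ge> N \<Longrightarrow> (\<integral>x. (\<psi> n x - u x)\<^sup>2 \<partial>M) < d" "\<And>n. n \<ge> N \<Longrightarrow> energy (\<psi> n) < m + c"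
    by (auto simp: eventually_sequentially)
  note W = sq_int_wgrad[OF psi]
  have sq: "sq_int M (\<psi> n)" for n by (rule sq_int_test(1)[OF psi])
  have "(\<integral>x. (norm (wgrad (\<psi> i) x - wgrad (\<psi> j) x))\<^sup>2 \<partial>M) < e" if ij: "i \<ge> N" "j \<ge> N" for i j
  proof -
    define \<phi> where "\<phi> x = 1 / 2 * \<psi> i x + 1 / 2 * \<psi> j x" for x
    have phi: "\<phi> \<in> test_functions D"
      unfolding \<phi>_def[abs_def] by (rule test_functions_lincomb[OF psi psi])
    have gphi: "wgrad \<phi> x = (1 / 2) *\<^sub>R wgrad (\<psi> i) x + (1 / 2) *\<^sub>R wgrad (\<psi> j) x" for x
      unfolding \<phi>_def[abs_def] by (rule wgrad_lincomb[OF psi psi])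
    have half: "energy (\<psi> n) = (\<integral>x. (norm (wgrad (\<psi> n) x))\<^sup>2 \<partial>M) / 2 - (\<integral>x. G (\<psi> n x) \<partial>M)" for n
      by (rule energy_wgrad)
    have near: "\<bar>(\<integral>x. G (\<psi> n x) \<partial>M) - \<gamma>\<bar> < c" if "n \<ge> N" for n
      using d(2)[OF sq N(1)[OF that]] .
    \<comment> \<open>By convexity of the square the midpoint is as close to \<open>u\<close> as the
      two functions are, so its potential is near \<open>\<gamma>\<close> as well.\<close>
    have "(\<integral>x. (\<phi> x - u x)\<^sup>2 \<partial>M) \<le> (\<integral>x. 1 / 2 * (\<psi> i x - u x)\<^sup>2 + 1 / 2 * (\<psi> j x - u x)\<^sup>2 \<partial>M)"
    proof (rule integral_mono)
      show "integrable M (\<lambda>x. (\<phi> x - u x)\<^sup>2)"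
        using sq_int_diff[OF sq_int_test(1)[OF phi] u] by (simp add: sq_int_def)
      show "integrable M (\<lambda>x. 1 / 2 * (\<psi> i x - u x)\<^sup>2 + 1 / 2 * (\<psi> j x - u x)\<^sup>2)"
        using sq_int_diff[OF sq[of i] u] sq_int_diff[OF sq[of j] u] by (simp add: sq_int_def)
      fix x
      have "0 \<le> (1 / 4) * ((\<psi> i x - u x) - (\<psi> j x - u x))\<^sup>2" by simp
      also have "\<dots> = 1 / 2 * (\<psi> i x - u x)\<^sup>2 + 1 / 2 * (\<psi> j x - u x)\<^sup>2 - (\<phi> x - u x)\<^sup>2"
        unfolding \<phi>_def by (simp add: power2_eq_square field_simps)
      finally show "(\<phi> x - u x)\<^sup>2 \<le> 1 / 2 * (\<psi> i x - u x)\<^sup>2 + 1 / 2 * (\<psi> j x - u x)\<^sup>2" by simp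
    qed
    also have "\<dots> = 1 / 2 * (\<integral>x. (\<psi> i x - u x)\<^sup>2 \<partial>M) + 1 / 2 * (\<integral>x. (\<psi> j x - u x)\<^sup>2 \<partial>M)"
      using sq_int_diff[OF sq[of i] u] sq_int_diff[OF sq[of j] u] by (simp add: sq_int_def)
    also have "\<dots> < d" using N(1)[OF ij(1)] N(1)[OF ij(2)] by argo
    finally have mid: "\<bar>(\<integral>x. G (\<phi> x) \<partial>M) - \<gamma>\<bar> < c"
      using d(2)[OF sq_int_test(1)[OF phi]] by blast
    have "(norm (a - b))\<^sup>2 = 2 * (norm a)\<^sup>2 + 2 * (norm b)\<^sup>2 - 4 * (norm ((1 / 2) *\<^sub>R a + (1 / 2) *\<^sub>R b))\<^sup>2" for a b :: 'a
      by (simp add: power2_norm_eq_inner inner_diff_left inner_diff_right inner_add_left inner_add_right inner_commute)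
    then have "(\<integral>x. (norm (wgrad (\<psi> i) x - wgrad (\<psi> j) x))\<^sup>2 \<partial>M)
      = (\<integral>x. 2 * (norm (wgrad (\<psi> i) x))\<^sup>2 + 2 * (norm (wgrad (\<psi> j) x))\<^sup>2 - 4 * (norm (wgrad \<phi> x))\<^sup>2 \<partial>M)"
      by (simp add: gphi)
    also have "\<dots> = 2 * (\<integral>x. (norm (wgrad (\<psi> i) x))\<^sup>2 \<partial>M) + 2 * (\<integral>x. (norm (wgrad (\<psi> j) x))\<^sup>2 \<partial>M)
         - 4 * (\<integral>x. (norm (wgrad \<phi> x))\<^sup>2 \<partial>M)"
      using W[of i] W[of j] sq_int_wgrad[OF phi] by (simp add: sq_int_def)
    also have "\<dots> = 4 * (energy (\<psi> i) + (\<integral>x. G (\<psi> i x) \<partial>M)) + 4 * (energy (\<psi> j) + (\<integral>x. G (\<psi> j x) \<partial>M))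
         - 8 * (energy \<phi> + (\<integral>x. G (\<phi> x) \<partial>M))"
      unfolding half energy_wgrad[of \<phi>] by argo
    also have "\<dots> \<le> 4 * (m + c + (\<gamma> + c)) + 4 * (m + c + (\<gamma> + c)) - 8 * (m + (\<gamma> - c))"
      using N(2)[OF ij(1)] N(2)[OF ij(2)] near[OF ij(1)] near[OF ij(2)] mid lower[OF phi] by argo
    also have "\<dots> = e / 2" by (simp add: c_def)
    also have "\<dots> < e" using e by simp
    finally show ?thesis .
  qed
  then show ?thesis by blast
qed

text \<open>\<open>energy\<close> is only used for test functions; the last conclusion gives the
  value at the limit through the weak gradient \<open>g\<close>. The Cauchy property in L^2 is a
  hypothesis because the bounds behind compactness differ between the two applications.\<close>

theorem energy_minimiser:
  assumes psi: "\<And>n. \<psi> n \<in> test_functions D"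
    and lower: "\<And>\<phi>. \<phi> \<in> test_functions D \<Longrightarrow> m \<le> energy \<phi>"
    and lim: "(\<lambda>n. energy (\<psi> n)) \<longlonglongrightarrow> m"
    and cau: "\<And>e. e > 0 \<Longrightarrow> \<exists>N. \<forall>i\<ge>N. \<forall>j\<ge>N. (\<integral>x. (\<psi> i x - \<psi> j x)\<^sup>2 \<partial>M) < e"
  obtains u g where "sq_int M u" "(\<lambda>n. \<integral>x. (\<psi> n x - u x)\<^sup>2 \<partial>M) \<longlonglongrightarrow> 0" "W1p_0 1 D u g"
    "(\<And>x. x \<in> D \<Longrightarrow> \<rho> x = 1) \<Longrightarrow> W1p_0 2 D u g"
    "\<And>\<phi>. \<phi> \<in> test_functions D \<Longrightarrow> (\<integral>x. \<rho> x * (g x \<bullet> grad \<phi> x) \<partial>M) = (\<integral>x. q (u x) * \<phi> x \<partial>M)"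
    "(\<integral>x. \<rho> x * (norm (g x))\<^sup>2 \<partial>M) / 2 - (\<integral>x. G (u x) \<partial>M) = m"
proof -
  have sq: "sq_int M (\<psi> n)" for n by (rule sq_int_test(1)[OF psi])
  have "\<exists>N. \<forall>i\<ge>N. \<forall>j\<ge>N. (\<integral>x. (norm (\<psi> i x - \<psi> j x))\<^sup>2 \<partial>M) < e" if "e > 0" for e
    using cau[OF that] by simp
  then obtain u where u: "sq_int M u" and "(\<lambda>n. \<integral>x. (norm (\<psi> n x - u x))\<^sup>2 \<partial>M) \<longlonglongrightarrow> 0"
    using L2_complete[of \<psi>, OF sq] by blast
  then have ulim: "(\<lambda>n. \<integral>x. (\<psi> n x - u x)\<^sup>2 \<partial>M) \<longlonglongrightarrow> 0" by simp
  note W = sq_int_wgrad[OF psi]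
  obtain w where w: "sq_int M w" and wlim: "(\<lambda>n. \<integral>x. (norm (wgrad (\<psi> n) x - w x))\<^sup>2 \<partial>M) \<longlonglongrightarrow> 0"
    using L2_complete[OF W wgrad_Cauchy[OF psi lower lim u ulim]] by blast
  \<comment> \<open>\<open>w\<close> is the limit of the weighted gradients, so the weight has to be
    divided out again.\<close>
  define g where "g x = (1 / sqrt (\<rho> x)) *\<^sub>R w x" for x
  have gm: "g \<in> borel_measurable M"
    using w weight_measurable unfolding g_def[abs_def] by (auto simp: sq_int_def)
  have gw: "sqrt (\<rho> x) *\<^sub>R g x = w x" if "x \<in> D" for x
    using weight_pos[OF that] by (simp add: g_def)
  note iw = sq_int_inverse_sqrt_weight
  have gi: "integrable M g"
  proof (rule Bochner_Integration.integrable_bound[OF sq_int_norm_mult(1)[OF w iw] gm])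
    show "AE x in M. norm (g x) \<le> norm (norm (w x) * norm (1 / sqrt (\<rho> x)))"
      by (intro AE_I2) (simp add: g_def abs_mult divide_inverse mult.commute)
  qed
  have ui: "integrable M u" by (rule sq_int_integrable(1)[OF u])
  \<comment> \<open>The inverse root of the weight is square integrable, which turns L^2 convergence
    of weighted gradients into L^1 convergence of gradients.\<close>
  have glim: "(\<lambda>n. \<integral>x. norm (g x - grad (\<psi> n) x) \<partial>M) \<longlonglongrightarrow> 0"
  proof -
    have "(\<integral>x. norm (g x - grad (\<psi> n) x) \<partial>M) = (\<integral>x. norm (wgrad (\<psi> n) x - w x) * norm (1 / sqrt (\<rho> x)) \<partial>M)" for n
    proof (rule Bochner_Integration.integral_cong[OF refl])
      fix x assume "x \<in> space M"
      then have x: "x \<in> D" by simp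
      have "wgrad (\<psi> n) x - w x = sqrt (\<rho> x) *\<^sub>R (grad (\<psi> n) x - g x)"
        using gw[OF x] by (simp add: wgrad_def scaleR_diff_right)
      then show "norm (g x - grad (\<psi> n) x) = norm (wgrad (\<psi> n) x - w x) * norm (1 / sqrt (\<rho> x))"
        using weight_pos[OF x] by (simp add: norm_minus_commute)
    qed
    then show ?thesis using L2_tendsto_mult[OF W w wlim iw] by simp
  qed
  have ulim1: "(\<lambda>n. \<integral>x. \<bar>u x - \<psi> n x\<bar> \<partial>M) \<longlonglongrightarrow> 0"
  proof -
    have "(\<lambda>n. \<integral>x. (norm (\<psi> n x - u x))\<^sup>2 \<partial>M) \<longlonglongrightarrow> 0" using ulim by simp
    from L2_tendsto_mult[of M \<psi> u "\<lambda>_. 1::real", OF sq u this sq_int_const] show ?thesis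
      by (simp add: abs_minus_commute)
  qed
  have W1: "W1p_0 1 D u g"
    by (rule W1p_0_1I[OF psi ui gi ulim1 glim])
  have W2: "W1p_0 2 D u g" if "\<And>x. x \<in> D \<Longrightarrow> \<rho> x = 1"
  proof (rule W1p_0_2I[OF psi u])
    have "(\<integral>x. (norm (g x - grad (\<psi> n) x))\<^sup>2 \<partial>M) = (\<integral>x. (norm (wgrad (\<psi> n) x - w x))\<^sup>2 \<partial>M)" for n
      using that by (intro Bochner_Integration.integral_cong) (auto simp: g_def wgrad_def norm_minus_commute)
    then show "(\<lambda>n. \<integral>x. (norm (g x - grad (\<psi> n) x))\<^sup>2 \<partial>M) \<longlonglongrightarrow> 0" using wlim by simp
    show "sq_int M g"
      using w gm unfolding sq_int_def
      by (subst Bochner_Integration.integrable_cong[of M M _ "\<lambda>x. (norm (w x))\<^sup>2"]) (auto simp: g_def that)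
    show "(\<lambda>n. \<integral>x. (u x - \<psi> n x)\<^sup>2 \<partial>M) \<longlonglongrightarrow> 0" using ulim by (simp add: power2_commute)
  qed
  have val0: "(\<integral>x. (norm (w x))\<^sup>2 \<partial>M) / 2 - (\<integral>x. G (u x) \<partial>M) = m"
  proof (rule LIMSEQ_unique[OF _ lim])
    show "(\<lambda>n. energy (\<psi> n)) \<longlonglongrightarrow> (\<integral>x. (norm (w x))\<^sup>2 \<partial>M) / 2 - (\<integral>x. G (u x) \<partial>M)"
      unfolding energy_wgrad
      by (intro tendsto_intros L2_tendsto_norm[OF W w wlim] G_integral_tendsto[OF sq u ulim]) simp
  qed
  have "(\<integral>x. \<rho> x * (norm (g x))\<^sup>2 \<partial>M) = (\<integral>x. (norm (w x))\<^sup>2 \<partial>M)"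
  proof (rule Bochner_Integration.integral_cong[OF refl])
    fix x assume "x \<in> space M"
    then have x: "x \<in> D" by simp
    show "\<rho> x * (norm (g x))\<^sup>2 = (norm (w x))\<^sup>2"
      using weight_pos[OF x] by (simp add: gw[OF x, symmetric] power_mult_distrib)
  qed
  with val0 have val: "(\<integral>x. \<rho> x * (norm (g x))\<^sup>2 \<partial>M) / 2 - (\<integral>x. G (u x) \<partial>M) = m" by simp
  have EL: "(\<integral>x. \<rho> x * (g x \<bullet> grad \<phi> x) \<partial>M) = (\<integral>x. q (u x) * \<phi> x \<partial>M)" if phi: "\<phi> \<in> test_functions D" for \<phi>
  proof -
    note Wp = sq_int_wgrad[OF phi]
    note sp = sq_int_test(1)[OF phi]
    obtain B where B: "B > 0" "\<And>x. \<bar>\<phi> x\<bar> \<le> B"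
      using test_bounded[OF phi] by metis
    have qi: "integrable M (\<lambda>x. q (u x) * \<phi> x)"
    proof (rule integrable_mult_bounded(1)[OF _ test_measurable(1)[OF phi] B(2)])
      show "integrable M (\<lambda>x. q (u x))"
      proof (rule Bochner_Integration.integrable_bound)
        show "integrable M (\<lambda>x. L * (1 + \<bar>u x\<bar>))" using ui by simp
        show "(\<lambda>x. q (u x)) \<in> borel_measurable M"
          using u by (intro comp_measurable[OF q_cont]) (simp add: sq_int_def)
        show "AE x in M. norm (q (u x)) \<le> norm (L * (1 + \<bar>u x\<bar>))"
          using q_growth L_nonneg by (intro AE_I2) (simp add: abs_mult)
      qed
    qed
    \<comment> \<open>Minimality is known among test functions only; it is applied to
      \<open>\<psi> n + t * \<phi>\<close> and carried over to \<open>u + t * \<phi>\<close> by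
      passing to the limit.\<close>
    have ineq: "m \<le> (\<integral>x. (norm (w x + t *\<^sub>R wgrad \<phi> x))\<^sup>2 \<partial>M) / 2 - (\<integral>x. G (u x + t * \<phi> x) \<partial>M)" for t
    proof (rule LIMSEQ_le_const)
      let ?p = "\<lambda>n x. 1 * \<psi> n x + t * \<phi> x"
      have p: "?p n \<in> test_functions D" for n by (rule test_functions_lincomb[OF psi phi])
      show "\<exists>N. \<forall>n\<ge>N. m \<le> energy (?p n)" using lower[OF p] by blast
      have "wgrad (?p n) x = wgrad (\<psi> n) x + t *\<^sub>R wgrad \<phi> x" for n x
        using wgrad_lincomb[OF psi phi, of 1 n t x] by simp
      then have eq: "energy (?p n) = (\<integral>x. (norm (wgrad (\<psi> n) x + t *\<^sub>R wgrad \<phi> x))\<^sup>2 \<partial>M) / 2 - (\<integral>x. G (\<psi> n x + t * \<phi> x) \<partial>M)" for n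
        by (simp add: energy_wgrad)
      show "(\<lambda>n. energy (?p n)) \<longlonglongrightarrow> (\<integral>x. (norm (w x + t *\<^sub>R wgrad \<phi> x))\<^sup>2 \<partial>M) / 2 - (\<integral>x. G (u x + t * \<phi> x) \<partial>M)"
        unfolding eq
      proof (intro tendsto_diff tendsto_divide tendsto_const)
        show "(\<lambda>n. \<integral>x. (norm (wgrad (\<psi> n) x + t *\<^sub>R wgrad \<phi> x))\<^sup>2 \<partial>M) \<longlonglongrightarrow> (\<integral>x. (norm (w x + t *\<^sub>R wgrad \<phi> x))\<^sup>2 \<partial>M)"
          using wlim by (intro L2_tendsto_norm sq_int_add sq_int_scaleR W w Wp) simp
        show "(\<lambda>n. \<integral>x. G (\<psi> n x + t * \<phi> x) \<partial>M) \<longlonglongrightarrow> (\<integral>x. G (u x + t * \<phi> x) \<partial>M)"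
          using ulim sq_int_add[OF sq sq_int_scaleR[OF sp]] sq_int_add[OF u sq_int_scaleR[OF sp]]
          by (intro G_integral_tendsto) simp_all
      qed simp
    qed
    define P where "P = (\<integral>x. \<bar>\<phi> x\<bar> \<partial>M)"
    define Q where "Q = (\<integral>x. (norm (wgrad \<phi> x))\<^sup>2 \<partial>M) / 2"
    have "(\<integral>x. w x \<bullet> wgrad \<phi> x \<partial>M) - (\<integral>x. q (u x) * \<phi> x \<partial>M) = 0"
    proof (rule first_order_vanishes[of P Q])
      show "P \<ge> 0" "Q \<ge> 0" by (simp_all add: P_def Q_def integral_nonneg_AE)
      fix e :: real assume "e > 0"
      then obtain d where d: "d > 0" "\<And>s h. \<bar>h\<bar> \<le> d \<Longrightarrow> \<bar>G (s + h) - G s - h * q s\<bar> \<le> e * \<bar>h\<bar>"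
        using G_taylor by blast
      \<comment> \<open>The restriction \<open>\<bar>t\<bar> \<le> d / B\<close> keeps the increment
        \<open>t * \<phi> x\<close> below \<open>d\<close> at every \<open>x\<close>, so the uniform
        Taylor estimate applies under the integral.\<close>
      have "0 \<le> t * ((\<integral>x. w x \<bullet> wgrad \<phi> x \<partial>M) - (\<integral>x. q (u x) * \<phi> x \<partial>M)) + t\<^sup>2 * Q + e * \<bar>t\<bar> * P" if t: "\<bar>t\<bar> \<le> d / B" for t
      proof -
        have small: "\<bar>t * \<phi> x\<bar> \<le> d" for x
        proof -
          have "\<bar>t\<bar> * \<bar>\<phi> x\<bar> \<le> d / B * B" using t B d by (intro mult_mono) auto
          then show ?thesis using B by (simp add: abs_mult)
        qed
        have iG: "integrable M (\<lambda>x. G (u x + t * \<phi> x))" "integrable M (\<lambda>x. G (u x))"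
          using G_integrable[OF sq_int_add[OF u sq_int_scaleR[OF sp, of t]]] G_integrable[OF u] by simp_all
        have "(\<integral>x. t * (q (u x) * \<phi> x) - e * \<bar>t\<bar> * \<bar>\<phi> x\<bar> \<partial>M) \<le> (\<integral>x. G (u x + t * \<phi> x) - G (u x) \<partial>M)"
        proof (rule integral_mono)
          show "integrable M (\<lambda>x. t * (q (u x) * \<phi> x) - e * \<bar>t\<bar> * \<bar>\<phi> x\<bar>)"
            using qi test_integrable[OF phi] by simp
          show "integrable M (\<lambda>x. G (u x + t * \<phi> x) - G (u x))" using iG by simp
          fix x
          show "t * (q (u x) * \<phi> x) - e * \<bar>t\<bar> * \<bar>\<phi> x\<bar> \<le> G (u x + t * \<phi> x) - G (u x)"
            using d(2)[OF small[of x], of "u x"] by (simp add: abs_mult algebra_simps abs_le_iff)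
        qed
        then have 1: "t * (\<integral>x. q (u x) * \<phi> x \<partial>M) - e * \<bar>t\<bar> * P \<le> (\<integral>x. G (u x + t * \<phi> x) \<partial>M) - (\<integral>x. G (u x) \<partial>M)"
          using iG qi test_integrable[OF phi] by (simp add: P_def)
        have "(norm (w x + t *\<^sub>R wgrad \<phi> x))\<^sup>2 = (norm (w x))\<^sup>2 + 2 * t * (w x \<bullet> wgrad \<phi> x) + t\<^sup>2 * (norm (wgrad \<phi> x))\<^sup>2" for x
          by (simp add: norm_add_sq power_mult_distrib)
        then have 2: "(\<integral>x. (norm (w x + t *\<^sub>R wgrad \<phi> x))\<^sup>2 \<partial>M) = (\<integral>x. (norm (w x))\<^sup>2 \<partial>M) + 2 * t * (\<integral>x. w x \<bullet> wgrad \<phi> x \<partial>M) + t\<^sup>2 * (2 * Q)"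
          using w Wp sq_int_inner(1)[OF w Wp] by (simp add: sq_int_def Q_def)
        from ineq[of t] val0 1 2 show ?thesis by (simp add: algebra_simps)
      qed
      then show "\<exists>d>0. \<forall>t. \<bar>t\<bar> \<le> d \<longrightarrow> 0 \<le> t * ((\<integral>x. w x \<bullet> wgrad \<phi> x \<partial>M) - (\<integral>x. q (u x) * \<phi> x \<partial>M)) + t\<^sup>2 * Q + e * \<bar>t\<bar> * P"
        using d B by (intro exI[of _ "d / B"]) auto
    qed
    moreover have "(\<integral>x. w x \<bullet> wgrad \<phi> x \<partial>M) = (\<integral>x. \<rho> x * (g x \<bullet> grad \<phi> x) \<partial>M)"
    proof (rule Bochner_Integration.integral_cong[OF refl])
      fix x assume "x \<in> space M"
      then have x: "x \<in> D" by simp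
      show "w x \<bullet> wgrad \<phi> x = \<rho> x * (g x \<bullet> grad \<phi> x)"
        using weight_pos[OF x] by (simp add: gw[OF x, symmetric] wgrad_def)
    qed
    ultimately show ?thesis by simp
  qed
  show ?thesis by (rule that[OF u ulim W1 W2 EL val])
qed

end

section \<open>Compactness and approximation on the domain\<close>

context weighted_domain
begin

lemma tests_L2_compact:
  assumes psi: "\<And>n. \<psi> n \<in> test_functions D"
    and K: "\<And>n. (\<integral>x. \<bar>\<psi> n x\<bar> * norm (grad (\<psi> n) x) \<partial>M) \<le> K" "\<And>n. (\<integral>x. (\<psi> n x)\<^sup>2 \<partial>M) \<le> K"
  obtains k where "strict_mono (k::nat \<Rightarrow> nat)"
    "\<And>e. e > 0 \<Longrightarrow> \<exists>N. \<forall>i\<ge>N. \<forall>j\<ge>N. (\<integral>x. (\<psi> (k i) x - \<psi> (k j) x)\<^sup>2 \<partial>M) < e"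
proof -
  note b = test_borel[OF psi] and z = test_functions_zero_outside[OF psi]
  have 1: "(\<integral>x. \<bar>\<psi> n x\<bar> * norm (grad (\<psi> n) x) \<partial>M) = (\<integral>x. \<bar>\<psi> n x\<bar> * norm (grad (\<psi> n) x) \<partial>lborel)" for n
    using b[of n] z[of _ n] by (intro integral_M(1)) auto
  have 2: "(\<integral>x. (\<psi> n x)\<^sup>2 \<partial>M) = (\<integral>x. (\<psi> n x)\<^sup>2 \<partial>lborel)" for n
    using b[of n] z[of _ n] by (intro integral_M(1)) auto
  have 3: "(\<integral>x. (\<psi> m x - \<psi> n x)\<^sup>2 \<partial>M) = (\<integral>x. (\<psi> m x - \<psi> n x)\<^sup>2 \<partial>lborel)" for m n
    using b[of n] z[of _ n] b[of m] z[of _ m] by (intro integral_M(1)) auto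
  obtain k where "strict_mono (k::nat \<Rightarrow> nat)"
    "\<And>e. e > 0 \<Longrightarrow> \<exists>N. \<forall>i\<ge>N. \<forall>j\<ge>N. (\<integral>x. (\<psi> (k i) x - \<psi> (k j) x)\<^sup>2 \<partial>lborel) < e"
    by (rule test_functions_L2_compact[of \<psi> D K, OF psi bounded_D K(1)[unfolded 1] K(2)[unfolded 2]]) blast
  then show ?thesis by (rule that[unfolded 3])
qed

lemma W1p_0_2_approx:
  assumes "W1p_0 2 D u g"
  obtains \<psi> where "sq_int M u" "sq_int M g" "\<And>n. \<psi> n \<in> test_functions D"
    "(\<lambda>n. \<integral>x. (norm (\<psi> n x - u x))\<^sup>2 \<partial>M) \<longlonglongrightarrow> 0" "(\<lambda>n. \<integral>x. (norm (grad (\<psi> n) x - g x))\<^sup>2 \<partial>M) \<longlonglongrightarrow> 0"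
proof -
  have u: "sq_int M u" "sq_int M g"
    using assms by (auto simp: W1p_0_def W1p_def Lp_on_def sq_int_def)
  have ex: "\<exists>\<phi>\<in>test_functions D. (\<integral>x. (norm (\<phi> x - u x))\<^sup>2 \<partial>M) + (\<integral>x. (norm (grad \<phi> x - g x))\<^sup>2 \<partial>M) < inverse (real (Suc n))" for n
  proof -
    \<comment> \<open>The \<open>W1p_0\<close> norm with exponent 2 is a root, so this tolerance
      bounds the sum of the squared errors by \<open>1 / (n + 1)\<close>.\<close>
    have p: "sqrt (inverse (real (Suc n))) > 0" by simp
    then obtain \<phi> where phi: "\<phi> \<in> test_functions D"
      "((\<integral>x. \<bar>u x - \<phi> x\<bar> powr 2 \<partial>M) + (\<integral>x. norm (g x - grad \<phi> x) powr 2 \<partial>M)) powr (1 / 2) < sqrt (inverse (real (Suc n)))"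
      using assms unfolding W1p_0_def by blast
    have "((\<integral>x. \<bar>u x - \<phi> x\<bar> powr 2 \<partial>M) + (\<integral>x. norm (g x - grad \<phi> x) powr 2 \<partial>M))
      = (\<integral>x. (norm (\<phi> x - u x))\<^sup>2 \<partial>M) + (\<integral>x. (norm (grad \<phi> x - g x))\<^sup>2 \<partial>M)" (is "_ = ?s")
      by (simp add: norm_minus_commute power2_commute)
    moreover have "0 \<le> ?s" by (intro add_nonneg_nonneg integral_nonneg_AE) auto
    ultimately have "sqrt ?s < sqrt (inverse (real (Suc n)))"
      using phi(2) by (simp only: powr_half_sqrt)
    then show ?thesis using phi(1) by (intro bexI[of _ \<phi>]) (simp_all only: real_sqrt_less_iff)
  qed
  have "\<exists>\<psi>. \<forall>n. \<psi> n \<in> test_functions D \<and>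
     (\<integral>x. (norm (\<psi> n x - u x))\<^sup>2 \<partial>M) + (\<integral>x. (norm (grad (\<psi> n) x - g x))\<^sup>2 \<partial>M) < inverse (real (Suc n))"
    by (intro choice allI) (use ex in blast)
  then obtain \<psi> where psi: "\<And>n. \<psi> n \<in> test_functions D"
    "\<And>n. (\<integral>x. (norm (\<psi> n x - u x))\<^sup>2 \<partial>M) + (\<integral>x. (norm (grad (\<psi> n) x - g x))\<^sup>2 \<partial>M) < inverse (real (Suc n))"
    by blast
  have nn: "0 \<le> (\<integral>x. (norm (\<psi> n x - u x))\<^sup>2 \<partial>M)" "0 \<le> (\<integral>x. (norm (grad (\<psi> n) x - g x))\<^sup>2 \<partial>M)" for n
    by (auto intro!: integral_nonneg_AE)
  show ?thesis
  proof (rule that[OF u psi(1)])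
    show "(\<lambda>n. \<integral>x. (norm (\<psi> n x - u x))\<^sup>2 \<partial>M) \<longlonglongrightarrow> 0"
      using psi(2) nn by (intro tendsto_0_squeeze[OF _ LIMSEQ_inverse_real_of_nat]) (smt (verit))
    show "(\<lambda>n. \<integral>x. (norm (grad (\<psi> n) x - g x))\<^sup>2 \<partial>M) \<longlonglongrightarrow> 0"
      using psi(2) nn by (intro tendsto_0_squeeze[OF _ LIMSEQ_inverse_real_of_nat]) (smt (verit))
  qed
qed

lemma AE_zero_iff_sq_int: "sq_int M u \<Longrightarrow> (\<integral>x. (norm (u x))\<^sup>2 \<partial>M) = 0 \<longleftrightarrow> (AE x in M. u x = 0)"
  by (subst integral_nonneg_eq_0_iff_AE) (auto simp: sq_int_def)

text \<open>Otherwise the function would vanish almost everywhere, whereas the set where it is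
  nonzero is open and nonempty, hence not negligible.\<close>

lemma integral_sq_test_pos:
  assumes "\<phi> \<in> test_functions D" "x \<in> D" "\<phi> x \<noteq> 0"
  shows "0 < (\<integral>x. (\<phi> x)\<^sup>2 \<partial>M)"
proof (rule ccontr)
  assume "\<not> 0 < (\<integral>x. (\<phi> x)\<^sup>2 \<partial>M)"
  moreover have "0 \<le> (\<integral>x. (\<phi> x)\<^sup>2 \<partial>M)" by (intro integral_nonneg_AE) auto
  ultimately have "(\<integral>x. (norm (\<phi> x))\<^sup>2 \<partial>M) = 0" by simp
  then have ae: "AE x in M. \<phi> x = 0" using AE_zero_iff_sq_int[OF sq_int_test(1)[OF assms(1)]] by simp
  define S where "S = {x. \<phi> x \<noteq> 0}"
  have cont: "continuous_on UNIV \<phi>" using C1c_continuous(1)[OF test_functions_C1c[OF assms(1)]] .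
  have oS: "open S" unfolding S_def
    using continuous_on_open_vimage[of UNIV \<phi>] cont by (auto intro!: open_Collect_neq continuous_intros)
  have SD: "S \<subseteq> D" using test_functions_zero_outside[OF assms(1)] by (auto simp: S_def)
  have "AE x in lebesgue. x \<in> D \<longrightarrow> \<phi> x = 0"
    using ae by (simp add: AE_restrict_space_iff)
  then have "AE x in lebesgue. x \<notin> S" by eventually_elim (use SD in \<open>auto simp: S_def\<close>)
  then have "AE x in lborel. x \<notin> S" by (simp add: AE_completion_iff)
  then have "emeasure lborel S = 0"
    using oS by (subst (asm) AE_iff_measurable[of S]) auto
  then have "negligible S" using oS
    by (simp add: negligible_iff_null_sets null_sets_def emeasure_completion)
  then show False using open_not_negligible[OF oS] assms(3) by (auto simp: S_def)
qed

end

text \<open>\<open>LEAST\<close> over the reals is informative only once a minimum is known to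
  exist. So the infimum \<open>\<nu>\<close> of the quotient has to be realised by an eigenfunction
  and compared with every eigenvalue. The strict inequality for \<open>c\<close> leaves room to
  return to a test function.\<close>

theorem first_eigenvalue_rayleigh:
  fixes D :: "'a::euclidean_space set"
  assumes D: "open D" "bounded D" "D \<noteq> {}" and c: "first_eigenvalue D < c"
  shows "\<exists>\<phi>\<in>test_functions D. (\<integral>x. (norm (grad \<phi> x))\<^sup>2 \<partial>lebesgue_on D) < c * (\<integral>x. (\<phi> x)\<^sup>2 \<partial>lebesgue_on D)"
proof -
  have fm: "finite_measure (lebesgue_on D)"
    using lmeasurable_open[OF D(2,1)] by (rule finite_measure_lebesgue_on)
  interpret weighted_domain D "\<lambda>_. 1" 1
    by unfold_locales (use D finite_measure.integrable_const[OF fm] in auto)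
  let ?N = "\<lambda>\<phi>. \<integral>x. (norm (grad \<phi> x))\<^sup>2 \<partial>M" and ?S = "\<lambda>\<phi>. \<integral>x. (\<phi> x)\<^sup>2 \<partial>M"
  define R where "R = {?N \<phi> |\<phi>. \<phi> \<in> test_functions D \<and> ?S \<phi> = 1}"
  have scale: "?S (\<lambda>x. b * \<phi> x) = b\<^sup>2 * ?S \<phi>" "?N (\<lambda>x. b * \<phi> x) = b\<^sup>2 * ?N \<phi>" if "\<phi> \<in> test_functions D" for b \<phi>
    using test_functions_scale(2)[OF that] by (simp_all add: power_mult_distrib)
  have N0: "0 \<le> ?N \<phi>" and S0: "0 \<le> ?S \<phi>" for \<phi> by (auto intro!: integral_nonneg_AE)
  have norm1: "?N \<phi> / ?S \<phi> \<in> R" if phi: "\<phi> \<in> test_functions D" and p: "?S \<phi> \<noteq> 0" for \<phi>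
  proof -
    let ?b = "1 / sqrt (?S \<phi>)"
    have b2: "?b\<^sup>2 = 1 / ?S \<phi>" using S0[of \<phi>] by (simp add: power_divide)
    show ?thesis unfolding R_def
      by (intro CollectI exI[of _ "\<lambda>x. ?b * \<phi> x"] conjI test_functions_scale(1)[OF phi])
        (use p in \<open>simp_all only: scale[OF phi] b2, simp_all\<close>)
  qed
  have "\<exists>r. r \<in> R"
  proof -
    obtain \<phi> x where "\<phi> \<in> test_functions D" "x \<in> D" "\<phi> x \<noteq> 0"
      using exists_test_function[OF D(1,3)] by blast
    then show ?thesis using norm1[of \<phi>] integral_sq_test_pos[of \<phi> x] by fastforce
  qed
  then have Rne: "R \<noteq> {}" by blast
  have Rbdd: "bdd_below R" using N0 by (auto simp: R_def intro!: bdd_belowI[of _ 0])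
  define \<nu> where "\<nu> = Inf R"
  have l0: "0 \<le> \<nu>" unfolding \<nu>_def using N0 by (intro cInf_greatest[OF Rne]) (auto simp: R_def)
  have ray: "\<nu> * ?S \<phi> \<le> ?N \<phi>" if phi: "\<phi> \<in> test_functions D" for \<phi>
  proof (cases "?S \<phi> = 0")
    case False
    have "\<nu> \<le> ?N \<phi> / ?S \<phi>" unfolding \<nu>_def by (rule cInf_lower[OF norm1[OF phi False] Rbdd])
    then show ?thesis using S0[of \<phi>] False by (simp add: pos_le_divide_eq)
  qed (use N0 in simp)
  have ex: "\<exists>\<phi>\<in>test_functions D. ?S \<phi> = 1 \<and> ?N \<phi> < \<nu> + inverse (real (Suc n))" for n
  proof -
    have "Inf R < \<nu> + inverse (real (Suc n))" by (simp add: \<nu>_def)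
    from cInf_lessD[OF Rne this] show ?thesis by (auto simp: R_def)
  qed
  have "\<exists>\<psi>. \<forall>n. \<psi> n \<in> test_functions D \<and> ?S (\<psi> n) = 1 \<and> ?N (\<psi> n) < \<nu> + inverse (real (Suc n))"
    by (intro choice allI) (use ex in blast)
  then obtain \<psi> where psi: "\<And>n. \<psi> n \<in> test_functions D" and S1: "\<And>n. ?S (\<psi> n) = 1"
    and N1: "\<And>n. ?N (\<psi> n) < \<nu> + inverse (real (Suc n))" by blast
  have i1: "inverse (real (Suc n)) \<le> 1" for n by (simp add: inverse_le_1_iff)
  obtain k where k: "strict_mono (k::nat \<Rightarrow> nat)"
    and cau: "\<And>e. e > 0 \<Longrightarrow> \<exists>N. \<forall>i\<ge>N. \<forall>j\<ge>N. (\<integral>x. (\<psi> (k i) x - \<psi> (k j) x)\<^sup>2 \<partial>M) < e"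
  proof (rule tests_L2_compact[of \<psi> "\<nu> + 1", OF psi])
    show "?S (\<psi> n) \<le> \<nu> + 1" for n using S1 l0 by simp
    show "(\<integral>x. \<bar>\<psi> n x\<bar> * norm (grad (\<psi> n) x) \<partial>M) \<le> \<nu> + 1" for n
    proof -
      have "(\<integral>x. norm (\<psi> n x) * norm (grad (\<psi> n) x) \<partial>M) \<le> sqrt (\<integral>x. (norm (\<psi> n x))\<^sup>2 \<partial>M) * sqrt (?N (\<psi> n))"
        by (rule sq_int_norm_mult(2)[OF sq_int_test(1,2)[OF psi]])
      also have "\<dots> = sqrt (?N (\<psi> n))" using S1[of n] by simp
      also have "\<dots> \<le> sqrt (\<nu> + 1)" using N1[of n] i1[of n] by (intro real_sqrt_le_mono) linarith
      also have "\<dots> \<le> \<nu> + 1" using l0 by (intro real_le_lsqrt) (auto simp: power2_eq_square algebra_simps)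
      finally show ?thesis by simp
    qed
  qed blast
  \<comment> \<open>For this choice the energy is half of
    \<open>?N \<phi> - \<nu> * ?S \<phi>\<close>: nonnegative on test functions, and tending to 0
    along the normalised minimising sequence of the quotient.\<close>
  interpret E: energy_functional D "\<lambda>_. 1" 1 "\<lambda>s. \<nu> * s\<^sup>2 / 2" "\<lambda>s. \<nu> * s" \<nu>
  proof unfold_locales
    show "\<bar>\<nu> * s\<bar> \<le> \<nu> * (1 + \<bar>s\<bar>)" for s using l0 by (simp add: abs_mult mult_left_mono)
    show "\<bar>\<nu> * s\<^sup>2 / 2 - \<nu> * t\<^sup>2 / 2\<bar> \<le> \<nu> * (1 + \<bar>s\<bar> + \<bar>t\<bar>) * \<bar>s - t\<bar>" for s t
    proof -
      have "\<nu> * s\<^sup>2 / 2 - \<nu> * t\<^sup>2 / 2 = \<nu> * ((s + t) / 2) * (s - t)" by (simp add: power2_eq_square field_simps)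
      then have "\<bar>\<nu> * s\<^sup>2 / 2 - \<nu> * t\<^sup>2 / 2\<bar> = \<bar>\<nu> * ((s + t) / 2) * (s - t)\<bar>" by (rule arg_cong)
      also have "\<dots> = \<nu> * \<bar>(s + t) / 2\<bar> * \<bar>s - t\<bar>" using l0 by (simp only: abs_mult abs_of_nonneg)
      also have "\<dots> \<le> \<nu> * (1 + \<bar>s\<bar> + \<bar>t\<bar>) * \<bar>s - t\<bar>"
        using l0 by (intro mult_right_mono mult_left_mono) auto
      finally show ?thesis .
    qed
    show "\<exists>d>0. \<forall>s h. \<bar>h\<bar> \<le> d \<longrightarrow> \<bar>\<nu> * (s + h)\<^sup>2 / 2 - \<nu> * s\<^sup>2 / 2 - h * (\<nu> * s)\<bar> \<le> e * \<bar>h\<bar>" if "e > 0" for e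
    proof (intro exI[of _ "e / (\<nu> + 1)"] conjI allI impI)
      fix s h assume h: "\<bar>h\<bar> \<le> e / (\<nu> + 1)"
      have "\<nu> * (s + h)\<^sup>2 / 2 - \<nu> * s\<^sup>2 / 2 - h * (\<nu> * s) = \<nu> / 2 * h\<^sup>2" by (simp add: power2_eq_square field_simps)
      also have "\<bar>\<dots>\<bar> = (\<nu> / 2 * \<bar>h\<bar>) * \<bar>h\<bar>" using l0 by (simp add: abs_mult power2_eq_square)
      also have "\<dots> \<le> e * \<bar>h\<bar>"
      proof (rule mult_right_mono)
        have "\<nu> / 2 * \<bar>h\<bar> \<le> (\<nu> + 1) * \<bar>h\<bar>" using l0 by (intro mult_right_mono) auto
        also have "\<dots> \<le> e" using h l0 by (simp add: pos_le_divide_eq mult.commute)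
        finally show "\<nu> / 2 * \<bar>h\<bar> \<le> e" .
      qed simp
      finally show "\<bar>\<nu> * (s + h)\<^sup>2 / 2 - \<nu> * s\<^sup>2 / 2 - h * (\<nu> * s)\<bar> \<le> e * \<bar>h\<bar>" .
    qed (use that l0 in auto)
  qed (auto intro!: continuous_intros)
  have energy: "E.energy \<phi> = (?N \<phi> - \<nu> * ?S \<phi>) / 2" for \<phi>
    by (simp add: E.energy_def diff_divide_distrib)
  have Elim: "(\<lambda>n. E.energy (\<psi> (k n))) \<longlonglongrightarrow> 0"
  proof (rule tendsto_0_squeeze[OF _ LIMSEQ_inverse_real_of_nat])
    fix n
    have "inverse (real (Suc (k n))) \<le> inverse (real (Suc n))"
      using seq_suble[OF k, of n] by (intro le_imp_inverse_le) auto
    moreover have "0 \<le> E.energy (\<psi> (k n))" using ray[OF psi[of "k n"]] by (simp add: energy)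
    moreover have "E.energy (\<psi> (k n)) \<le> inverse (real (Suc (k n)))"
    proof -
      have "0 < inverse (real (Suc (k n)))" by simp
      with N1[of "k n"] show ?thesis unfolding energy S1 mult_1_right by argo
    qed
    ultimately show "\<bar>E.energy (\<psi> (k n))\<bar> \<le> inverse (real (Suc n))" by linarith
  qed
  obtain u g where u: "sq_int M u" and ulim: "(\<lambda>n. \<integral>x. (\<psi> (k n) x - u x)\<^sup>2 \<partial>M) \<longlonglongrightarrow> 0"
    and W: "W1p_0 2 D u g"
    and EL: "\<And>\<phi>. \<phi> \<in> test_functions D \<Longrightarrow> (\<integral>x. 1 * (g x \<bullet> grad \<phi> x) \<partial>M) = (\<integral>x. \<nu> * u x * \<phi> x \<partial>M)"
  proof (rule E.energy_minimiser[of "\<lambda>n. \<psi> (k n)" 0, OF psi _ Elim cau])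
    show "0 \<le> E.energy \<phi>" if "\<phi> \<in> test_functions D" for \<phi> using ray[OF that] by (simp add: energy)
  qed blast+
  \<comment> \<open>Strong L^2 convergence preserves the normalisation, which excludes the zero
    limit.\<close>
  have "(\<lambda>n. \<integral>x. (norm (\<psi> (k n) x))\<^sup>2 \<partial>M) \<longlonglongrightarrow> (\<integral>x. (norm (u x))\<^sup>2 \<partial>M)"
    using ulim by (intro L2_tendsto_norm sq_int_test(1)[OF psi] u) simp
  then have "(\<integral>x. (norm (u x))\<^sup>2 \<partial>M) = 1"
    using S1 by (simp add: LIMSEQ_const_iff)
  then have u0: "\<not> (AE x in M. u x = 0)" using AE_zero_iff_sq_int[OF u] by simp
  have ev: "dirichlet_eigenvalue D \<nu>"
    unfolding dirichlet_eigenvalue_def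
    by (intro exI[of _ u] exI[of _ g] conjI W u0 ballI) (use EL in \<open>simp add: mult.assoc\<close>)
  have least: "\<nu> \<le> \<mu>" if ev_mu: "dirichlet_eigenvalue D \<mu>" for \<mu>
  proof -
    obtain v h where v: "W1p_0 2 D v h" "\<not> (AE x in M. v x = 0)"
      and eq: "\<And>\<phi>. \<phi> \<in> test_functions D \<Longrightarrow> (\<integral>x. h x \<bullet> grad \<phi> x \<partial>M) = \<mu> * (\<integral>x. v x * \<phi> x \<partial>M)"
      using ev_mu unfolding dirichlet_eigenvalue_def by blast
    obtain \<phi> where v2: "sq_int M v" "sq_int M h" and phi: "\<And>n. \<phi> n \<in> test_functions D"
      and l1: "(\<lambda>n. \<integral>x. (norm (\<phi> n x - v x))\<^sup>2 \<partial>M) \<longlonglongrightarrow> 0"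
      and l2: "(\<lambda>n. \<integral>x. (norm (grad (\<phi> n) x - h x))\<^sup>2 \<partial>M) \<longlonglongrightarrow> 0"
      by (rule W1p_0_2_approx[OF v(1)]) blast
    note s1 = sq_int_test(1)[OF phi] and s2 = sq_int_test(2)[OF phi]
    \<comment> \<open>Inserting \<open>\<phi> n\<close> into the equation of \<open>v\<close> and
      passing to the limit amounts to testing it with \<open>v\<close> itself.\<close>
    have h: "(\<lambda>n. \<integral>x. grad (\<phi> n) x \<bullet> h x \<partial>M) \<longlonglongrightarrow> (\<integral>x. h x \<bullet> h x \<partial>M)"
      by (rule L2_tendsto_inner[OF s2 v2(2) l2 v2(2)])
    have "(\<lambda>n. \<mu> * (\<integral>x. \<phi> n x \<bullet> v x \<partial>M)) \<longlonglongrightarrow> \<mu> * (\<integral>x. v x \<bullet> v x \<partial>M)"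
      by (intro tendsto_intros L2_tendsto_inner[OF s1 v2(1) l1 v2(1)])
    moreover have "(\<integral>x. grad (\<phi> n) x \<bullet> h x \<partial>M) = \<mu> * (\<integral>x. \<phi> n x \<bullet> v x \<partial>M)" for n
      using eq[OF phi[of n]] by (simp add: inner_commute mult.commute)
    ultimately have "(\<lambda>n. \<integral>x. grad (\<phi> n) x \<bullet> h x \<partial>M) \<longlonglongrightarrow> \<mu> * (\<integral>x. v x \<bullet> v x \<partial>M)" by simp
    from LIMSEQ_unique[OF h this] have e1: "(\<integral>x. (norm (h x))\<^sup>2 \<partial>M) = \<mu> * (\<integral>x. (norm (v x))\<^sup>2 \<partial>M)"
      by (simp only: power2_norm_eq_inner)
    have "\<nu> * (\<integral>x. (norm (v x))\<^sup>2 \<partial>M) \<le> (\<integral>x. (norm (h x))\<^sup>2 \<partial>M)"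
    proof (rule LIMSEQ_le)
      show "(\<lambda>n. \<nu> * (\<integral>x. (norm (\<phi> n x))\<^sup>2 \<partial>M)) \<longlonglongrightarrow> \<nu> * (\<integral>x. (norm (v x))\<^sup>2 \<partial>M)"
        by (intro tendsto_mult tendsto_const L2_tendsto_norm[OF s1 v2(1) l1])
      show "(\<lambda>n. ?N (\<phi> n)) \<longlonglongrightarrow> (\<integral>x. (norm (h x))\<^sup>2 \<partial>M)"
        by (rule L2_tendsto_norm[OF s2 v2(2) l2])
      show "\<exists>N. \<forall>n\<ge>N. \<nu> * (\<integral>x. (norm (\<phi> n x))\<^sup>2 \<partial>M) \<le> ?N (\<phi> n)"
        using ray[OF phi] by simp
    qed
    moreover have "(\<integral>x. (norm (v x))\<^sup>2 \<partial>M) \<noteq> 0" using v(2) AE_zero_iff_sq_int[OF v2(1)] by simp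
    moreover have "0 \<le> (\<integral>x. (norm (v x))\<^sup>2 \<partial>M)" by (intro integral_nonneg_AE) auto
    ultimately show ?thesis unfolding e1 by - (rule mult_right_le_imp_le, assumption, linarith)
  qed
  have "first_eigenvalue D = \<nu>"
    unfolding first_eigenvalue_def by (rule Least_equality[of "dirichlet_eigenvalue D" \<nu>, OF ev least])
  with c have "Inf R < c" by (simp add: \<nu>_def)
  from cInf_lessD[OF Rne this] obtain \<phi> where "\<phi> \<in> test_functions D" "?S \<phi> = 1" "?N \<phi> < c"
    by (auto simp: R_def)
  then show ?thesis by (intro bexI[of _ \<phi>]) auto
qed

section \<open>The truncated nonlinearity and smooth truncation\<close>

locale bistable =
  fixes f :: "real \<Rightarrow> real" and s0 \<gamma> :: real
  assumes f_cont: "continuous_on UNIV f" and s0_pos: "0 < s0" and f_0: "f 0 = 0" and f_s0: "f s0 = 0"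
    and f_pos: "\<And>s. 0 < s \<Longrightarrow> s < s0 \<Longrightarrow> 0 < f s"
    and f_slope: "((\<lambda>s. f s / s) \<longlongrightarrow> \<gamma>) (at_right 0)"
begin

text \<open>As \<open>f\<close> vanishes at 0 and at \<open>s0\<close>, clamping the argument
  replaces \<open>f\<close> by zero outside \<open>[0, s0]\<close> without a jump.\<close>

definition cut :: "real \<Rightarrow> real" where "cut s = f (max 0 (min s s0))"

text \<open>The odd extension, chosen so that the primitive is even and replacing a function by its
  absolute value leaves the potential unchanged.\<close>

definition nonlin :: "real \<Rightarrow> real" where "nonlin s = cut s - cut (- s)"

lemma cut_cont: "continuous_on S cut"
  unfolding cut_def[abs_def]
  by (rule continuous_on_compose2[OF f_cont]) (auto intro!: continuous_intros)

lemma nonlin_cont: "continuous_on S nonlin"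
  unfolding nonlin_def[abs_def]
  by (intro continuous_intros cut_cont continuous_on_compose2[OF cut_cont[of UNIV]]) auto

lemma cut_nonneg: "0 \<le> cut s"
proof -
  consider "s \<le> 0" | "s \<ge> s0" | "0 < s" "s < s0" by linarith
  then show ?thesis using s0_pos f_0 f_s0 f_pos[of s] by cases (auto simp: cut_def max_def min_def)
qed

lemma cut_nonpos: "s \<le> 0 \<Longrightarrow> cut s = 0"
  using s0_pos by (simp add: cut_def f_0 min_absorb1 max_absorb1)

lemma nonlin_eq: "0 \<le> s \<Longrightarrow> s \<le> s0 \<Longrightarrow> nonlin s = f s"
  using cut_nonpos[of "- s"] by (simp add: nonlin_def cut_def)

lemma nonlin_nonneg: "0 \<le> s \<Longrightarrow> 0 \<le> nonlin s"
  using cut_nonpos[of "- s"] cut_nonneg[of s] by (simp add: nonlin_def)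

lemma nonlin_ge: "s0 \<le> s \<Longrightarrow> nonlin s = 0"
  using cut_nonpos[of "- s"] s0_pos f_s0 by (simp add: nonlin_def cut_def)

text \<open>One fixed constant, since it becomes the parameter \<open>L\<close> of the energy
  functional, where it governs both growth and Lipschitz estimates.\<close>

definition bound :: real where "bound = (SOME K. 0 < K \<and> (\<forall>s. \<bar>nonlin s\<bar> \<le> K))"

lemma bound: "0 < bound" "\<bar>nonlin s\<bar> \<le> bound"
proof -
  have "bounded (f ` {0..s0})"
    by (intro compact_imp_bounded compact_continuous_image continuous_on_subset[OF f_cont]) auto
  then obtain K where K: "0 < K" "\<And>x. x \<in> {0..s0} \<Longrightarrow> \<bar>f x\<bar> \<le> K"
    unfolding bounded_pos real_norm_def by blast
  have "\<bar>cut s\<bar> \<le> K" for s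
    unfolding cut_def using s0_pos by (intro K(2)) auto
  then have "\<bar>nonlin s\<bar> \<le> K + K" for s
    unfolding nonlin_def using abs_triangle_ineq4[of "cut s" "cut (- s)"] by (meson add_mono order_trans)
  with K(1) have "\<exists>K. 0 < K \<and> (\<forall>s. \<bar>nonlin s\<bar> \<le> K)" by (intro exI[of _ "K + K"]) auto
  from someI_ex[OF this] show "0 < bound" "\<bar>nonlin s\<bar> \<le> bound" unfolding bound_def by blast+
qed

text \<open>Clamping does not increase distances, so uniform continuity of \<open>f\<close> on the
  compact interval extends to the whole line. With the mean value theorem this gives the uniform
  Taylor estimate for the primitive.\<close>

lemma nonlin_uniformly_continuous:
  assumes "e > 0"
  shows "\<exists>d>0. \<forall>s t. \<bar>s - t\<bar> \<le> d \<longrightarrow> \<bar>nonlin s - nonlin t\<bar> \<le> e"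
proof -
  have "uniformly_continuous_on {0..s0} f"
    by (intro compact_uniformly_continuous continuous_on_subset[OF f_cont]) auto
  then obtain d where d: "d > 0" "\<And>x y. x \<in> {0..s0} \<Longrightarrow> y \<in> {0..s0} \<Longrightarrow> \<bar>y - x\<bar> < d \<Longrightarrow> \<bar>f y - f x\<bar> < e / 2"
    using assms unfolding uniformly_continuous_on_def dist_real_def by (meson half_gt_zero)
  have c: "\<bar>cut s - cut t\<bar> < e / 2" if "\<bar>s - t\<bar> < d" for s t
    unfolding cut_def using that s0_pos by (intro d(2)) (auto simp: max_def min_def)
  show ?thesis
  proof (intro exI[of _ "d / 2"] conjI allI impI)
    fix s t assume "\<bar>s - t\<bar> \<le> d / 2"
    then have "\<bar>s - t\<bar> < d" "\<bar>(- s) - (- t)\<bar> < d" using d(1) by linarith+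
    from c[OF this(1)] c[OF this(2)] show "\<bar>nonlin s - nonlin t\<bar> \<le> e"
      unfolding nonlin_def by linarith
  qed (use d in auto)
qed

section \<open>The even primitive\<close>

definition cut_prim :: "real \<Rightarrow> real" where
  "cut_prim = (SOME P. \<forall>s. (P has_real_derivative cut s) (at s))"

lemma cut_prim: "(cut_prim has_real_derivative cut s) (at s)"
proof -
  have "\<exists>P. \<forall>s. - \<infinity> < ereal s \<longrightarrow> ereal s < \<infinity> \<longrightarrow> (P has_vector_derivative cut s) (at s)"
    using cut_cont[of UNIV] by (intro einterval_antiderivative) (auto simp: continuous_on_eq_continuous_at)
  then have "\<exists>P. \<forall>s. (P has_real_derivative cut s) (at s)"
    by (auto simp: has_real_derivative_iff_has_vector_derivative)
  from someI_ex[OF this] show ?thesis unfolding cut_prim_def by blast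
qed

definition prim :: "real \<Rightarrow> real" where
  "prim s = cut_prim s + cut_prim (- s) - 2 * cut_prim 0"

lemma prim_0: "prim 0 = 0" and prim_even: "prim (- s) = prim s"
  by (simp_all add: prim_def)

lemma prim_deriv: "(prim has_real_derivative nonlin s) (at s)"
  unfolding prim_def[abs_def] nonlin_def
  by (auto intro!: derivative_eq_intros cut_prim DERIV_chain2[OF cut_prim])

lemma prim_cont: "continuous_on S prim"
  using prim_deriv DERIV_isCont continuous_at_imp_continuous_on by blast

lemma prim_mvt:
  assumes "s \<noteq> t"
  obtains z where "\<bar>z - s\<bar> \<le> \<bar>t - s\<bar>" "min s t < z" "z < max s t" "prim t - prim s = (t - s) * nonlin z"
proof (cases "s < t")
  case True
  obtain z where "s < z" "z < t" "prim t - prim s = (t - s) * nonlin z"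
    using MVT2[OF True, of prim nonlin] prim_deriv by blast
  then show ?thesis using True by (intro that[of z]) auto
next
  case False
  then have "t < s" using assms by simp
  obtain z where "t < z" "z < s" "prim s - prim t = (s - t) * nonlin z"
    using MVT2[OF \<open>t < s\<close>, of prim nonlin] prim_deriv by blast
  then show ?thesis using \<open>t < s\<close> by (intro that[of z]) (auto simp: algebra_simps)
qed

lemma prim_lipschitz: "\<bar>prim s - prim t\<bar> \<le> bound * \<bar>s - t\<bar>"
proof (cases "s = t")
  case False
  then obtain z where "prim s - prim t = (s - t) * nonlin z" by (metis prim_mvt)
  then show ?thesis using mult_right_mono[OF bound(2)[of z], of "\<bar>s - t\<bar>"] by (simp add: abs_mult mult.commute)
qed simp

lemma prim_taylor:
  assumes "e > 0"
  shows "\<exists>d>0. \<forall>s h. \<bar>h\<bar> \<le> d \<longrightarrow> \<bar>prim (s + h) - prim s - h * nonlin s\<bar> \<le> e * \<bar>h\<bar>"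
proof -
  obtain d where d: "d > 0" "\<And>s t. \<bar>s - t\<bar> \<le> d \<Longrightarrow> \<bar>nonlin s - nonlin t\<bar> \<le> e"
    using nonlin_uniformly_continuous[OF assms] by blast
  have "\<bar>prim (s + h) - prim s - h * nonlin s\<bar> \<le> e * \<bar>h\<bar>" if h: "\<bar>h\<bar> \<le> d" for s h
  proof (cases "h = 0")
    case False
    then have "s \<noteq> s + h" by simp
    then obtain z where z: "\<bar>z - s\<bar> \<le> \<bar>(s + h) - s\<bar>" "prim (s + h) - prim s = (s + h - s) * nonlin z"
      by (metis prim_mvt)
    have "prim (s + h) - prim s - h * nonlin s = h * (nonlin z - nonlin s)"
      unfolding z(2) by (simp add: algebra_simps)
    then have "\<bar>prim (s + h) - prim s - h * nonlin s\<bar> = \<bar>h\<bar> * \<bar>nonlin z - nonlin s\<bar>"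
      by (simp add: abs_mult)
    also have "\<dots> \<le> \<bar>h\<bar> * e" using z(1) h by (intro mult_left_mono d(2)) auto
    finally show ?thesis by (simp add: mult.commute)
  qed simp
  with d(1) show ?thesis by blast
qed

lemma prim_mono: "0 \<le> s \<Longrightarrow> s \<le> t \<Longrightarrow> prim s \<le> prim t"
  by (rule DERIV_nonneg_imp_nondecreasing[of s t prim])
    (use prim_deriv nonlin_nonneg in \<open>meson order_trans\<close>)+

text \<open>\<open>prim\<close> is even, and constant beyond \<open>s0\<close> because
  \<open>nonlin\<close> vanishes there. Hence sharp truncation does not alter the potential.\<close>

lemma prim_trunc: "prim (min \<bar>s\<bar> s0) = prim s"
proof (cases "\<bar>s\<bar> \<le> s0")
  case True
  then show ?thesis using prim_even[of s] by (simp add: abs_if)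
next
  case False
  have "prim \<bar>s\<bar> = prim s0"
  proof -
    have "s0 \<noteq> \<bar>s\<bar>" using False by simp
    then obtain z where z: "min s0 \<bar>s\<bar> < z" "prim \<bar>s\<bar> - prim s0 = (\<bar>s\<bar> - s0) * nonlin z" by (metis prim_mvt)
    then have "nonlin z = 0" using False by (intro nonlin_ge) auto
    with z show ?thesis by simp
  qed
  moreover have "prim \<bar>s\<bar> = prim s" using prim_even[of s] by (simp add: abs_if)
  ultimately show ?thesis using False by simp
qed

lemma prim_le: "prim s \<le> prim s0"
  using prim_mono[of "min \<bar>s\<bar> s0" s0] s0_pos prim_trunc[of s] by simp

text \<open>Near zero \<open>f s / s\<close> exceeds \<open>c\<close>, and integrating
  \<open>nonlin x - c * x \<ge> 0\<close> from 0 gives the bound for positive arguments; evenness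
  gives the rest. The radius stays below \<open>s0\<close>, where \<open>nonlin\<close> is still
  \<open>f\<close>.\<close>

lemma prim_quadratic:
  assumes c: "c < \<gamma>"
  shows "\<exists>d>0. \<forall>s. \<bar>s\<bar> \<le> d \<longrightarrow> c * s\<^sup>2 / 2 \<le> prim s"
proof -
  have "eventually (\<lambda>s. c < f s / s) (at_right 0)" using f_slope c by (auto elim: order_tendstoD)
  then obtain b where b: "b > 0" "\<And>s. 0 < s \<Longrightarrow> s < b \<Longrightarrow> c < f s / s"
    by (auto simp: eventually_at_right_field)
  define d where "d = min (b / 2) s0"
  have d: "d > 0" "d < b" "d \<le> s0" using b(1) s0_pos by (auto simp: d_def)
  have pos: "c * s\<^sup>2 / 2 \<le> prim s" if s: "0 \<le> s" "s \<le> d" for s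
  proof -
    let ?h = "\<lambda>s. prim s - c * s\<^sup>2 / 2"
    have "?h 0 \<le> ?h s"
    proof (rule DERIV_nonneg_imp_nondecreasing[OF s(1)])
      fix x assume x: "0 \<le> x" "x \<le> s"
      have "(?h has_real_derivative (nonlin x - c * x)) (at x)"
        by (auto intro!: derivative_eq_intros prim_deriv)
      moreover have "0 \<le> nonlin x - c * x"
      proof (cases "x = 0")
        case False
        then have "c < f x / x" using b(2)[of x] x s d by linarith
        then show ?thesis using False x s d nonlin_eq[of x] by (simp add: pos_less_divide_eq)
      qed (simp add: nonlin_nonneg)
      ultimately show "\<exists>y. (?h has_real_derivative y) (at x) \<and> 0 \<le> y" by blast
    qed
    then show ?thesis by (simp add: prim_0)
  qed
  have "c * s\<^sup>2 / 2 \<le> prim s" if "\<bar>s\<bar> \<le> d" for s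
    using pos[of "\<bar>s\<bar>"] that prim_even[of s] by (cases "s \<ge> 0") (auto simp: abs_if)
  with d(1) show ?thesis by blast
qed

text \<open>A smooth approximation of \<open>min |s| s0\<close> that vanishes at \<open>0\<close> and does not increase gradients,
  obtained from \<open>min |s| s0 = |s| - (|s - s0| + |s + s0|) / 2 + s0\<close> by replacing \<open>|s|\<close> with \<open>sqrt (s\<^sup>2 + d\<^sup>2)\<close>.\<close>

definition trunc :: "real \<Rightarrow> real \<Rightarrow> real" where
  "trunc d s = sqrt (s\<^sup>2 + d\<^sup>2) + (-1 / 2) * (sqrt ((s + (- s0))\<^sup>2 + d\<^sup>2) + sqrt ((s + s0)\<^sup>2 + d\<^sup>2))
     + (sqrt (s0\<^sup>2 + d\<^sup>2) - sqrt (d\<^sup>2))"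

definition trunc_deriv :: "real \<Rightarrow> real \<Rightarrow> real" where
  "trunc_deriv d s = s / sqrt (s\<^sup>2 + d\<^sup>2) - ((s - s0) / sqrt ((s - s0)\<^sup>2 + d\<^sup>2) + (s + s0) / sqrt ((s + s0)\<^sup>2 + d\<^sup>2)) / 2"

section \<open>Estimates for the smooth truncation\<close>

lemma sqrt_approx_abs: "d > 0 \<Longrightarrow> \<bar>s\<bar> \<le> sqrt (s\<^sup>2 + d\<^sup>2) \<and> sqrt (s\<^sup>2 + d\<^sup>2) \<le> \<bar>s\<bar> + d" for s d :: real
proof -
  assume d: "d > 0"
  have "sqrt (s\<^sup>2 + d\<^sup>2) \<le> sqrt (s\<^sup>2) + sqrt (d\<^sup>2)" by (rule sqrt_add_le_add_sqrt) auto
  moreover have "sqrt (s\<^sup>2) \<le> sqrt (s\<^sup>2 + d\<^sup>2)" by (intro real_sqrt_le_mono) auto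
  ultimately show ?thesis using d by simp
qed

text \<open>Each regularised absolute value exceeds the true one by at most \<open>d\<close>, so the
  first root errs by an amount in \<open>[0, d]\<close>, the halved pair of roots in
  \<open>[- d, 0]\<close>, and the constant, an approximation of \<open>s0\<close>, in
  \<open>[- d, 0]\<close>.\<close>

lemma trunc_approx:
  assumes d: "d > 0"
  shows "\<bar>trunc d s - min \<bar>s\<bar> s0\<bar> \<le> 2 * d"
proof -
  have m: "min \<bar>s\<bar> s0 = \<bar>s\<bar> - (\<bar>s + (- s0)\<bar> + \<bar>s + s0\<bar>) / 2 + s0"
    using s0_pos by (auto simp: min_def abs_if field_simps)
  have "sqrt (d\<^sup>2) = d" using d by simp
  then show ?thesis
    unfolding m trunc_def
    using sqrt_approx_abs[OF d, of s] sqrt_approx_abs[OF d, of "s + (- s0)"] sqrt_approx_abs[OF d, of "s + s0"]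
      sqrt_approx_abs[OF d, of s0] s0_pos abs_of_pos[OF s0_pos]
    by (intro abs_leI) argo+
qed

lemma trunc_has_derivative:
  assumes d: "d > 0"
  shows "(trunc d has_real_derivative trunc_deriv d s) (at s)"
proof -
  have *: "((\<lambda>s. sqrt ((s + c)\<^sup>2 + d\<^sup>2)) has_real_derivative (s + c) / sqrt ((s + c)\<^sup>2 + d\<^sup>2)) (at s)" for c
  proof -
    have "(s + c)\<^sup>2 + d\<^sup>2 > 0" using d by (simp add: add_nonneg_pos)
    moreover have "((\<lambda>s. (s + c)\<^sup>2 + d\<^sup>2) has_real_derivative 2 * (s + c)) (at s)"
      by (auto intro!: derivative_eq_intros)
    ultimately have "((\<lambda>s. sqrt ((s + c)\<^sup>2 + d\<^sup>2)) has_real_derivative inverse (sqrt ((s + c)\<^sup>2 + d\<^sup>2)) / 2 * (2 * (s + c))) (at s)"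
      by (intro DERIV_chain2[OF DERIV_real_sqrt])
    then show ?thesis by (simp only: divide_inverse mult.assoc mult.commute mult.left_commute) simp
  qed
  have "(trunc d has_real_derivative
      ((s + 0) / sqrt ((s + 0)\<^sup>2 + d\<^sup>2) + (-1 / 2) * ((s + (- s0)) / sqrt ((s + (- s0))\<^sup>2 + d\<^sup>2) + (s + s0) / sqrt ((s + s0)\<^sup>2 + d\<^sup>2)) + 0)) (at s)"
    unfolding trunc_def[abs_def]
    by (intro DERIV_add DERIV_cmult DERIV_const *) (use *[of 0] in simp)
  then show ?thesis by (simp add: trunc_deriv_def field_simps)
qed

text \<open>With \<open>h s = s / sqrt (s^2 + d^2)\<close> the derivative is \<open>h s\<close>
  minus the mean of \<open>h (s - s0)\<close> and \<open>h (s + s0)\<close>. For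
  \<open>s \<ge> 0\<close> both terms lie in \<open>[0, 1]\<close>: the mean is nonnegative because
  \<open>h\<close> is odd and increasing on the positive axis. Oddness handles negative
  \<open>s\<close>.\<close>

lemma trunc_deriv_le:
  assumes d: "d > 0"
  shows "\<bar>trunc_deriv d s\<bar> \<le> 1"
proof -
  define h where "h s = s / sqrt (s\<^sup>2 + d\<^sup>2)" for s
  have pos: "sqrt (s\<^sup>2 + d\<^sup>2) > 0" for s using d by (simp add: add_nonneg_pos)
  have h_le: "h s \<le> 1" for s
    unfolding h_def using pos[of s] sqrt_approx_abs[OF d, of s] by (simp add: divide_le_eq)
  have h_nonneg: "0 \<le> s \<Longrightarrow> 0 \<le> h s" for s
    unfolding h_def using pos[of s] by simp
  have h_neg: "h (- s) = - h s" for s by (simp add: h_def)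
  have h_mono: "h s \<le> h t" if "0 \<le> s" "s \<le> t" for s t
  proof -
    have "s * sqrt (t\<^sup>2 + d\<^sup>2) \<le> t * sqrt (s\<^sup>2 + d\<^sup>2)"
    proof (rule power2_le_imp_le)
      have "s\<^sup>2 * d\<^sup>2 \<le> t\<^sup>2 * d\<^sup>2" using that by (intro mult_right_mono power_mono) auto
      then show "(s * sqrt (t\<^sup>2 + d\<^sup>2))\<^sup>2 \<le> (t * sqrt (s\<^sup>2 + d\<^sup>2))\<^sup>2"
        by (simp add: power_mult_distrib algebra_simps)
    qed (use that pos[of s] in auto)
    then show ?thesis unfolding h_def using pos[of s] pos[of t] by (simp add: divide_simps mult.commute)
  qed
  have main: "\<bar>h s - (h (s - s0) + h (s + s0)) / 2\<bar> \<le> 1" if s: "0 \<le> s" for s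
  proof -
    have "h (s0 - s) \<le> h (s + s0)"
    proof (cases "s \<le> s0")
      case True then show ?thesis using s by (intro h_mono) auto
    next
      case False
      then have "h (s0 - s) \<le> 0" using h_neg[of "s - s0"] h_nonneg[of "s - s0"] by simp
      then show ?thesis using h_nonneg[of "s + s0"] s s0_pos by linarith
    qed
    then have "0 \<le> h (s - s0) + h (s + s0)" using h_neg[of "s - s0"] by simp
    then show ?thesis using h_le[of s] h_nonneg[OF s] h_le[of "s - s0"] h_le[of "s + s0"]
      unfolding abs_le_iff by argo
  qed
  have "\<bar>h s - (h (s - s0) + h (s + s0)) / 2\<bar> \<le> 1"
  proof (cases "0 \<le> s")
    case False
    have "h s - (h (s - s0) + h (s + s0)) / 2 = - (h (- s) - (h (- s - s0) + h (- s + s0)) / 2)"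
    proof -
      have "- s - s0 = - (s + s0)" "- s + s0 = - (s - s0)" by simp_all
      then show ?thesis unfolding h_neg by (simp only: h_neg) argo
    qed
    then show ?thesis using main[of "- s"] False by (simp only: abs_minus_cancel)
  qed (rule main)
  then show ?thesis by (simp add: trunc_deriv_def h_def)
qed

lemma trunc_0: "trunc d 0 = 0"
  by (simp add: trunc_def)

lemma trunc_test:
  assumes phi: "\<phi> \<in> test_functions D" and d: "d > 0"
  shows "(\<lambda>x. trunc d (\<phi> x)) \<in> test_functions D"
    "grad (\<lambda>x. trunc d (\<phi> x)) x = trunc_deriv d (\<phi> x) *\<^sub>R grad \<phi> x"
    "norm (grad (\<lambda>x. trunc d (\<phi> x)) x) \<le> norm (grad \<phi> x)"
proof -
  obtain K where K: "compact K" "K \<subseteq> D" "\<And>x. x \<notin> K \<Longrightarrow> \<phi> x = 0 \<and> grad \<phi> x = 0"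
    using test_functions_support[OF phi] by metis
  show "(\<lambda>x. trunc d (\<phi> x)) \<in> test_functions D"
  proof (rule test_functionsI[OF _ K(1,2)])
    show "C_on k UNIV (\<lambda>x. trunc d (\<phi> x))" for k
      unfolding trunc_def
      by (intro C_on_add C_on_mult C_on_const C_on_sqrt[OF d] test_functions_C_on[OF phi])
  qed (simp add: K trunc_0)
  have "((\<lambda>x. trunc d (\<phi> x)) has_derivative (\<lambda>h. (trunc_deriv d (\<phi> x) *\<^sub>R grad \<phi> x) \<bullet> h)) (at x)"
    using has_derivative_compose[OF test_functions_has_derivative[OF phi]
        trunc_has_derivative[OF d, of "\<phi> x", unfolded has_field_derivative_def]] by simp
  from grad_eqI[OF this] show g: "grad (\<lambda>x. trunc d (\<phi> x)) x = trunc_deriv d (\<phi> x) *\<^sub>R grad \<phi> x" .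
  show "norm (grad (\<lambda>x. trunc d (\<phi> x)) x) \<le> norm (grad \<phi> x)"
    unfolding g using mult_right_mono[OF trunc_deriv_le[OF d, of "\<phi> x"], of "norm (grad \<phi> x)"] by simp
qed

end

section \<open>A solution on one component\<close>

text \<open>The truncated equation is solved; since the limit takes values in
  \<open>[0, s0]\<close>, where \<open>nonlin\<close> agrees with \<open>f\<close>, it also solves
  the original one.\<close>

theorem component_solution:
  fixes D :: "'a::euclidean_space set" and a :: "'a \<Rightarrow> real"
  assumes D: "open D" "bounded D" "D \<noteq> {}"
    and a: "continuous_on (closure D) a" "\<And>x. x \<in> D \<Longrightarrow> 0 < a x" "integrable (lebesgue_on D) (\<lambda>x. 1 / a x)"
    and f: "bistable f s0 \<gamma>" "0 < \<gamma>"
    and eig: "(SUP x\<in>closure D. a x) < \<gamma> / first_eigenvalue D"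
  shows "\<exists>u. nonneg_nontrivial_weak_solution D a f u"
proof -
  interpret bistable f s0 \<gamma> by (rule f(1))
  define A where "A = (SUP x\<in>closure D. a x)"
  have "compact (a ` closure D)"
    using D(2) a(1) by (intro compact_continuous_image) auto
  then have bdd: "bdd_above (a ` closure D)" by (intro bounded_imp_bdd_above compact_imp_bounded)
  have aA: "a x \<le> A" if "x \<in> D" for x
    unfolding A_def using that closure_subset by (intro cSUP_upper bdd) auto
  interpret E: energy_functional D a A prim nonlin bound
  proof unfold_locales
    show "continuous_on D a" using a(1) closure_subset by (rule continuous_on_subset)
    show "\<bar>nonlin s\<bar> \<le> bound * (1 + \<bar>s\<bar>)" for s
    proof -
      have "bound * 1 \<le> bound * (1 + \<bar>s\<bar>)" using bound(1) by (intro mult_left_mono) auto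
      then show ?thesis using bound(2)[of s] by linarith
    qed
    show "\<bar>prim s - prim t\<bar> \<le> bound * (1 + \<bar>s\<bar> + \<bar>t\<bar>) * \<bar>s - t\<bar>" for s t
    proof -
      have "bound * 1 * \<bar>s - t\<bar> \<le> bound * (1 + \<bar>s\<bar> + \<bar>t\<bar>) * \<bar>s - t\<bar>"
        using bound(1) by (intro mult_left_mono mult_right_mono) auto
      then show ?thesis using prim_lipschitz[of s t] by simp
    qed
  qed (use D a aA prim_taylor in \<open>auto simp: nonlin_cont prim_cont prim_0\<close>)
  let ?M = "lebesgue_on D"
  define \<mu> where "\<mu> = measure ?M (space ?M)"
  have mu: "0 \<le> \<mu>" by (simp add: \<mu>_def)
  have const: "(\<integral>x. c \<partial>?M) = c * \<mu>" for c :: real by (simp add: \<mu>_def)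
  define T where "T = test_functions D"
  have Gi: "integrable ?M (\<lambda>x. prim (\<phi> x))" if "\<phi> \<in> T" for \<phi>
    using E.G_integrable[OF E.sq_int_test(1)] that by (simp add: T_def)
  have kinetic: "E.energy \<phi> + (\<integral>x. prim (\<phi> x) \<partial>?M) = (\<integral>x. (norm (E.wgrad \<phi> x))\<^sup>2 \<partial>?M) / 2" for \<phi>
    by (simp add: E.energy_wgrad)
  have Gle: "(\<integral>x. prim (\<phi> x) \<partial>?M) \<le> prim s0 * \<mu>" if "\<phi> \<in> T" for \<phi>
  proof -
    have "(\<integral>x. prim (\<phi> x) \<partial>?M) \<le> (\<integral>x. prim s0 \<partial>?M)"
      by (rule integral_mono[OF Gi[OF that]]) (auto simp: prim_le)
    then show ?thesis by (simp only: const)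
  qed
  have lower: "- (prim s0 * \<mu>) \<le> E.energy \<phi>" if "\<phi> \<in> T" for \<phi>
  proof -
    have "0 \<le> (\<integral>x. (norm (E.wgrad \<phi> x))\<^sup>2 \<partial>?M)" by (intro integral_nonneg_AE) auto
    then show ?thesis using Gle[OF that] kinetic[of \<phi>] by argo
  qed
  define m where "m = Inf (E.energy ` T)"
  have Tne: "E.energy ` T \<noteq> {}" using zero_test by (auto simp: T_def)
  have Tbdd: "bdd_below (E.energy ` T)" using lower by (intro bdd_belowI2)
  have m_le: "m \<le> E.energy \<phi>" if "\<phi> \<in> T" for \<phi>
    unfolding m_def using that by (intro cInf_lower Tbdd) auto
  have m_neg: "m < 0"
  proof -
    obtain x0 where "x0 \<in> D" using D(3) by blast
    then have A0: "0 < A" using a(2) aA by (meson less_le_trans)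
    \<comment> \<open>The quotient exceeds \<open>A > 0\<close>, which forces the first eigenvalue
      to be positive.\<close>
    have "0 < \<gamma> / first_eigenvalue D" using eig A0 unfolding A_def by linarith
    then have fe: "0 < first_eigenvalue D" using f(2) by (simp add: zero_less_divide_iff)
    \<comment> \<open>The midpoint leaves room on both sides: a test function has Rayleigh quotient
      below \<open>c / A\<close>, and \<open>prim\<close> dominates \<open>c * s^2 / 2\<close> near
      zero.\<close>
    define c where "c = (A * first_eigenvalue D + \<gamma>) / 2"
    have "A * first_eigenvalue D < \<gamma>" using eig fe unfolding A_def[symmetric] by (simp add: pos_less_divide_eq)
    then have c: "A * first_eigenvalue D < c" "c < \<gamma>" by (auto simp: c_def)
    then have "first_eigenvalue D < c / A" using A0 by (simp add: pos_less_divide_eq mult.commute)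
    then obtain \<phi> where phi: "\<phi> \<in> test_functions D"
      and ray: "(\<integral>x. (norm (grad \<phi> x))\<^sup>2 \<partial>?M) < c / A * (\<integral>x. (\<phi> x)\<^sup>2 \<partial>?M)"
      using first_eigenvalue_rayleigh[OF D] by blast
    obtain B where B: "B > 0" "\<And>x. \<bar>\<phi> x\<bar> \<le> B" using E.test_bounded[OF phi] by metis
    obtain d where d: "d > 0" "\<And>s. \<bar>s\<bar> \<le> d \<Longrightarrow> c * s\<^sup>2 / 2 \<le> prim s"
      using prim_quadratic[OF c(2)] by blast
    \<comment> \<open>Scaling keeps all values of \<open>t * \<phi>\<close> where the quadratic
      lower bound for \<open>prim\<close> holds.\<close>
    define t where "t = d / B"
    have t: "t > 0" using d B by (simp add: t_def)
    let ?p = "\<lambda>x. t * \<phi> x"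
    note p = test_functions_scale[OF phi, of t]
    have phis: "integrable ?M (\<lambda>x. (\<phi> x)\<^sup>2)" "integrable ?M (\<lambda>x. (norm (grad \<phi> x))\<^sup>2)"
      using E.sq_int_test(1,2)[OF phi] by (auto simp: sq_int_def)
    have "(\<integral>x. c * t\<^sup>2 / 2 * (\<phi> x)\<^sup>2 \<partial>?M) \<le> (\<integral>x. prim (?p x) \<partial>?M)"
    proof (rule integral_mono)
      show "integrable ?M (\<lambda>x. prim (?p x))" using p by (intro Gi) (simp add: T_def)
      show "integrable ?M (\<lambda>x. c * t\<^sup>2 / 2 * (\<phi> x)\<^sup>2)" using phis by simp
      fix x
      have "\<bar>?p x\<bar> \<le> t * B" using B(2)[of x] t by (simp add: abs_mult)
      also have "\<dots> = d" using B by (simp add: t_def)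
      finally show "c * t\<^sup>2 / 2 * (\<phi> x)\<^sup>2 \<le> prim (?p x)" using d(2)[of "?p x"] by (simp add: power_mult_distrib)
    qed
    then have 1: "c * t\<^sup>2 / 2 * (\<integral>x. (\<phi> x)\<^sup>2 \<partial>?M) \<le> (\<integral>x. prim (?p x) \<partial>?M)" by simp
    have "(\<integral>x. (norm (E.wgrad ?p x))\<^sup>2 \<partial>?M) \<le> (\<integral>x. t\<^sup>2 * A * (norm (grad \<phi> x))\<^sup>2 \<partial>?M)"
    proof (rule integral_mono)
      show "integrable ?M (\<lambda>x. (norm (E.wgrad ?p x))\<^sup>2)" using E.sq_int_wgrad[OF p(1)] by (simp add: sq_int_def)
      show "integrable ?M (\<lambda>x. t\<^sup>2 * A * (norm (grad \<phi> x))\<^sup>2)" using phis by simp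
      fix x assume "x \<in> space ?M"
      then have x: "x \<in> D" by simp
      have "(norm (E.wgrad ?p x))\<^sup>2 = a x * (t\<^sup>2 * (norm (grad \<phi> x))\<^sup>2)"
        using a(2)[OF x] by (simp add: E.wgrad_def p(2) power_mult_distrib less_imp_le)
      also have "\<dots> \<le> A * (t\<^sup>2 * (norm (grad \<phi> x))\<^sup>2)" using aA[OF x] by (intro mult_right_mono) auto
      finally show "(norm (E.wgrad ?p x))\<^sup>2 \<le> t\<^sup>2 * A * (norm (grad \<phi> x))\<^sup>2" by (simp add: mult_ac)
    qed
    also have "\<dots> = t\<^sup>2 * A * (\<integral>x. (norm (grad \<phi> x))\<^sup>2 \<partial>?M)" by simp
    also have "\<dots> < t\<^sup>2 * A * (c / A * (\<integral>x. (\<phi> x)\<^sup>2 \<partial>?M))"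
      using ray t A0 by (intro mult_strict_left_mono) auto
    also have "\<dots> = 2 * (c * t\<^sup>2 / 2 * (\<integral>x. (\<phi> x)\<^sup>2 \<partial>?M))" using A0 by simp
    finally have "E.energy ?p < 0" using 1 kinetic[of ?p] by linarith
    then show ?thesis using m_le[of ?p] p(1) by (simp add: T_def)
  qed
  have ex: "\<exists>\<phi>\<in>T. E.energy \<phi> < m + inverse (real (Suc n))" for n
  proof -
    have "Inf (E.energy ` T) < m + inverse (real (Suc n))" by (simp add: m_def)
    from cInf_lessD[OF Tne this] show ?thesis by auto
  qed
  have "\<exists>\<phi>. \<forall>n. \<phi> n \<in> T \<and> E.energy (\<phi> n) < m + inverse (real (Suc n))"
    by (intro choice allI) (use ex in blast)
  then obtain \<phi> where phi: "\<And>n. \<phi> n \<in> T" "\<And>n. E.energy (\<phi> n) < m + inverse (real (Suc n))" by blast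
  \<comment> \<open>The same null sequence measures the excess of the energy over \<open>m\<close>
    and the error of the truncation.\<close>
  define d where "d n = inverse (real (Suc n))" for n
  have d: "0 < d n" "d n \<le> 1" for n by (auto simp: d_def inverse_le_1_iff)
  have dlim: "d \<longlonglongrightarrow> 0" unfolding d_def[abs_def] by (rule LIMSEQ_inverse_real_of_nat)
  define \<psi> where "\<psi> n x = trunc (d n) (\<phi> n x)" for n x
  have phiD: "\<phi> n \<in> test_functions D" for n using phi(1) by (simp add: T_def)
  have psi: "\<psi> n \<in> test_functions D" for n
    unfolding \<psi>_def[abs_def] by (rule trunc_test(1)[OF phiD d(1)])
  have psiT: "\<psi> n \<in> T" for n using psi by (simp add: T_def)
  have range: "- 2 * d n \<le> \<psi> n x" "\<psi> n x \<le> s0 + 2 * d n" for n x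
    using trunc_approx[OF d(1)[of n], of "\<phi> n x"] s0_pos unfolding \<psi>_def by (auto simp: abs_le_iff min_def split: if_splits)
  \<comment> \<open>Truncation shrinks gradients pointwise. Compared with the sharp truncation,
    which preserves the potential, it changes \<open>prim\<close> by at most
    \<open>bound * (2 * d n)\<close>.\<close>
  have energy_psi: "E.energy (\<psi> n) \<le> m + d n + bound * (2 * d n) * \<mu>" for n
  proof -
    have "(\<integral>x. (norm (E.wgrad (\<psi> n) x))\<^sup>2 \<partial>?M) \<le> (\<integral>x. (norm (E.wgrad (\<phi> n) x))\<^sup>2 \<partial>?M)"
    proof (rule integral_mono)
      show "integrable ?M (\<lambda>x. (norm (E.wgrad (\<psi> n) x))\<^sup>2)" "integrable ?M (\<lambda>x. (norm (E.wgrad (\<phi> n) x))\<^sup>2)"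
        using E.sq_int_wgrad[OF psi] E.sq_int_wgrad[OF phiD] by (simp_all add: sq_int_def)
      fix x assume "x \<in> space ?M"
      then have "0 < a x" using a(2) by simp
      then show "(norm (E.wgrad (\<psi> n) x))\<^sup>2 \<le> (norm (E.wgrad (\<phi> n) x))\<^sup>2"
        using trunc_test(3)[OF phiD[of n] d(1)[of n], of x]
        by (intro power_mono) (auto simp: E.wgrad_def \<psi>_def[abs_def] intro!: mult_left_mono)
    qed
    moreover have "(\<integral>x. prim (\<phi> n x) - bound * (2 * d n) \<partial>?M) \<le> (\<integral>x. prim (\<psi> n x) \<partial>?M)"
    proof (rule integral_mono)
      show "integrable ?M (\<lambda>x. prim (\<phi> n x) - bound * (2 * d n))" "integrable ?M (\<lambda>x. prim (\<psi> n x))"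
        using Gi[OF phi(1)] Gi[OF psiT] by auto
      fix x
      have "\<bar>prim (\<psi> n x) - prim (min \<bar>\<phi> n x\<bar> s0)\<bar> \<le> bound * \<bar>\<psi> n x - min \<bar>\<phi> n x\<bar> s0\<bar>"
        by (rule prim_lipschitz)
      also have "\<dots> \<le> bound * (2 * d n)"
        unfolding \<psi>_def using trunc_approx[OF d(1)] bound(1) by (intro mult_left_mono) auto
      finally show "prim (\<phi> n x) - bound * (2 * d n) \<le> prim (\<psi> n x)" unfolding prim_trunc by linarith
    qed
    then have "(\<integral>x. prim (\<phi> n x) \<partial>?M) - bound * (2 * d n) * \<mu> \<le> (\<integral>x. prim (\<psi> n x) \<partial>?M)"
      using Gi[OF phi(1)] by (simp add: \<mu>_def mult_ac)
    ultimately show ?thesis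
      using phi(2)[of n] kinetic[of "\<psi> n"] kinetic[of "\<phi> n"] unfolding d_def by linarith
  qed
  have Elim: "(\<lambda>n. E.energy (\<psi> n)) \<longlonglongrightarrow> m"
  proof (rule tendsto_sandwich[of "\<lambda>_. m" _ _ "\<lambda>n. m + d n + bound * (2 * d n) * \<mu>"])
    have "(\<lambda>n. m + d n + bound * (2 * d n) * \<mu>) \<longlonglongrightarrow> m + 0 + bound * (2 * 0) * \<mu>"
      by (intro tendsto_intros dlim)
    then show "(\<lambda>n. m + d n + bound * (2 * d n) * \<mu>) \<longlonglongrightarrow> m" by simp
  qed (use m_le[OF psiT] energy_psi in auto)
  \<comment> \<open>Twice the sum of the energy bound, with \<open>d n\<close> replaced by 1, and
    the bound on the potential.\<close>
  define Q where "Q = 2 * (m + 1 + bound * 2 * \<mu> + prim s0 * \<mu>)"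
  have Q: "(\<integral>x. (norm (E.wgrad (\<psi> n) x))\<^sup>2 \<partial>?M) \<le> Q" for n
  proof -
    have "bound * (2 * d n) * \<mu> \<le> bound * 2 * \<mu>"
      using d[of n] bound(1) mu by (intro mult_right_mono mult_left_mono) auto
    then show ?thesis
      using energy_psi[of n] d(2)[of n] kinetic[of "\<psi> n"] Gle[OF psiT, of n] unfolding Q_def by argo
  qed
  define S where "S = s0 + 2"
  have S: "0 < S" "\<bar>\<psi> n x\<bar> \<le> S" for n x
    using range[of n x] d[of n] s0_pos by (auto simp: S_def)
  define P where "P = (\<integral>x. (norm (1 / sqrt (a x)))\<^sup>2 \<partial>?M)"
  \<comment> \<open>The uniform bound \<open>S\<close> removes
    \<open>\<bar>\<psi> n x\<bar>\<close>; the gradient is split into the weighted gradient and the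
    inverse root of \<open>a\<close> for Cauchy-Schwarz.\<close>
  have grad1: "(\<integral>x. \<bar>\<psi> n x\<bar> * norm (grad (\<psi> n) x) \<partial>?M) \<le> S * (sqrt Q * sqrt P)" for n
  proof -
    note ii = sq_int_norm_mult[OF E.sq_int_wgrad[OF psi[of n]] E.sq_int_inverse_sqrt_weight]
    have "(\<integral>x. \<bar>\<psi> n x\<bar> * norm (grad (\<psi> n) x) \<partial>?M) \<le> (\<integral>x. S * (norm (E.wgrad (\<psi> n) x) * norm (1 / sqrt (a x))) \<partial>?M)"
    proof (rule integral_mono)
      show "integrable ?M (\<lambda>x. \<bar>\<psi> n x\<bar> * norm (grad (\<psi> n) x))"
        using sq_int_norm_mult(1)[OF E.sq_int_test(1,2)[OF psi]] by simp
      show "integrable ?M (\<lambda>x. S * (norm (E.wgrad (\<psi> n) x) * norm (1 / sqrt (a x))))"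
        by (intro integrable_mult_right ii)
      fix x assume "x \<in> space ?M"
      then have "0 < a x" using a(2) by simp
      then have "norm (E.wgrad (\<psi> n) x) * norm (1 / sqrt (a x)) = norm (grad (\<psi> n) x)" by (simp add: E.wgrad_def)
      then show "\<bar>\<psi> n x\<bar> * norm (grad (\<psi> n) x) \<le> S * (norm (E.wgrad (\<psi> n) x) * norm (1 / sqrt (a x)))"
        using S(2)[of n x] by (simp only:) (intro mult_right_mono, auto)
    qed
    also have "\<dots> = S * (\<integral>x. norm (E.wgrad (\<psi> n) x) * norm (1 / sqrt (a x)) \<partial>?M)" by (rule integral_mult_right_zero)
    also have "\<dots> \<le> S * (sqrt (\<integral>x. (norm (E.wgrad (\<psi> n) x))\<^sup>2 \<partial>?M) * sqrt P)"
      unfolding P_def using S(1) by (intro mult_left_mono ii) auto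
    also have "\<dots> \<le> S * (sqrt Q * sqrt P)"
    proof -
      have "0 \<le> P" unfolding P_def by (intro integral_nonneg_AE) auto
      then show ?thesis using Q[of n] S(1) by (intro mult_left_mono mult_right_mono real_sqrt_le_mono) auto
    qed
    finally show ?thesis .
  qed
  have sq2: "(\<integral>x. (\<psi> n x)\<^sup>2 \<partial>?M) \<le> S\<^sup>2 * \<mu>" for n
  proof -
    have "(\<integral>x. (\<psi> n x)\<^sup>2 \<partial>?M) \<le> (\<integral>x. S\<^sup>2 \<partial>?M)"
    proof (rule integral_mono)
      show "integrable ?M (\<lambda>x. (\<psi> n x)\<^sup>2)" using E.sq_int_test(1)[OF psi] by (simp add: sq_int_def)
      show "(\<psi> n x)\<^sup>2 \<le> S\<^sup>2" for x using S(1) S(2)[of n x] by (simp add: abs_le_square_iff[symmetric])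
    qed simp
    then show ?thesis by (simp only: const)
  qed
  obtain k where k: "strict_mono (k::nat \<Rightarrow> nat)"
    and cau: "\<And>e. e > 0 \<Longrightarrow> \<exists>N. \<forall>i\<ge>N. \<forall>j\<ge>N. (\<integral>x. (\<psi> (k i) x - \<psi> (k j) x)\<^sup>2 \<partial>?M) < e"
  proof (rule E.tests_L2_compact[of \<psi> "max (S * (sqrt Q * sqrt P)) (S\<^sup>2 * \<mu>)", OF psi])
    show "(\<integral>x. \<bar>\<psi> n x\<bar> * norm (grad (\<psi> n) x) \<partial>?M) \<le> max (S * (sqrt Q * sqrt P)) (S\<^sup>2 * \<mu>)" for n
      using grad1[of n] by simp
    show "(\<integral>x. (\<psi> n x)\<^sup>2 \<partial>?M) \<le> max (S * (sqrt Q * sqrt P)) (S\<^sup>2 * \<mu>)" for n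
      using sq2[of n] by simp
  qed blast
  have Eklim: "(\<lambda>n. E.energy (\<psi> (k n))) \<longlonglongrightarrow> m"
    using LIMSEQ_subseq_LIMSEQ[OF Elim k] by (simp add: o_def)
  obtain u g where u: "sq_int ?M u" and ulim: "(\<lambda>n. \<integral>x. (\<psi> (k n) x - u x)\<^sup>2 \<partial>?M) \<longlonglongrightarrow> 0"
    and W: "W1p_0 1 D u g"
    and EL: "\<And>\<phi>. \<phi> \<in> test_functions D \<Longrightarrow> (\<integral>x. a x * (g x \<bullet> grad \<phi> x) \<partial>?M) = (\<integral>x. nonlin (u x) * \<phi> x \<partial>?M)"
    and val: "(\<integral>x. a x * (norm (g x))\<^sup>2 \<partial>?M) / 2 - (\<integral>x. prim (u x) \<partial>?M) = m"
  proof (rule E.energy_minimiser[of "\<lambda>n. \<psi> (k n)" m, OF psi _ Eklim cau])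
    show "m \<le> E.energy \<phi>" if "\<phi> \<in> test_functions D" for \<phi> using m_le that by (simp add: T_def)
  qed blast+
  have um: "u \<in> borel_measurable ?M" using u by (simp add: sq_int_def)
  \<comment> \<open>Along an almost everywhere convergent subsequence the bounds
    \<open>- 2 * d n\<close> and \<open>s0 + 2 * d n\<close> shrink to
    \<open>[0, s0]\<close>.\<close>
  have urange: "AE x in ?M. 0 \<le> u x \<and> u x \<le> s0"
  proof -
    have "(\<lambda>n. \<integral>x. (norm (\<psi> (k n) x - u x))\<^sup>2 \<partial>?M) \<longlonglongrightarrow> 0" using ulim by simp
    then obtain r where r: "strict_mono (r::nat \<Rightarrow> nat)" and ae: "AE x in ?M. (\<lambda>n. \<psi> (k (r n)) x) \<longlonglongrightarrow> u x"
      by (rule L2_AE_subseq[of ?M "\<lambda>n. \<psi> (k n)" u, OF E.sq_int_test(1)[OF psi] u]) blast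
    have dl: "(\<lambda>n. d (k (r n))) \<longlonglongrightarrow> 0"
      using LIMSEQ_subseq_LIMSEQ[OF dlim strict_mono_o[OF k r]] by (simp add: o_def)
    have l1: "(\<lambda>n. - 2 * d (k (r n))) \<longlonglongrightarrow> 0" using tendsto_mult[OF tendsto_const dl, of "-2"] by simp
    have l2: "(\<lambda>n. s0 + 2 * d (k (r n))) \<longlonglongrightarrow> s0"
      using tendsto_add[OF tendsto_const tendsto_mult[OF tendsto_const dl], of s0 2] by simp
    from ae show ?thesis
    proof eventually_elim
      case (elim x)
      show ?case using LIMSEQ_le[OF l1 elim] LIMSEQ_le[OF elim l2] range by blast
    qed
  qed
  have notin: "D - a -` {0} = D" using a(2) by force
  show ?thesis
    unfolding nonneg_nontrivial_weak_solution_def weak_solution_def notin Linf_on_def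
  proof (intro exI[of _ u] conjI exI[of _ g] exI[of _ s0] um W ballI)
    show "AE x in ?M. \<bar>u x\<bar> \<le> s0" using urange by eventually_elim auto
    show "AE x in ?M. 0 \<le> u x" using urange by eventually_elim auto
    show "(\<integral>x. a x * (g x \<bullet> grad \<phi> x) \<partial>?M) = (\<integral>x. f (u x) * \<phi> x \<partial>?M)" if "\<phi> \<in> test_functions D" for \<phi>
      unfolding EL[OF that]
    proof (rule integral_cong_AE)
      show "(\<lambda>x. nonlin (u x) * \<phi> x) \<in> borel_measurable ?M" "(\<lambda>x. f (u x) * \<phi> x) \<in> borel_measurable ?M"
        using E.comp_measurable[OF nonlin_cont um] E.comp_measurable[OF f_cont um] E.test_measurable(1)[OF that] by auto
      show "AE x in ?M. nonlin (u x) * \<phi> x = f (u x) * \<phi> x"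
        using urange by eventually_elim (simp add: nonlin_eq)
    qed
    \<comment> \<open>For \<open>u = 0\<close> the potential vanishes and the attained value would
      be nonnegative, contrary to \<open>m < 0\<close>.\<close>
    show "\<not> (AE x in ?M. u x = 0)"
    proof
      assume "AE x in ?M. u x = 0"
      then have "AE x in ?M. prim (u x) = 0" by eventually_elim (simp add: prim_0)
      then have "(\<integral>x. prim (u x) \<partial>?M) = 0" by (simp add: integral_eq_zero_AE)
      moreover have "0 \<le> (\<integral>x. a x * (norm (g x))\<^sup>2 \<partial>?M)"
        using a(2) by (intro integral_nonneg_AE AE_I2 mult_nonneg_nonneg) (auto simp: less_imp_le)
      ultimately show False using val m_neg by linarith
    qed
  qed
qed

section \<open>Finiteness of the set of components\<close>

text \<open>A connected subset lies inside every component it meets, so it meets at most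
  one.\<close>

lemma finite_components_meeting_connected:
  assumes T: "connected T" "T \<subseteq> S"
  shows "finite {C \<in> components S. C \<inter> T \<noteq> {}}"
proof (cases "T = {}")
  case False
  have "C = C'" if "C \<in> components S" "C \<inter> T \<noteq> {}" "C' \<in> components S" "C' \<inter> T \<noteq> {}" for C C'
  proof -
    have "T \<subseteq> C" "T \<subseteq> C'"
      using components_maximal[OF that(1) T(1,2)] components_maximal[OF that(3) T(1,2)] that(2,4) by (auto simp: Int_commute)
    then have "C \<inter> C' \<noteq> {}" using False by blast
    then show ?thesis using components_nonoverlap[OF that(1,3)] by blast
  qed
  then have uniq: "C = C'" if "C \<in> {C \<in> components S. C \<inter> T \<noteq> {}}" "C' \<in> {C \<in> components S. C \<inter> T \<noteq> {}}" for C C'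
    using that by simp
  show ?thesis
  proof (cases "{C \<in> components S. C \<inter> T \<noteq> {}} = {}")
    case False
    then obtain C where "C \<in> {C \<in> components S. C \<inter> T \<noteq> {}}" by blast
    then have "{C \<in> components S. C \<inter> T \<noteq> {}} \<subseteq> {C}" using uniq[of C] by blast
    then show ?thesis using finite_subset by blast
  qed (metis finite.emptyI)
qed simp

text \<open>In a slice chart a small ball minus the hyperplane consists of two convex half balls.
  Their preimages are connected, so near \<open>p\<close> at most two components occur.
  \<open>Z'\<close> stands for the other hypersurfaces.\<close>

lemma hypersurface_two_sides:
  fixes \<Omega> :: "'a::euclidean_space set"
  assumes "open \<Omega>" and M: "smooth_hypersurface M" "p \<in> M" "M \<subseteq> \<Omega>" and Z': "closed Z'" "p \<notin> Z'"
  shows "\<exists>W. open W \<and> p \<in> W \<and> W \<subseteq> \<Omega> \<and> finite {C \<in> components (\<Omega> - (M \<union> Z')). C \<inter> W \<noteq> {}}"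
proof -
  obtain U V \<Phi> \<Psi> e where e: "e \<in> Basis" and p: "p \<in> U" and diff: "diffeomorphism U V \<Phi> \<Psi>"
    and M_eq: "\<Phi> ` (U \<inter> M) = {y \<in> V. y \<bullet> e = 0}"
    using M(1,2) unfolding smooth_hypersurface_def by blast
  have U: "open U" "open V" and hom: "homeomorphism U V \<Phi> \<Psi>"
    using diff by (auto simp: diffeomorphism_def)
  have inv: "\<And>x. x \<in> U \<Longrightarrow> \<Psi> (\<Phi> x) = x" "\<And>y. y \<in> V \<Longrightarrow> \<Phi> (\<Psi> y) = y" "\<Phi> ` U = V" "\<Psi> ` V = U"
    and cont: "continuous_on U \<Phi>" "continuous_on V \<Psi>"
    using hom by (auto simp: homeomorphism_def)
  \<comment> \<open>Shrinking the chart to \<open>V'\<close> keeps the preimage of a ball inside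
    \<open>\<Omega>\<close> and away from the other hypersurfaces.\<close>
  define V' where "V' = V \<inter> \<Psi> -` (\<Omega> \<inter> - Z')"
  have "open (\<Omega> \<inter> - Z')" using assms by auto
  then have "open V'" unfolding V'_def by (rule continuous_open_preimage[OF cont(2) U(2)])
  moreover have "\<Phi> p \<in> V'" using p inv M Z' by (auto simp: V'_def)
  ultimately obtain r where r: "r > 0" "ball (\<Phi> p) r \<subseteq> V'" by (meson open_contains_ball)
  let ?B = "ball (\<Phi> p) r"
  define W where "W = U \<inter> \<Phi> -` ?B"
  have W: "open W" unfolding W_def by (rule continuous_open_preimage[OF cont(1) U(1)]) auto
  have pW: "p \<in> W" using p r by (simp add: W_def)
  have W_sub: "W \<subseteq> \<Omega> \<inter> - Z'"
  proof
    fix x assume "x \<in> W"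
    then have "x \<in> U" "\<Phi> x \<in> V'" using r by (auto simp: W_def)
    then show "x \<in> \<Omega> \<inter> - Z'" using inv(1) by (auto simp: V'_def)
  qed
  have zero: "x \<in> M \<longleftrightarrow> \<Phi> x \<bullet> e = 0" if "x \<in> U" for x
  proof
    assume "x \<in> M"
    then show "\<Phi> x \<bullet> e = 0" using that M_eq by blast
  next
    assume "\<Phi> x \<bullet> e = 0"
    then have "\<Phi> x \<in> \<Phi> ` (U \<inter> M)" using that inv(3) M_eq by auto
    then obtain y where "y \<in> U" "y \<in> M" "\<Phi> x = \<Phi> y" by auto
    then show "x \<in> M" using inv(1) that by metis
  qed
  \<comment> \<open>The two sides are \<open>H 1\<close> and \<open>H (-1)\<close>; the sign as
    parameter lets one argument treat both.\<close>
  define H where "H s = \<Psi> ` (?B \<inter> {y. 0 < s * (y \<bullet> e)})" for s :: real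
  have HV: "?B \<inter> {y. 0 < s * (y \<bullet> e)} \<subseteq> V" for s using r by (auto simp: V'_def)
  have H_conn: "connected (H s)" for s
  proof -
    have "{y. 0 < s * (y \<bullet> e)} = {y. (s *\<^sub>R e) \<bullet> y > 0}" by (auto simp: inner_commute)
    then have "convex (?B \<inter> {y. 0 < s * (y \<bullet> e)})"
      by (simp only: convex_Int convex_ball convex_halfspace_gt)
    then show ?thesis unfolding H_def
      by (intro connected_continuous_image continuous_on_subset[OF cont(2) HV] convex_connected)
  qed
  have H_mem: "x \<in> U \<and> \<Phi> x \<in> ?B \<and> 0 < s * (\<Phi> x \<bullet> e)" if "x \<in> H s" for x s
    using that inv(2,4) HV[of s] unfolding H_def by force
  have H_sub: "H s \<subseteq> \<Omega> - (M \<union> Z')" for s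
  proof
    fix x assume x: "x \<in> H s"
    from H_mem[OF x] have "x \<in> W" "x \<notin> M" using zero[of x] by (auto simp: W_def)
    then show "x \<in> \<Omega> - (M \<union> Z')" using W_sub by blast
  qed
  have cover: "W - M \<subseteq> H 1 \<union> H (-1)"
  proof
    fix x assume x: "x \<in> W - M"
    then have xU: "x \<in> U" "\<Phi> x \<in> ?B" "\<Phi> x \<bullet> e \<noteq> 0" using zero[of x] by (auto simp: W_def)
    have "x = \<Psi> (\<Phi> x)" using inv(1) xU by simp
    then show "x \<in> H 1 \<union> H (-1)"
      using xU unfolding H_def by (cases "\<Phi> x \<bullet> e > 0") (auto intro!: image_eqI[of _ \<Psi> "\<Phi> x"])
  qed
  have "{C \<in> components (\<Omega> - (M \<union> Z')). C \<inter> W \<noteq> {}} \<subseteq>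
      {C \<in> components (\<Omega> - (M \<union> Z')). C \<inter> H 1 \<noteq> {}} \<union> {C \<in> components (\<Omega> - (M \<union> Z')). C \<inter> H (-1) \<noteq> {}}"
  proof
    fix C assume C: "C \<in> {C \<in> components (\<Omega> - (M \<union> Z')). C \<inter> W \<noteq> {}}"
    then have "C \<subseteq> \<Omega> - (M \<union> Z')" using in_components_subset by blast
    with C cover show "C \<in> {C \<in> components (\<Omega> - (M \<union> Z')). C \<inter> H 1 \<noteq> {}} \<union> {C \<in> components (\<Omega> - (M \<union> Z')). C \<inter> H (-1) \<noteq> {}}"
      by blast
  qed
  then have "finite {C \<in> components (\<Omega> - (M \<union> Z')). C \<inter> W \<noteq> {}}"
    using finite_components_meeting_connected[OF H_conn H_sub] by (meson finite_UnI finite_subset)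
  with W pW W_sub show ?thesis by blast
qed

text \<open>Compactness gives finitely many neighbourhoods covering the hypersurfaces, each meeting
  finitely many components. A component that avoids them all, together with the open union of the
  others and the neighbourhoods, would disconnect \<open>\<Omega>\<close> unless it is
  \<open>\<Omega>\<close> itself.\<close>

theorem finite_components_minus_hypersurfaces:
  fixes \<Omega> :: "'a::euclidean_space set"
  assumes \<Omega>: "open \<Omega>" "connected \<Omega>" and I: "finite I"
    and G: "\<And>l. l \<in> I \<Longrightarrow> compact (\<Gamma> l)" "\<And>l. l \<in> I \<Longrightarrow> smooth_hypersurface (\<Gamma> l)" "\<And>l. l \<in> I \<Longrightarrow> \<Gamma> l \<subseteq> \<Omega>"
    and disj: "disjoint_family_on \<Gamma> I"
  shows "finite (components (\<Omega> - (\<Union>l\<in>I. \<Gamma> l)))"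
proof -
  define Z where "Z = (\<Union>l\<in>I. \<Gamma> l)"
  let ?C = "components (\<Omega> - Z)"
  have cZ: "compact Z" unfolding Z_def using I G(1) by (intro compact_UN) auto
  have local: "\<exists>W. open W \<and> p \<in> W \<and> finite {C \<in> ?C. C \<inter> W \<noteq> {}}" if p: "p \<in> Z" for p
  proof -
    obtain l where l: "l \<in> I" "p \<in> \<Gamma> l" using p by (auto simp: Z_def)
    define Z' where "Z' = (\<Union>j\<in>I - {l}. \<Gamma> j)"
    have "compact Z'" unfolding Z'_def using I G(1) by (intro compact_UN) auto
    then have "closed Z'" by (rule compact_imp_closed)
    moreover have "p \<notin> Z'" using disj l unfolding Z'_def disjoint_family_on_def by blast
    moreover have "\<Gamma> l \<union> Z' = Z" using l(1) by (auto simp: Z_def Z'_def)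
    ultimately show ?thesis
      using hypersurface_two_sides[OF \<Omega>(1) G(2)[OF l(1)] l(2) G(3)[OF l(1)], of Z'] by auto
  qed
  then have "\<forall>p\<in>Z. \<exists>W. open W \<and> p \<in> W \<and> finite {C \<in> ?C. C \<inter> W \<noteq> {}}" by blast
  from bchoice[OF this] obtain W where "\<forall>p\<in>Z. open (W p) \<and> p \<in> W p \<and> finite {C \<in> ?C. C \<inter> W p \<noteq> {}}" by blast
  then have W: "\<And>p. p \<in> Z \<Longrightarrow> open (W p)" "\<And>p. p \<in> Z \<Longrightarrow> p \<in> W p"
    "\<And>p. p \<in> Z \<Longrightarrow> finite {C \<in> ?C. C \<inter> W p \<noteq> {}}" by blast+
  obtain P where P: "P \<subseteq> Z" "finite P" "Z \<subseteq> (\<Union>p\<in>P. W p)"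
    by (rule compactE_image[OF cZ, of Z W]) (use W in auto)
  define N where "N = (\<Union>p\<in>P. W p)"
  have "open N" unfolding N_def using W(1) P(1) by (intro open_UN) blast
  with P(3) have N: "open N" "Z \<subseteq> N" by (simp_all add: N_def)
  have oC: "open C" if "C \<in> ?C" for C
    using that \<Omega>(1) compact_imp_closed[OF cZ] open_components by (metis open_Diff)
  have "?C \<subseteq> insert \<Omega> (\<Union>p\<in>P. {C \<in> ?C. C \<inter> W p \<noteq> {}})"
  proof
    fix C assume C: "C \<in> ?C"
    show "C \<in> insert \<Omega> (\<Union>p\<in>P. {C \<in> ?C. C \<inter> W p \<noteq> {}})"
    proof (cases "C \<inter> N = {}")
      case True
      define E where "E = \<Union>(?C - {C}) \<union> N"
      have "open E" unfolding E_def using oC N by (intro open_Un open_Union) auto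
      moreover have "\<Omega> \<subseteq> C \<union> E"
      proof
        fix x assume "x \<in> \<Omega>"
        then have "x \<in> Z \<or> x \<in> \<Union>?C" by (simp add: Union_components)
        then show "x \<in> C \<union> E" using N(2) unfolding E_def by blast
      qed
      moreover have "C \<inter> E \<inter> \<Omega> = {}"
        using True components_nonoverlap[OF C] unfolding E_def by blast
      ultimately have "C \<inter> \<Omega> = {} \<or> E \<inter> \<Omega> = {}"
        using connectedD[OF \<Omega>(2) oC[OF C], of E] by blast
      moreover have "C \<noteq> {}" "C \<subseteq> \<Omega>"
        using in_components_nonempty[OF C] in_components_subset[OF C] by auto
      ultimately have "C = \<Omega>" using \<open>\<Omega> \<subseteq> C \<union> E\<close> by blast
      then show ?thesis by simp
    next
      case False
      then show ?thesis using C by (auto simp: N_def)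
    qed
  qed
  moreover have "finite (insert \<Omega> (\<Union>p\<in>P. {C \<in> ?C. C \<inter> W p \<noteq> {}}))"
    using P W(3) by blast
  ultimately show ?thesis unfolding Z_def using finite_subset by blast
qed

section \<open>Gluing solutions on distinct components\<close>

text \<open>The value type is general because solutions, gradients and integrands are all glued this
  way.\<close>

definition extend_sum :: "'a set set \<Rightarrow> ('a set \<Rightarrow> 'a \<Rightarrow> 'b::comm_monoid_add) \<Rightarrow> 'a \<Rightarrow> 'b" where
  "extend_sum \<A> w x = (\<Sum>D\<in>\<A>. if x \<in> D then w D x else 0)"

lemma extend_sum_eq:
  assumes "finite \<A>" "\<And>C D. C \<in> \<A> \<Longrightarrow> D \<in> \<A> \<Longrightarrow> C \<noteq> D \<Longrightarrow> C \<inter> D = {}" "D \<in> \<A>" "x \<in> D"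
  shows "extend_sum \<A> w x = w D x"
proof -
  have "(if x \<in> C then w C x else 0) = (if C = D then w C x else 0)" if "C \<in> \<A>" for C
    using assms(2)[OF that assms(3)] assms(4) by auto
  then have "extend_sum \<A> w x = (\<Sum>C\<in>\<A>. if C = D then w C x else 0)"
    unfolding extend_sum_def by (intro sum.cong) auto
  then show ?thesis using assms by simp
qed

lemma extend_sum_outside: "x \<notin> \<Union>\<A> \<Longrightarrow> extend_sum \<A> w x = 0"
  unfolding extend_sum_def by (intro sum.neutral) auto

lemma extend_zero:
  fixes h :: "'a::euclidean_space \<Rightarrow> 'b::euclidean_space"
  assumes D: "D \<in> sets lebesgue" "S \<in> sets lebesgue" "D \<subseteq> S"
  shows "integral\<^sup>L (lebesgue_on S) (\<lambda>x. if x \<in> D then h x else 0) = integral\<^sup>L (lebesgue_on D) h"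
    "integrable (lebesgue_on D) h \<Longrightarrow> integrable (lebesgue_on S) (\<lambda>x. if x \<in> D then h x else 0)"
    "h \<in> borel_measurable (lebesgue_on D) \<Longrightarrow> (\<lambda>x. if x \<in> D then h x else 0) \<in> borel_measurable (lebesgue_on S)"
proof -
  have eq: "(\<lambda>x. if x \<in> S then if x \<in> D then h x else 0 else 0) = (\<lambda>x. if x \<in> D then h x else 0)"
    using D(3) by (auto simp: fun_eq_iff)
  show "integral\<^sup>L (lebesgue_on S) (\<lambda>x. if x \<in> D then h x else 0) = integral\<^sup>L (lebesgue_on D) h"
    unfolding Lebesgue_Measure.integral_restrict_UNIV[OF D(1), symmetric]
      Lebesgue_Measure.integral_restrict_UNIV[OF D(2), symmetric] eq ..
  show "integrable (lebesgue_on S) (\<lambda>x. if x \<in> D then h x else 0)" if "integrable (lebesgue_on D) h"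
    using that unfolding Lebesgue_Measure.integrable_restrict_UNIV[OF D(1), symmetric]
      Lebesgue_Measure.integrable_restrict_UNIV[OF D(2), symmetric] eq .
  show "(\<lambda>x. if x \<in> D then h x else 0) \<in> borel_measurable (lebesgue_on S)" if "h \<in> borel_measurable (lebesgue_on D)"
    using that D unfolding borel_measurable_if[OF D(1), symmetric]
    by (auto intro: measurable_restrict_space1)
qed

lemma integral_extend_sum:
  fixes h :: "'a::euclidean_space set \<Rightarrow> 'a \<Rightarrow> 'b::euclidean_space"
  assumes A: "finite \<A>" "\<And>D. D \<in> \<A> \<Longrightarrow> D \<in> sets lebesgue" "\<And>D. D \<in> \<A> \<Longrightarrow> D \<subseteq> S" "S \<in> sets lebesgue"
    and h: "\<And>D. D \<in> \<A> \<Longrightarrow> integrable (lebesgue_on D) (h D)"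
  shows "integrable (lebesgue_on S) (extend_sum \<A> h)"
    "integral\<^sup>L (lebesgue_on S) (extend_sum \<A> h) = (\<Sum>D\<in>\<A>. integral\<^sup>L (lebesgue_on D) (h D))"
proof -
  have i: "integrable (lebesgue_on S) (\<lambda>x. if x \<in> D then h D x else 0)" if "D \<in> \<A>" for D
    using that A h by (intro extend_zero(2)) auto
  show "integrable (lebesgue_on S) (extend_sum \<A> h)"
    unfolding extend_sum_def[abs_def] using i by auto
  have "integral\<^sup>L (lebesgue_on S) (extend_sum \<A> h) = (\<Sum>D\<in>\<A>. integral\<^sup>L (lebesgue_on S) (\<lambda>x. if x \<in> D then h D x else 0))"
    unfolding extend_sum_def[abs_def] using i by (intro Bochner_Integration.integral_sum)
  also have "\<dots> = (\<Sum>D\<in>\<A>. integral\<^sup>L (lebesgue_on D) (h D))"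
    using A by (intro sum.cong extend_zero(1)) auto
  finally show "integral\<^sup>L (lebesgue_on S) (extend_sum \<A> h) = (\<Sum>D\<in>\<A>. integral\<^sup>L (lebesgue_on D) (h D))" .
qed

lemma AE_lebesgue_on_subset:
  assumes "D \<in> sets lebesgue" "S \<in> sets lebesgue" "D \<subseteq> S" "AE x in lebesgue_on S. P x"
  shows "AE x in lebesgue_on D. P x"
proof -
  have "AE x in lebesgue. x \<in> S \<longrightarrow> P x" using assms by (simp add: AE_restrict_space_iff)
  then have "AE x in lebesgue. x \<in> D \<longrightarrow> P x" by eventually_elim (use assms in auto)
  then show ?thesis using assms by (simp add: AE_restrict_space_iff)
qed

lemma AE_all_components:
  assumes A: "finite \<A>" "\<And>D. D \<in> \<A> \<Longrightarrow> D \<in> sets lebesgue" "S \<in> sets lebesgue"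
    and P: "\<And>D. D \<in> \<A> \<Longrightarrow> AE x in lebesgue_on D. P D x"
  shows "AE x in lebesgue_on S. \<forall>D\<in>\<A>. x \<in> D \<longrightarrow> P D x"
proof (rule AE_finite_allI[OF A(1)])
  fix D assume D: "D \<in> \<A>"
  have "AE x in lebesgue. x \<in> D \<longrightarrow> P D x" using P[OF D] A(2)[OF D] by (simp add: AE_restrict_space_iff)
  then have "AE x in lebesgue. x \<in> S \<longrightarrow> x \<in> D \<longrightarrow> P D x" by eventually_elim auto
  then show "AE x in lebesgue_on S. x \<in> D \<longrightarrow> P D x" using A by (simp add: AE_restrict_space_iff)
qed

text \<open>The remaining components form an open set \<open>E\<close>, so the part of the support
  inside \<open>D\<close> is \<open>K \<inter> - E\<close>, which is compact. No cut-off function is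
  needed.\<close>

lemma test_restrict_component:
  fixes U :: "'a::euclidean_space set"
  assumes U: "open U" and D: "D \<in> components U" and phi: "\<phi> \<in> test_functions U"
  shows "(\<lambda>x. if x \<in> D then \<phi> x else 0) \<in> test_functions D"
    "x \<in> D \<Longrightarrow> grad (\<lambda>x. if x \<in> D then \<phi> x else 0) x = grad \<phi> x"
proof -
  obtain K where K: "compact K" "K \<subseteq> U" "\<And>x. x \<notin> K \<Longrightarrow> \<phi> x = 0 \<and> grad \<phi> x = 0"
    using test_functions_support[OF phi] by metis
  define E where "E = \<Union>(components U - {D})"
  have o: "open C" if "C \<in> components U" for C using open_components[OF U] that by blast
  have oD: "open D" and oE: "open E" unfolding E_def using o D by auto
  have cov: "U \<subseteq> D \<union> E"
  proof
    fix x assume "x \<in> U"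
    then have "x \<in> \<Union>(components U)" by (simp only: Union_components)
    then show "x \<in> D \<union> E" unfolding E_def by blast
  qed
  have dis: "D \<inter> E = {}" unfolding E_def using components_nonoverlap[OF D] by blast
  show "(\<lambda>x. if x \<in> D then \<phi> x else 0) \<in> test_functions D"
  proof (rule test_functionsI[of _ "K \<inter> - E"])
    show "compact (K \<inter> - E)" using K(1) oE by (intro compact_Int_closed) auto
    show "K \<inter> - E \<subseteq> D" using K cov by blast
    show "C_on k UNIV (\<lambda>x. if x \<in> D then \<phi> x else 0)" for k
      by (rule C_on_restrict_clopen[of K D E, OF compact_imp_closed[OF K(1)] _ oD oE dis test_functions_C_on[OF phi]])
        (use K cov in auto)
    show "(if x \<in> D then \<phi> x else 0) = 0" if "x \<notin> K \<inter> - E" for x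
      using that K dis by auto
  qed
  assume x: "x \<in> D"
  have "((\<lambda>x. if x \<in> D then \<phi> x else 0) has_derivative (\<lambda>h. grad \<phi> x \<bullet> h)) (at x)"
    by (rule has_derivative_transform_within_open[OF test_functions_has_derivative[OF phi] oD x]) simp
  from grad_eqI[OF this] show "grad (\<lambda>x. if x \<in> D then \<phi> x else 0) x = grad \<phi> x" .
qed

lemma extend_sum_mult: "extend_sum \<A> w x * k x = extend_sum \<A> (\<lambda>D x. w D x * (k x :: real)) x"
  unfolding extend_sum_def sum_distrib_right by (intro sum.cong) auto

lemma extend_sum_inner: "extend_sum \<A> g x \<bullet> v x = extend_sum \<A> (\<lambda>D x. g D x \<bullet> v x) x"
  unfolding extend_sum_def inner_sum_left by (intro sum.cong) auto

text \<open>Makes the facts on test functions and bounded multipliers available on any bounded open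
  set.\<close>

lemma unit_weight: "open D \<Longrightarrow> bounded D \<Longrightarrow> weighted_domain D (\<lambda>_. 1) 1"
  using finite_measure.integrable_const[OF finite_measure_lebesgue_on[OF lmeasurable_open]]
  by unfold_locales auto

text \<open>A test function on the complement of the zero set splits into its restrictions to the
  components, so the weak formulation is the sum of those on the members of \<open>\<A>\<close>. Off
  their union both sides vanish, the right one because \<open>f 0 = 0\<close>.\<close>

lemma glue_solutions:
  fixes \<Omega> :: "'a::euclidean_space set" and a :: "'a \<Rightarrow> real"
  assumes \<Omega>: "open \<Omega>" "bounded \<Omega>" and U: "open (\<Omega> - a -` {0})"
    and a: "continuous_on (closure \<Omega>) a" and f: "continuous_on UNIV f" "f 0 = 0"
    and A: "finite \<A>" "\<A> \<subseteq> components (\<Omega> - a -` {0})" "\<A> \<noteq> {}"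
    and w: "\<And>D. D \<in> \<A> \<Longrightarrow> nonneg_nontrivial_weak_solution D a f (w D)"
  shows "nonneg_nontrivial_weak_solution \<Omega> a f (extend_sum \<A> w)"
proof -
  define U where "U = \<Omega> - a -` {0}"
  have oU: "open U" using U by (simp add: U_def)
  have comp: "D \<in> components U" if "D \<in> \<A>" for D using A(2) that by (auto simp: U_def)
  have DU: "D \<subseteq> U" if "D \<in> \<A>" for D using in_components_subset[OF comp[OF that]] .
  have U\<Omega>: "U \<subseteq> \<Omega>" by (auto simp: U_def)
  have D\<Omega>: "D \<subseteq> \<Omega>" if "D \<in> \<A>" for D using DU[OF that] U\<Omega> by blast
  have oD: "open D" if "D \<in> \<A>" for D using open_components[OF oU comp[OF that]] .
  have bD: "bounded D" if "D \<in> \<A>" for D using bounded_subset[OF \<Omega>(2) D\<Omega>[OF that]] .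
  note wd = unit_weight[OF oD bD]
  have lm: "open X \<Longrightarrow> X \<in> sets lebesgue" for X :: "'a set" by auto
  have sD: "D \<in> sets lebesgue" if "D \<in> \<A>" for D by (rule lm[OF oD[OF that]])
  have sU: "U \<in> sets lebesgue" "\<Omega> \<in> sets lebesgue" using lm oU \<Omega> by auto
  have dis: "C \<inter> D = {}" if "C \<in> \<A>" "D \<in> \<A>" "C \<noteq> D" for C D
    using components_nonoverlap[OF comp comp] that by blast
  have notin: "D - a -` {0} = D" if "D \<in> \<A>" for D using DU[OF that] by (auto simp: U_def)
  have val: "extend_sum \<A> h x = h D x" if "D \<in> \<A>" "x \<in> D" for h :: "'a set \<Rightarrow> 'a \<Rightarrow> real" and D x
    by (intro extend_sum_eq A(1) dis that)
  let ?u = "extend_sum \<A> w"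
  have sol: "Linf_on D (w D)" "\<exists>g. W1p_0 1 D (w D) g \<and> (\<forall>\<phi>\<in>test_functions D.
      (\<integral>x. a x * (g x \<bullet> grad \<phi> x) \<partial>lebesgue_on D) = (\<integral>x. f (w D x) * \<phi> x \<partial>lebesgue_on D))"
    "AE x in lebesgue_on D. 0 \<le> w D x" "\<not> (AE x in lebesgue_on D. w D x = 0)" if "D \<in> \<A>" for D
    using w[OF that] notin[OF that] unfolding nonneg_nontrivial_weak_solution_def weak_solution_def by auto
  have "\<forall>D\<in>\<A>. \<exists>g. W1p_0 1 D (w D) g \<and> (\<forall>\<phi>\<in>test_functions D.
      (\<integral>x. a x * (g x \<bullet> grad \<phi> x) \<partial>lebesgue_on D) = (\<integral>x. f (w D x) * \<phi> x \<partial>lebesgue_on D))"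
    using sol(2) by blast
  from bchoice[OF this] obtain g where g0: "\<forall>D\<in>\<A>. W1p_0 1 D (w D) (g D) \<and> (\<forall>\<phi>\<in>test_functions D.
      (\<integral>x. a x * (g D x \<bullet> grad \<phi> x) \<partial>lebesgue_on D) = (\<integral>x. f (w D x) * \<phi> x \<partial>lebesgue_on D))" by blast
  have W: "W1p_0 1 D (w D) (g D)" if "D \<in> \<A>" for D using g0 that by blast
  have EL: "(\<integral>x. a x * (g D x \<bullet> grad \<phi> x) \<partial>lebesgue_on D) = (\<integral>x. f (w D x) * \<phi> x \<partial>lebesgue_on D)"
    if "D \<in> \<A>" "\<phi> \<in> test_functions D" for D \<phi> using g0 that by blast
  let ?g = "extend_sum \<A> g"
  have wm: "w D \<in> borel_measurable (lebesgue_on D)" and gm: "g D \<in> borel_measurable (lebesgue_on D)"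
    and wi: "integrable (lebesgue_on D) (w D)" and gi: "integrable (lebesgue_on D) (g D)" if "D \<in> \<A>" for D
    using W[OF that] by (auto simp: W1p_0_def W1p_def Lp_on_def integrable_norm_iff integrable_abs_iff)
  have wg: "weak_gradient D (w D) (g D)" if "D \<in> \<A>" for D using W[OF that] by (simp add: W1p_0_def W1p_def)
  obtain Ba where Ba: "\<And>x. x \<in> \<Omega> \<Longrightarrow> \<bar>a x\<bar> \<le> Ba"
  proof -
    have "bounded (a ` closure \<Omega>)" using \<Omega>(2) a by (intro compact_imp_bounded compact_continuous_image) auto
    then obtain B where "\<And>x. x \<in> closure \<Omega> \<Longrightarrow> \<bar>a x\<bar> \<le> B" unfolding bounded_iff by auto
    then show ?thesis using that closure_subset by blast
  qed
  have am: "a \<in> borel_measurable (lebesgue_on D)" if "D \<in> \<A>" for D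
    using continuous_on_subset[OF a] D\<Omega>[OF that] closure_subset sD[OF that]
    by (intro continuous_imp_measurable_on_sets_lebesgue) blast+
  have bnd: "\<exists>K\<ge>0. AE x in lebesgue_on D. \<bar>w D x\<bar> \<le> K" if D: "D \<in> \<A>" for D
  proof -
    obtain K where "AE x in lebesgue_on D. \<bar>w D x\<bar> \<le> K" using sol(1)[OF D] by (auto simp: Linf_on_def)
    then have "AE x in lebesgue_on D. \<bar>w D x\<bar> \<le> max 0 K" by eventually_elim simp
    then show ?thesis by (intro exI[of _ "max 0 K"]) simp
  qed
  have fi: "integrable (lebesgue_on D) (\<lambda>x. f (w D x))" if D: "D \<in> \<A>" for D
  proof -
    interpret weighted_domain D "\<lambda>_. 1" 1 by (rule wd[OF D D])
    obtain K where K: "K \<ge> 0" "AE x in lebesgue_on D. \<bar>w D x\<bar> \<le> K" using bnd[OF D] by blast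
    have "bounded (f ` {- K..K})"
      by (intro compact_imp_bounded compact_continuous_image continuous_on_subset[OF f(1)]) auto
    then obtain B where B: "\<And>s. s \<in> {- K..K} \<Longrightarrow> \<bar>f s\<bar> \<le> B" unfolding bounded_iff real_norm_def by blast
    show ?thesis
    proof (rule integrable_const_bound[of _ B])
      show "AE x in lebesgue_on D. norm (f (w D x)) \<le> B"
        using K(2)
      proof eventually_elim
        case (elim x)
        then have "w D x \<in> {- K..K}" by auto
        from B[OF this] show ?case by simp
      qed
      show "(\<lambda>x. f (w D x)) \<in> borel_measurable (lebesgue_on D)"
        using measurable_compose[OF wm[OF D] borel_measurable_continuous_onI[OF f(1)]] .
    qed
  qed
  have uW: "W1p_0 1 U ?u ?g"
    unfolding W1p_0_def W1p_def Lp_on_def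
  proof (intro conjI allI impI)
    have i: "integrable (lebesgue_on U) ?u" "integrable (lebesgue_on U) ?g"
      using integral_extend_sum(1)[OF A(1) sD DU sU(1)] wi gi by blast+
    then show "?u \<in> borel_measurable (lebesgue_on U)" "?g \<in> borel_measurable (lebesgue_on U)"
      "integrable (lebesgue_on U) (\<lambda>x. norm (?u x) powr 1)" "integrable (lebesgue_on U) (\<lambda>x. norm (?g x) powr 1)"
      by auto
    show "weak_gradient U ?u ?g"
      unfolding weak_gradient_def
    proof (intro ballI)
      fix \<phi> and b :: 'a assume phi: "\<phi> \<in> test_functions U" and b: "b \<in> Basis"
      have 1: "integrable (lebesgue_on D) (\<lambda>x. w D x * (grad \<phi> x \<bullet> b))"
        and 2: "integrable (lebesgue_on D) (\<lambda>x. (g D x \<bullet> b) * \<phi> x)" if D: "D \<in> \<A>" for D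
      proof -
        interpret weighted_domain D "\<lambda>_. 1" 1 by (rule wd[OF D D])
        obtain B where B: "\<And>x. \<bar>\<phi> x\<bar> \<le> B" "\<And>x. norm (grad \<phi> x) \<le> B" using test_bounded[OF phi] by metis
        have "\<bar>grad \<phi> x \<bullet> b\<bar> \<le> B" for x using order_trans[OF Basis_le_norm[OF b] B(2)] .
        then show "integrable (lebesgue_on D) (\<lambda>x. w D x * (grad \<phi> x \<bullet> b))"
          using test_measurable[OF phi] by (intro integrable_mult_bounded(1)[OF wi[OF D]] borel_measurable_inner) auto
        show "integrable (lebesgue_on D) (\<lambda>x. (g D x \<bullet> b) * \<phi> x)"
          by (intro integrable_mult_bounded(1)[OF _ test_measurable(1)[OF phi] B(1)] integrable_inner_left gi D)
      qed
      have "(\<integral>x. ?u x * (grad \<phi> x \<bullet> b) \<partial>lebesgue_on U) = (\<Sum>D\<in>\<A>. \<integral>x. w D x * (grad \<phi> x \<bullet> b) \<partial>lebesgue_on D)"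
        unfolding extend_sum_mult[where k = "\<lambda>x. grad \<phi> x \<bullet> b"]
        by (intro integral_extend_sum(2) A(1) sD DU sU(1) 1)
      also have "\<dots> = (\<Sum>D\<in>\<A>. - (\<integral>x. (g D x \<bullet> b) * \<phi> x \<partial>lebesgue_on D))"
      proof (rule sum.cong[OF refl])
        fix D assume D: "D \<in> \<A>"
        note t = test_restrict_component[OF oU comp[OF D] phi]
        have "(\<integral>x. w D x * (grad \<phi> x \<bullet> b) \<partial>lebesgue_on D)
          = (\<integral>x. w D x * (grad (\<lambda>x. if x \<in> D then \<phi> x else 0) x \<bullet> b) \<partial>lebesgue_on D)"
          using t(2) by (intro Bochner_Integration.integral_cong) auto
        also have "\<dots> = - (\<integral>x. (g D x \<bullet> b) * (if x \<in> D then \<phi> x else 0) \<partial>lebesgue_on D)"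
          using wg[OF D] t(1) b unfolding weak_gradient_def by blast
        also have "(\<integral>x. (g D x \<bullet> b) * (if x \<in> D then \<phi> x else 0) \<partial>lebesgue_on D) = (\<integral>x. (g D x \<bullet> b) * \<phi> x \<partial>lebesgue_on D)"
          by (intro Bochner_Integration.integral_cong) auto
        finally show "(\<integral>x. w D x * (grad \<phi> x \<bullet> b) \<partial>lebesgue_on D) = - (\<integral>x. (g D x \<bullet> b) * \<phi> x \<partial>lebesgue_on D)" .
      qed
      also have "\<dots> = - (\<Sum>D\<in>\<A>. \<integral>x. (g D x \<bullet> b) * \<phi> x \<partial>lebesgue_on D)" by (rule sum_negf)
      also have "(\<Sum>D\<in>\<A>. \<integral>x. (g D x \<bullet> b) * \<phi> x \<partial>lebesgue_on D) = (\<integral>x. (?g x \<bullet> b) * \<phi> x \<partial>lebesgue_on U)"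
        unfolding extend_sum_inner[where v = "\<lambda>_. b"] extend_sum_mult[where k = \<phi>]
        by (intro integral_extend_sum(2)[symmetric] A(1) sD DU sU(1) 2)
      finally show "(\<integral>x. ?u x * (grad \<phi> x \<bullet> b) \<partial>lebesgue_on U) = - (\<integral>x. (?g x \<bullet> b) * \<phi> x \<partial>lebesgue_on U)" .
    qed
    fix e :: real assume e: "e > 0"
    \<comment> \<open>The tolerance is shared equally among the components.\<close>
    define d where "d = e / real (card \<A>)"
    have card: "card \<A> > 0" using A by (simp add: card_gt_0_iff)
    then have d: "d > 0" using e by (simp add: d_def)
    have "\<forall>D\<in>\<A>. \<exists>\<phi>. \<phi> \<in> test_functions D \<and>
      (\<integral>x. \<bar>w D x - \<phi> x\<bar> \<partial>lebesgue_on D) + (\<integral>x. norm (g D x - grad \<phi> x) \<partial>lebesgue_on D) < d"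
    proof
      fix D assume "D \<in> \<A>"
      then obtain \<phi> where phi: "\<phi> \<in> test_functions D"
        "((\<integral>x. \<bar>w D x - \<phi> x\<bar> powr 1 \<partial>lebesgue_on D) + (\<integral>x. norm (g D x - grad \<phi> x) powr 1 \<partial>lebesgue_on D)) powr (1 / 1) < d"
        using W d unfolding W1p_0_def by blast
      have "0 \<le> (\<integral>x. \<bar>w D x - \<phi> x\<bar> \<partial>lebesgue_on D) + (\<integral>x. norm (g D x - grad \<phi> x) \<partial>lebesgue_on D)"
        by (intro add_nonneg_nonneg integral_nonneg_AE) auto
      with phi show "\<exists>\<phi>. \<phi> \<in> test_functions D \<and>
        (\<integral>x. \<bar>w D x - \<phi> x\<bar> \<partial>lebesgue_on D) + (\<integral>x. norm (g D x - grad \<phi> x) \<partial>lebesgue_on D) < d"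
        by (intro exI[of _ \<phi>]) auto
    qed
    from bchoice[OF this] obtain \<phi> where phi0: "\<forall>D\<in>\<A>. \<phi> D \<in> test_functions D \<and>
      (\<integral>x. \<bar>w D x - \<phi> D x\<bar> \<partial>lebesgue_on D) + (\<integral>x. norm (g D x - grad (\<phi> D) x) \<partial>lebesgue_on D) < d" by blast
    then have phi: "\<phi> D \<in> test_functions D" "\<phi> D \<in> test_functions U" if "D \<in> \<A>" for D
      using that test_functions_mono[OF DU[OF that]] by auto
    \<comment> \<open>The approximants have supports in disjoint components, so their sum
      approximates the glued function with the sum of the errors.\<close>
    define \<Phi> where "\<Phi> x = (\<Sum>D\<in>\<A>. \<phi> D x)" for x
    have Phi: "\<Phi> \<in> test_functions U" "\<And>x. grad \<Phi> x = (\<Sum>D\<in>\<A>. grad (\<phi> D) x)"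
      unfolding \<Phi>_def[abs_def] using test_functions_sum[OF A(1), of \<phi> U] phi(2) by blast+
    have zero: "\<phi> D x = 0" "grad (\<phi> D) x = 0" if "D \<in> \<A>" "x \<notin> D" for D x
      using test_functions_zero_outside[OF phi(1)[OF that(1)] that(2)] by auto
    have ti: "integrable (lebesgue_on D) (\<phi> D)" "integrable (lebesgue_on D) (grad (\<phi> D))" if D: "D \<in> \<A>" for D
      using weighted_domain.test_integrable[OF wd[OF D D] phi(1)[OF D]] .
    have bu: "\<bar>?u x - \<Phi> x\<bar> \<le> extend_sum \<A> (\<lambda>D x. \<bar>w D x - \<phi> D x\<bar>) x" for x
    proof -
      have "?u x - \<Phi> x = (\<Sum>D\<in>\<A>. if x \<in> D then w D x - \<phi> D x else 0)"
        unfolding \<Phi>_def extend_sum_def sum_subtractf[symmetric] using zero by (intro sum.cong) auto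
      also have "\<bar>\<dots>\<bar> \<le> (\<Sum>D\<in>\<A>. \<bar>if x \<in> D then w D x - \<phi> D x else 0\<bar>)" by (rule sum_abs)
      also have "\<dots> = extend_sum \<A> (\<lambda>D x. \<bar>w D x - \<phi> D x\<bar>) x"
        unfolding extend_sum_def by (intro sum.cong) auto
      finally show ?thesis .
    qed
    have bg: "norm (?g x - grad \<Phi> x) \<le> extend_sum \<A> (\<lambda>D x. norm (g D x - grad (\<phi> D) x)) x" for x
    proof -
      have "?g x - grad \<Phi> x = (\<Sum>D\<in>\<A>. if x \<in> D then g D x - grad (\<phi> D) x else 0)"
        unfolding Phi(2) extend_sum_def sum_subtractf[symmetric] using zero by (intro sum.cong) auto
      also have "norm \<dots> \<le> (\<Sum>D\<in>\<A>. norm (if x \<in> D then g D x - grad (\<phi> D) x else 0))" by (rule norm_sum)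
      also have "\<dots> = extend_sum \<A> (\<lambda>D x. norm (g D x - grad (\<phi> D) x)) x"
        unfolding extend_sum_def by (intro sum.cong) auto
      finally show ?thesis .
    qed
    have iu: "integrable (lebesgue_on D) (\<lambda>x. \<bar>w D x - \<phi> D x\<bar>)" and ig: "integrable (lebesgue_on D) (\<lambda>x. norm (g D x - grad (\<phi> D) x))"
      if "D \<in> \<A>" for D
      using wi[OF that] gi[OF that] ti[OF that] by auto
    have su: "integrable (lebesgue_on U) (extend_sum \<A> (\<lambda>D x. \<bar>w D x - \<phi> D x\<bar>))"
      "integral\<^sup>L (lebesgue_on U) (extend_sum \<A> (\<lambda>D x. \<bar>w D x - \<phi> D x\<bar>)) = (\<Sum>D\<in>\<A>. \<integral>x. \<bar>w D x - \<phi> D x\<bar> \<partial>lebesgue_on D)"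
      by (intro integral_extend_sum A(1) sD DU sU(1) iu; assumption)+
    have sg: "integrable (lebesgue_on U) (extend_sum \<A> (\<lambda>D x. norm (g D x - grad (\<phi> D) x)))"
      "integral\<^sup>L (lebesgue_on U) (extend_sum \<A> (\<lambda>D x. norm (g D x - grad (\<phi> D) x))) = (\<Sum>D\<in>\<A>. \<integral>x. norm (g D x - grad (\<phi> D) x) \<partial>lebesgue_on D)"
      by (intro integral_extend_sum A(1) sD DU sU(1) ig; assumption)+
    have Phim: "\<Phi> \<in> borel_measurable (lebesgue_on U)" "grad \<Phi> \<in> borel_measurable (lebesgue_on U)"
      using weighted_domain.test_measurable[OF unit_weight[OF oU bounded_subset[OF \<Omega>(2) U\<Omega>]] Phi(1)] .
    have ju: "integrable (lebesgue_on U) (\<lambda>x. \<bar>?u x - \<Phi> x\<bar>)"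
      by (rule Bochner_Integration.integrable_bound[OF su(1)])
        (use i Phim bu in \<open>auto intro!: AE_I2 intro: order_trans[OF bu abs_ge_self]\<close>)
    have jg: "integrable (lebesgue_on U) (\<lambda>x. norm (?g x - grad \<Phi> x))"
      by (rule Bochner_Integration.integrable_bound[OF sg(1)])
        (use i Phim bg in \<open>auto intro!: AE_I2 intro: order_trans[OF bg abs_ge_self]\<close>)
    have "(\<integral>x. \<bar>?u x - \<Phi> x\<bar> \<partial>lebesgue_on U) + (\<integral>x. norm (?g x - grad \<Phi> x) \<partial>lebesgue_on U)
      \<le> (\<Sum>D\<in>\<A>. \<integral>x. \<bar>w D x - \<phi> D x\<bar> \<partial>lebesgue_on D) + (\<Sum>D\<in>\<A>. \<integral>x. norm (g D x - grad (\<phi> D) x) \<partial>lebesgue_on D)"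
      unfolding su(2)[symmetric] sg(2)[symmetric]
      by (intro add_mono integral_mono ju jg su sg bu bg)
    also have "\<dots> = (\<Sum>D\<in>\<A>. (\<integral>x. \<bar>w D x - \<phi> D x\<bar> \<partial>lebesgue_on D) + (\<integral>x. norm (g D x - grad (\<phi> D) x) \<partial>lebesgue_on D))"
      by (simp add: sum.distrib)
    also have "\<dots> < (\<Sum>D\<in>\<A>. d)" using phi0 A by (intro sum_strict_mono) auto
    also have "\<dots> = e" using card by (simp add: d_def)
    finally have lt: "(\<integral>x. \<bar>?u x - \<Phi> x\<bar> \<partial>lebesgue_on U) + (\<integral>x. norm (?g x - grad \<Phi> x) \<partial>lebesgue_on U) < e" .
    have "0 \<le> (\<integral>x. \<bar>?u x - \<Phi> x\<bar> \<partial>lebesgue_on U) + (\<integral>x. norm (?g x - grad \<Phi> x) \<partial>lebesgue_on U)"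
      by (intro add_nonneg_nonneg integral_nonneg_AE) auto
    with lt show "\<exists>\<phi>\<in>test_functions U. ((\<integral>x. \<bar>?u x - \<phi> x\<bar> powr 1 \<partial>lebesgue_on U) +
        (\<integral>x. norm (?g x - grad \<phi> x) powr 1 \<partial>lebesgue_on U)) powr (1 / 1) < e"
      by (intro bexI[OF _ Phi(1)]) auto
  qed
  have uEL: "(\<integral>x. a x * (?g x \<bullet> grad \<phi> x) \<partial>lebesgue_on \<Omega>) = (\<integral>x. f (?u x) * \<phi> x \<partial>lebesgue_on \<Omega>)"
    if phi: "\<phi> \<in> test_functions U" for \<phi>
  proof -
    have 1: "integrable (lebesgue_on D) (\<lambda>x. (g D x \<bullet> grad \<phi> x) * a x)"
      and 2: "integrable (lebesgue_on D) (\<lambda>x. f (w D x) * \<phi> x)" if D: "D \<in> \<A>" for D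
    proof -
      interpret weighted_domain D "\<lambda>_. 1" 1 by (rule wd[OF D D])
      obtain B where B: "B > 0" "\<And>x. \<bar>\<phi> x\<bar> \<le> B" "\<And>x. norm (grad \<phi> x) \<le> B" using test_bounded[OF phi] by metis
      show "integrable (lebesgue_on D) (\<lambda>x. f (w D x) * \<phi> x)"
        by (rule integrable_mult_bounded(1)[OF fi[OF D] test_measurable(1)[OF phi] B(2)])
      show "integrable (lebesgue_on D) (\<lambda>x. (g D x \<bullet> grad \<phi> x) * a x)"
      proof (rule Bochner_Integration.integrable_bound[of _ "\<lambda>x. norm (g D x) * B * Ba"])
        show "integrable (lebesgue_on D) (\<lambda>x. norm (g D x) * B * Ba)" using gi[OF D] by simp
        show "(\<lambda>x. (g D x \<bullet> grad \<phi> x) * a x) \<in> borel_measurable (lebesgue_on D)"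
          using gm[OF D] am[OF D] test_measurable(2)[OF phi]
          by (intro borel_measurable_times borel_measurable_inner)
        have "norm ((g D x \<bullet> grad \<phi> x) * a x) \<le> norm (norm (g D x) * B * Ba)" if "x \<in> D" for x
        proof -
          have "\<bar>a x\<bar> \<le> Ba" using Ba D\<Omega>[OF D] that by blast
          then have "\<bar>g D x \<bullet> grad \<phi> x\<bar> * \<bar>a x\<bar> \<le> (norm (g D x) * B) * Ba"
            using B(1) order_trans[OF Cauchy_Schwarz_ineq2[of "g D x" "grad \<phi> x"] mult_left_mono[OF B(3)[of x] norm_ge_zero]]
            by (intro mult_mono) auto
          also have "\<dots> \<le> \<bar>norm (g D x) * B * Ba\<bar>" by (rule abs_ge_self)
          finally show ?thesis by (simp only: real_norm_def abs_mult)
        qed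
        then show "AE x in lebesgue_on D. norm ((g D x \<bullet> grad \<phi> x) * a x) \<le> norm (norm (g D x) * B * Ba)"
          by (intro AE_I2) simp
      qed
    qed
    have "(\<integral>x. a x * (?g x \<bullet> grad \<phi> x) \<partial>lebesgue_on \<Omega>) = (\<integral>x. extend_sum \<A> (\<lambda>D x. (g D x \<bullet> grad \<phi> x) * a x) x \<partial>lebesgue_on \<Omega>)"
      unfolding extend_sum_inner[where v = "grad \<phi>"] mult.commute[of "a _"] extend_sum_mult[where k = a] ..
    also have "\<dots> = (\<Sum>D\<in>\<A>. \<integral>x. (g D x \<bullet> grad \<phi> x) * a x \<partial>lebesgue_on D)"
      by (intro integral_extend_sum(2) A(1) sD D\<Omega> sU(2) 1)
    also have "\<dots> = (\<Sum>D\<in>\<A>. \<integral>x. f (w D x) * \<phi> x \<partial>lebesgue_on D)"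
    proof (rule sum.cong[OF refl])
      fix D assume D: "D \<in> \<A>"
      note t = test_restrict_component[OF oU comp[OF D] phi]
      have "(\<integral>x. (g D x \<bullet> grad \<phi> x) * a x \<partial>lebesgue_on D)
        = (\<integral>x. a x * (g D x \<bullet> grad (\<lambda>x. if x \<in> D then \<phi> x else 0) x) \<partial>lebesgue_on D)"
        using t(2) by (intro Bochner_Integration.integral_cong) (auto simp: mult.commute)
      also have "\<dots> = (\<integral>x. f (w D x) * (if x \<in> D then \<phi> x else 0) \<partial>lebesgue_on D)"
        by (rule EL[OF D t(1)])
      also have "\<dots> = (\<integral>x. f (w D x) * \<phi> x \<partial>lebesgue_on D)"
        by (intro Bochner_Integration.integral_cong) auto
      finally show "(\<integral>x. (g D x \<bullet> grad \<phi> x) * a x \<partial>lebesgue_on D) = (\<integral>x. f (w D x) * \<phi> x \<partial>lebesgue_on D)" .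
    qed
    also have "\<dots> = (\<integral>x. extend_sum \<A> (\<lambda>D x. f (w D x) * \<phi> x) x \<partial>lebesgue_on \<Omega>)"
      by (intro integral_extend_sum(2)[symmetric] A(1) sD D\<Omega> sU(2) 2)
    also have "\<dots> = (\<integral>x. f (?u x) * \<phi> x \<partial>lebesgue_on \<Omega>)"
    proof (rule Bochner_Integration.integral_cong[OF refl])
      fix x
      show "extend_sum \<A> (\<lambda>D x. f (w D x) * \<phi> x) x = f (?u x) * \<phi> x"
      proof (cases "x \<in> \<Union>\<A>")
        case True
        then obtain D where D: "D \<in> \<A>" "x \<in> D" by blast
        show ?thesis by (simp only: val[OF D])
      qed (simp add: extend_sum_outside f(2))
    qed
    finally show ?thesis .
  qed
  have uLinf: "Linf_on \<Omega> ?u"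
    unfolding Linf_on_def
  proof
    show "?u \<in> borel_measurable (lebesgue_on \<Omega>)"
      unfolding extend_sum_def[abs_def] using sD sU D\<Omega> wm by (intro borel_measurable_sum extend_zero(3)) auto
    have "\<forall>D\<in>\<A>. \<exists>K\<ge>0. AE x in lebesgue_on D. \<bar>w D x\<bar> \<le> K" using bnd by blast
    from bchoice[OF this] obtain K where K: "\<forall>D\<in>\<A>. 0 \<le> K D \<and> (AE x in lebesgue_on D. \<bar>w D x\<bar> \<le> K D)" by blast
    have "AE x in lebesgue_on \<Omega>. \<forall>D\<in>\<A>. x \<in> D \<longrightarrow> \<bar>w D x\<bar> \<le> K D"
    proof (rule AE_all_components[OF A(1) _ sU(2)])
      show "D \<in> sets lebesgue" if "D \<in> \<A>" for D by (rule sD[OF that])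
      show "AE x in lebesgue_on D. \<bar>w D x\<bar> \<le> K D" if "D \<in> \<A>" for D using K that by blast
    qed
    then have "AE x in lebesgue_on \<Omega>. \<bar>?u x\<bar> \<le> (\<Sum>D\<in>\<A>. K D)"
    proof eventually_elim
      case (elim x)
      have "\<bar>?u x\<bar> \<le> (\<Sum>D\<in>\<A>. \<bar>if x \<in> D then w D x else 0\<bar>)" unfolding extend_sum_def by (rule sum_abs)
      also have "\<dots> \<le> (\<Sum>D\<in>\<A>. K D)" using elim K by (intro sum_mono) auto
      finally show ?case .
    qed
    then show "\<exists>K. AE x in lebesgue_on \<Omega>. \<bar>?u x\<bar> \<le> K" by blast
  qed
  have unn: "AE x in lebesgue_on \<Omega>. 0 \<le> ?u x"
  proof -
    have "AE x in lebesgue_on \<Omega>. \<forall>D\<in>\<A>. x \<in> D \<longrightarrow> 0 \<le> w D x"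
      using sol(3) by (intro AE_all_components[OF A(1) sD sU(2)])
    then show ?thesis by eventually_elim (auto simp: extend_sum_def intro!: sum_nonneg)
  qed
  have unt: "\<not> (AE x in lebesgue_on \<Omega>. ?u x = 0)"
  proof
    assume ae: "AE x in lebesgue_on \<Omega>. ?u x = 0"
    obtain D where D: "D \<in> \<A>" using A(3) by blast
    from AE_lebesgue_on_subset[OF sD[OF D] sU(2) D\<Omega>[OF D] ae]
    have "AE x in lebesgue_on D. ?u x = 0" .
    then have "AE x in lebesgue_on D. w D x = 0"
      using AE_space
    proof eventually_elim
      case (elim x)
      then show ?case using val[OF D, of x w] by simp
    qed
    with sol(4)[OF D] show False by blast
  qed
  show ?thesis
    unfolding nonneg_nontrivial_weak_solution_def weak_solution_def U_def[symmetric]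
    using uLinf uW uEL unn unt by blast
qed

text \<open>On a member of \<open>\<A>\<close> missing from \<open>\<B>\<close> the right-hand sum
  is zero, which would make the summand of \<open>\<A>\<close> vanish there almost
  everywhere.\<close>

lemma extend_sum_AE_eq_imp_subset:
  fixes \<Omega> :: "'a::euclidean_space set"
  assumes \<A>: "finite \<A>" "finite \<B>" "\<A> \<subseteq> \<C>" "\<B> \<subseteq> \<C>"
    and \<C>: "\<And>C D. C \<in> \<C> \<Longrightarrow> D \<in> \<C> \<Longrightarrow> C \<noteq> D \<Longrightarrow> C \<inter> D = {}" "\<And>D. D \<in> \<C> \<Longrightarrow> D \<subseteq> \<Omega>"
      "\<And>D. D \<in> \<C> \<Longrightarrow> D \<in> sets lebesgue" "\<Omega> \<in> sets lebesgue"
    and v: "\<And>D. D \<in> \<A> \<Longrightarrow> \<not> (AE x in lebesgue_on D. v D x = 0)"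
    and eq: "AE x in lebesgue_on \<Omega>. extend_sum \<A> v x = extend_sum \<B> w x"
  shows "\<A> \<subseteq> \<B>"
proof (rule ccontr)
  assume "\<not> \<A> \<subseteq> \<B>"
  then obtain D where D: "D \<in> \<A>" "D \<notin> \<B>" by blast
  then have DC: "D \<in> \<C>" using \<A> by blast
  have "AE x in lebesgue_on D. extend_sum \<A> v x = extend_sum \<B> w x"
    by (rule AE_lebesgue_on_subset[OF \<C>(3)[OF DC] \<C>(4) \<C>(2)[OF DC] eq])
  then have "AE x in lebesgue_on D. v D x = 0"
    using AE_space
  proof eventually_elim
    case (elim x)
    then have x: "x \<in> D" by simp
    have "x \<notin> \<Union>\<B>" using \<C>(1)[OF DC] D(2) x \<A>(4) by blast
    moreover have "extend_sum \<A> v x = v D x"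
      using \<A>(3) \<C>(1) by (intro extend_sum_eq[OF \<A>(1) _ D(1) x]) blast
    ultimately show ?case using elim(1) extend_sum_outside[of x \<B> w] by simp
  qed
  with v[OF D(1)] show False by blast
qed

text \<open>The family \<open>S\<close> is indexed by the nonempty sets of components, with one
  solution fixed on each component. Almost everywhere equality determines the index, which gives
  both counts.\<close>

theorem theorem1p1:
  fixes \<Omega> :: "'a::euclidean_space set"
    and a :: "'a \<Rightarrow> real"
    and f :: "real \<Rightarrow> real"
    and \<Gamma> :: "nat \<Rightarrow> 'a set"
    and k num_comps :: nat
    and t s0 \<gamma> :: real
  assumes dim: "2 \<le> DIM('a)"
    and domain: "smooth_bounded_domain \<Omega>"
    and a_cont: "continuous_on (closure \<Omega>) a"
    and a_nonneg: "\<forall>x\<in>closure \<Omega>. 0 \<le> a x"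
    and f_cont: "continuous_on UNIV f"
    and a1_zeros: "closure \<Omega> \<inter> a -` {0} = (\<Union>l\<in>{1..k}. \<Gamma> l)"
    and a1_inside: "(\<Union>l\<in>{1..k}. \<Gamma> l) \<subseteq> \<Omega>"
    and a1_disjoint: "disjoint_family_on \<Gamma> {1..k}"
    and a1_manifolds: "\<forall>l\<in>{1..k}. compact (\<Gamma> l) \<and> connected (\<Gamma> l) \<and> smooth_hypersurface (\<Gamma> l)"
    and a2_muckenhoupt: "muckenhoupt_A2 \<Omega> a"
    and a2_exponent: "t > real DIM('a) / 2"
    and a2_integrable: "Lp_on t \<Omega> (\<lambda>x. 1 / a x)"
    and f1_local_min: "f 0 = 0" "\<forall>\<^sub>F s in at 0. f 0 < f s"
    and f1_zero: "0 < s0" "f s0 = 0"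
    and f1_pos: "\<forall>s\<in>{0<..<s0}. 0 < f s"
    and f2_limit: "((\<lambda>s. f s / s) \<longlongrightarrow> \<gamma>) (at_right 0)"
    and f2_pos: "0 < \<gamma>"
    and f2_bound: "\<forall>D\<in>components (\<Omega> - a -` {0}).
                     (SUP x\<in>closure D. a x) < \<gamma> / first_eigenvalue D"
    and num_comps_eq: "num_comps = card (components (\<Omega> - a -` {0}))"
  shows "finite (components (\<Omega> - a -` {0})) \<and>
    (\<exists>S. finite S \<and>
       (\<forall>u\<in>S. nonneg_nontrivial_weak_solution \<Omega> a f u) \<and>
       (\<forall>u\<in>S. \<forall>v\<in>S. u \<noteq> v \<longrightarrow> \<not> (AE x in lebesgue_on \<Omega>. u x = v x)) \<and>
       card S = 2 ^ num_comps - 1 \<and>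
       (\<forall>n\<in>{1..num_comps}. card {u\<in>S. has_bumps \<Omega> a f n u} = num_comps choose n))"
proof -
  define Z where "Z = (\<Union>l\<in>{1..k}. \<Gamma> l)"
  have \<Omega>: "open \<Omega>" "connected \<Omega>" "bounded \<Omega>"
    using domain by (auto simp: smooth_bounded_domain_def)
  have diff: "\<Omega> - a -` {0} = \<Omega> - Z"
    using a1_zeros closure_subset[of \<Omega>] unfolding Z_def by blast
  have "compact Z" unfolding Z_def using a1_manifolds by (intro compact_UN) auto
  then have oU: "open (\<Omega> - a -` {0})"
    unfolding diff using \<Omega>(1) by (intro open_Diff compact_imp_closed)
  define \<C> where "\<C> = components (\<Omega> - a -` {0})"
  have fin: "finite \<C>"
    unfolding \<C>_def diff Z_def
  proof (rule finite_components_minus_hypersurfaces[OF \<Omega>(1,2) _ _ _ _ a1_disjoint])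
    show "\<Gamma> l \<subseteq> \<Omega>" if "l \<in> {1..k}" for l using a1_inside that by blast
  qed (use a1_manifolds in auto)
  have bistable: "bistable f s0 \<gamma>"
    using f_cont f1_zero f1_local_min(1) f1_pos f2_limit by unfold_locales auto
  have D_props: "open D" "D \<noteq> {}" "D \<subseteq> \<Omega>" "\<And>x. x \<in> D \<Longrightarrow> a x \<noteq> 0" if "D \<in> \<C>" for D
    using that open_components[OF oU] in_components_nonempty[of D] in_components_subset[of D "\<Omega> - a -` {0}"]
    unfolding \<C>_def by auto
  have meas: "D \<in> sets lebesgue" if "open D" for D :: "'a set" using that by auto
  interpret \<Omega>: weighted_domain \<Omega> "\<lambda>_. 1" 1 by (rule unit_weight[OF \<Omega>(1,3)])
  \<comment> \<open>From \<open>t > N / 2\<close> and \<open>N \<ge> 2\<close>; then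
    \<open>s \<le> 1 + s powr t\<close> gives integrability of \<open>1 / a\<close> on the bounded
    domain.\<close>
  have "1 \<le> t" using a2_exponent dim by simp
  have inv: "integrable (lebesgue_on \<Omega>) (\<lambda>x. 1 / a x)"
  proof (rule Bochner_Integration.integrable_bound[of _ "\<lambda>x. 1 + norm (1 / a x) powr t"])
    show "integrable (lebesgue_on \<Omega>) (\<lambda>x. 1 + norm (1 / a x) powr t)"
      "(\<lambda>x. 1 / a x) \<in> borel_measurable (lebesgue_on \<Omega>)"
      using a2_integrable by (simp_all add: Lp_on_def)
    have "s \<le> 1 + s powr t" if "0 \<le> s" for s :: real
    proof (cases "s \<le> 1")
      case False
      then have "s powr 1 \<le> s powr t" using \<open>1 \<le> t\<close> by (intro powr_mono) auto
      then show ?thesis using False by simp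
    qed (simp add: add_increasing2)
    then have "norm (1 / a x) \<le> norm (1 + norm (1 / a x) powr t)" for x
      by (metis abs_ge_self norm_ge_zero order_trans real_norm_def)
    then show "AE x in lebesgue_on \<Omega>. norm (1 / a x) \<le> norm (1 + norm (1 / a x) powr t)" by blast
  qed
  have "\<exists>u. nonneg_nontrivial_weak_solution D a f u" if D: "D \<in> \<C>" for D
  proof (rule component_solution[OF D_props(1)[OF D] _ D_props(2)[OF D] _ _ _ bistable f2_pos])
    show "bounded D" using bounded_subset[OF \<Omega>(3) D_props(3)[OF D]] .
    show "continuous_on (closure D) a"
      using continuous_on_subset[OF a_cont closure_mono[OF D_props(3)[OF D]]] .
    show "0 < a x" if "x \<in> D" for x
      using a_nonneg closure_subset[of \<Omega>] D_props(3,4)[OF D] that by force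
    have "integrable lebesgue (\<lambda>x. indicator D x *\<^sub>R (if x \<in> \<Omega> then 1 / a x else 0))"
      using inv meas \<Omega>(1) D_props(1)[OF D]
      by (intro integrable_mult_indicator) (simp_all add: Lebesgue_Measure.integrable_restrict_UNIV)
    also have "(\<lambda>x. indicator D x *\<^sub>R (if x \<in> \<Omega> then 1 / a x else 0)) = (\<lambda>x. if x \<in> D then 1 / a x else 0)"
      using D_props(3)[OF D] by (auto simp: fun_eq_iff)
    finally show "integrable (lebesgue_on D) (\<lambda>x. 1 / a x)"
      using meas[OF D_props(1)[OF D]] by (simp add: Lebesgue_Measure.integrable_restrict_UNIV)
    show "(SUP x\<in>closure D. a x) < \<gamma> / first_eigenvalue D"
      using f2_bound D unfolding \<C>_def by blast
  qed
  then have "\<forall>D\<in>\<C>. \<exists>u. nonneg_nontrivial_weak_solution D a f u" by blast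
  from bchoice[OF this] obtain w where w: "\<forall>D\<in>\<C>. nonneg_nontrivial_weak_solution D a f (w D)" by blast
  define u where "u \<A> = extend_sum \<A> w" for \<A>
  have dis: "C \<inter> D = {}" if "C \<in> \<C>" "D \<in> \<C>" "C \<noteq> D" for C D
    using components_nonoverlap[of C "\<Omega> - a -` {0}" D] that unfolding \<C>_def by blast
  have nontriv: "\<not> (AE x in lebesgue_on D. v x = 0)" if "nonneg_nontrivial_weak_solution D a f v" for D v
    using that by (simp add: nonneg_nontrivial_weak_solution_def)
  \<comment> \<open>Two different families \<open>v\<close> and \<open>z\<close> of solutions are
    allowed, because \<open>has_bumps\<close> may be witnessed by solutions other than the fixed
    \<open>w\<close>.\<close>
  have ident: "\<A> = \<B>"
    if "\<A> \<subseteq> \<C>" "\<B> \<subseteq> \<C>" "\<forall>D\<in>\<A>. nonneg_nontrivial_weak_solution D a f (v D)"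
      "\<forall>D\<in>\<B>. nonneg_nontrivial_weak_solution D a f (z D)"
      "AE x in lebesgue_on \<Omega>. extend_sum \<A> v x = extend_sum \<B> z x" for \<A> \<B> v z
  proof
    have f: "finite \<A>" "finite \<B>" using that fin finite_subset by blast+
    have eq': "AE x in lebesgue_on \<Omega>. extend_sum \<B> z x = extend_sum \<A> v x"
      using that(5) by eventually_elim simp
    have m: "\<And>D. D \<in> \<C> \<Longrightarrow> D \<in> sets lebesgue" "\<Omega> \<in> sets lebesgue"
      using meas D_props(1) \<Omega>(1) by blast+
    show "\<A> \<subseteq> \<B>"
      by (rule extend_sum_AE_eq_imp_subset[OF f that(1,2) dis D_props(3) m _ that(5)]) (use that(3) nontriv in auto)
    show "\<B> \<subseteq> \<A>"
      by (rule extend_sum_AE_eq_imp_subset[OF f(2,1) that(2,1) dis D_props(3) m _ eq']) (use that(4) nontriv in auto)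
  qed
  define P where "P = Pow \<C> - {{}}"
  have finP: "finite P" using fin by (simp add: P_def)
  have u_eq: "\<A> = \<B>" if "\<A> \<in> P" "\<B> \<in> P" "AE x in lebesgue_on \<Omega>. u \<A> x = u \<B> x" for \<A> \<B>
    using ident[of \<A> \<B> w w] that w unfolding P_def u_def by blast
  then have inj: "inj_on u P" by (auto simp: inj_on_def)
  have sol: "nonneg_nontrivial_weak_solution \<Omega> a f (u \<A>)" if "\<A> \<in> P" for \<A>
    unfolding u_def
  proof (rule glue_solutions[OF \<Omega>(1,3) oU a_cont f_cont f1_local_min(1)])
    show "finite \<A>" using that fin finite_subset by (auto simp: P_def)
    show "\<A> \<subseteq> components (\<Omega> - a -` {0})" "\<A> \<noteq> {}" using that by (auto simp: P_def \<C>_def)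
    show "nonneg_nontrivial_weak_solution D a f (w D)" if "D \<in> \<A>" for D
      using w that \<open>\<A> \<in> P\<close> by (auto simp: P_def)
  qed
  have bumps: "has_bumps \<Omega> a f n (u \<A>) \<longleftrightarrow> card \<A> = n" if A: "\<A> \<in> P" for \<A> n
  proof
    assume "has_bumps \<Omega> a f n (u \<A>)"
    then obtain \<D> v where D: "\<D> \<subseteq> \<C>" "card \<D> = n" "\<forall>D\<in>\<D>. nonneg_nontrivial_weak_solution D a f (v D)"
      "AE x in lebesgue_on \<Omega>. u \<A> x = (\<Sum>D\<in>\<D>. if x \<in> D then v D x else 0)"
      unfolding has_bumps_def \<C>_def by blast
    \<comment> \<open>Any witness of bumps for \<open>u \<A>\<close> uses the components of
      \<open>\<A>\<close>, so the number of bumps is \<open>card \<A>\<close> and no other.\<close>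
    have "\<A> = \<D>"
      by (rule ident[of \<A> \<D> w v]) (use A D w in \<open>auto simp: P_def u_def extend_sum_def\<close>)
    then show "card \<A> = n" using D by simp
  next
    assume n: "card \<A> = n"
    show "has_bumps \<Omega> a f n (u \<A>)"
      unfolding has_bumps_def
    proof (intro exI[of _ \<A>] exI[of _ w] conjI ballI)
      show "\<A> \<subseteq> components (\<Omega> - a -` {0})" "finite \<A>"
        using A fin finite_subset by (auto simp: P_def \<C>_def)
      show "nonneg_nontrivial_weak_solution D a f (w D)" if "D \<in> \<A>" for D
        using w that A by (auto simp: P_def)
    qed (simp_all add: n u_def extend_sum_def)
  qed
  have num: "num_comps = card \<C>" using num_comps_eq by (simp add: \<C>_def)
  show ?thesis
  proof (intro conjI exI[of _ "u ` P"])
    show "finite (components (\<Omega> - a -` {0}))" using fin by (simp add: \<C>_def)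
    show "finite (u ` P)" using finP by simp
    show "\<forall>v\<in>u ` P. nonneg_nontrivial_weak_solution \<Omega> a f v" using sol by blast
    show "\<forall>v\<in>u ` P. \<forall>z\<in>u ` P. v \<noteq> z \<longrightarrow> \<not> (AE x in lebesgue_on \<Omega>. v x = z x)"
      using u_eq by blast
    have "card P = 2 ^ num_comps - 1"
      unfolding P_def num using fin by (simp add: card_Diff_singleton card_Pow)
    then show "card (u ` P) = 2 ^ num_comps - 1" using card_image[OF inj] by simp
    show "\<forall>n\<in>{1..num_comps}. card {v \<in> u ` P. has_bumps \<Omega> a f n v} = num_comps choose n"
    proof
      fix n assume n: "n \<in> {1..num_comps}"
      \<comment> \<open>Since \<open>n \<ge> 1\<close>, the empty family, removed in
        \<open>P\<close>, does not occur on the left either.\<close>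
      have "{\<A>. \<A> \<subseteq> \<C> \<and> card \<A> = n} = {\<A> \<in> P. card \<A> = n}"
        using n by (auto simp: P_def)
      moreover have "{v \<in> u ` P. has_bumps \<Omega> a f n v} = u ` {\<A> \<in> P. card \<A> = n}"
        using bumps by auto
      moreover have "inj_on u {\<A> \<in> P. card \<A> = n}" by (rule inj_on_subset[OF inj]) auto
      ultimately show "card {v \<in> u ` P. has_bumps \<Omega> a f n v} = num_comps choose n"
        using n_subsets[OF fin, of n] by (simp add: card_image num)
    qed
  qed
qed

end
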